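(* Let $k$ be a field of characteristic zero, let $H$ be a trivially braided Hopf algebra over $k$ (i.e. a usual Hopf algebra, with braiding $x\otimes y\mapsto y\otimes x$) with coradical $H_0$, and let $K$ be a Hopf subalgebra of $H$ containing $H_0$. Let $\operatorname{gr}_K(H)$ be the graded Hopf algebra associated to the filtration $F_nH=\wedge^{n+1}K$, and let $i:K\hookrightarrow\operatorname{gr}_K(H)$ and $\pi:\operatorname{gr}_K(H)\twoheadrightarrow K$ be the canonical injection and projection. If either $i$ is central or $\pi$ is cocentral, then $H$ has a PBW basis as a $K$-module.
   Context: All objects are $k$-vector spaces, all maps are $k$-linear, $\otimes=\otimes_k$; Sweedler notation is used for comultiplications. Filtration: $\wedge^0K=0$, $\wedge^1K=K$, $\wedge^nK=\Delta_H^{-1}(K\otimes H+H\otimes\wedge^{n-1}K)$ for $n>1$. The filtration $F_nH=\wedge^{n+1}K$ is a Hopf algebra filtration, and $\operatorname{gr}_K(H)=\bigoplus_{n\ge0}F_nH/F_{n-1}H$ (with $F_{-1}H=0$) is the associated graded Hopf algebra, with structure maps $\nabla,1,\Delta,\varepsilon,S$ and trivial braiding $\mathfrak{c}(x\otimes y)=y\otimes x$. Here $K=F_0H$ is the degree $0$ component, and $i$, $\pi$ (inclusion of and projection onto degree $0$) are Hopf algebra morphisms. Central/cocentral (for the trivial braiding $\mathfrak{c}$): for a coalgebra $(A,\Delta_A,\varepsilon_A)$ and an algebra $(B,\nabla_B,1_B)$, a linear map $f:A\to B$ is central if $\nabla_B(f\otimes \mathrm{id}_B)=\nabla_B\mathfrak{c}(f\otimes\mathrm{id}_B)$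 and $\nabla_B(\mathrm{id}_B\otimes f)=\nabla_B\mathfrak{c}(\mathrm{id}_B\otimes f)$ (i.e. $f(a)b=bf(a)$ for all $a\in A$, $b\in B$); it is cocentral if $(f\otimes\mathrm{id}_A)\Delta_A=(f\otimes\mathrm{id}_A)\mathfrak{c}\Delta_A$ and $(\mathrm{id}_A\otimes f)\Delta_A=(\mathrm{id}_A\otimes f)\mathfrak{c}\Delta_A$ (i.e. $f(a_1)\otimes a_2=f(a_2)\otimes a_1$ for all $a\in A$). Braided objects: a braided vector space is a pair $(V,\mathfrak{c}_V)$ with $\mathfrak{c}_V:V^{\otimes 2}\to V^{\otimes 2}$ satisfying the braid equation $(\mathfrak{c}_V\otimes\mathrm{id})(\mathrm{id}\otimes\mathfrak{c}_V)(\mathfrak{c}_V\otimes\mathrm{id})=(\mathrm{id}\otimes\mathfrak{c}_V)(\mathfrak{c}_V\otimes\mathrm{id})(\mathrm{id}\otimes\mathfrak{c}_V)$. Write $\mathfrak{c}_j$ for $\mathfrak{c}_V$ applied in positions $j,j+1$ of $V^{\otimes n}$. A braided algebra is a braided vector space $(A,\mathfrak{c}_A)$ with an associative unital algebra structure $(\nabla,1)$ such that (with $\mathfrak{c}_j$ now formed from $\mathfrak{c}_A$) $\mathfrak{c}_A(\nabla\otimes\mathrm{id})=(\mathrm{id}\otimes\nabla)\mathfrak{c}_1\mathfrak{c}_2$, $\mathfrak{c}_A(\mathrm{id}\otimes\nabla)=(\nabla\otimes\mathrm{id})\mathfrak{c}_2\mathfrak{c}_1$, $\mathfrak{c}_A(1\otimes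 a)=a\otimes1$, $\mathfrak{c}_A(a\otimes1)=1\otimes a$. A grading is compatible with the braiding if each component $X$ satisfies $\mathfrak{c}_V(X\otimes V)\subseteq V\otimes X$ and $\mathfrak{c}_V(V\otimes X)\subseteq X\otimes V$; a braided graded vector space (resp. algebra) is a braided vector space (resp. algebra) with such a (resp. algebra) grading by nonnegative integers. Morphisms of braided graded algebras are graded unital algebra morphisms $f$ commuting with the braidings, i.e. $\mathfrak{c}(f\otimes f)=(f\otimes f)\mathfrak{c}$. For a braided graded vector space $V$, the tensor algebra $\mathcal{T}(V)$ is a braided algebra with braiding $\bigoplus_{n,m}\mathfrak{c}_{n,m}$, $\mathfrak{c}_{n,m}=(\mathfrak{c}_m\cdots\mathfrak{c}_{n+m-1})(\mathfrak{c}_{m-1}\cdots\mathfrak{c}_{n+m-2})\cdots(\mathfrak{c}_1\cdots\mathfrak{c}_n):V^{\otimes n}\otimes V^{\otimes m}\to V^{\otimes m}\otimes V^{\otimes n}$; the braided graded symmetric algebra $\mathcal{S}(V)$ is the quotient of $\mathcal{T}(V)$ by the ideal generated by $(\mathrm{id}-\mathfrak{c}_V)(V^{\otimes2})$, with induced braiding and with grading induced from that of $V$. PBW basis: let $K^+=K\cap\ker\varepsilon$, $J=H/HK^+$ (a quotient coalgebra of $H$), and let $\operatorname{gr}J$ be its associated graded coalgebra for the coradical filtration. Then $\operatorname{gr}J$ is identified with the graded subalgebra of $\pi$-coinvariants $R=\{b\in\operatorname{gr}_K(H) : \sum b_1\otimes\pi(b_2)=b\otimes 1\}=\{a_1S(\pi(a_2))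 : a\in\operatorname{gr}_K(H)\}$ of $\operatorname{gr}_K(H)$, and this makes $\operatorname{gr}J=R$ a braided graded algebra, with product that of $\operatorname{gr}_K(H)$ and braiding $\mathfrak{c}_R=(\mathrm{ad}_K\otimes\mathrm{id}_R)(\mathrm{id}_K\otimes\mathfrak{c})(\delta_R\otimes\mathrm{id}_R):R\otimes R\to R\otimes R$, where $\mathrm{ad}_K=\nabla(\nabla\otimes S)(\mathrm{id}_K\otimes\mathfrak{c})(\Delta\otimes\mathrm{id}_R):K\otimes R\to R$ and $\delta_R=(\pi\otimes\mathrm{id}_R)\Delta:R\to K\otimes R$. $H$ has a PBW basis as a $K$-module if $\operatorname{gr}J$ is isomorphic, as a braided graded algebra, to the braided graded symmetric algebra $\mathcal{S}(V)$ of some braided graded vector space $V$, and $\mathcal{S}(V)$ has a linear basis consisting of monomials $x_{i_1}\cdots x_{i_n}$, $n\ge0$, with (weakly) increasing letters $i_1\le\cdots\le i_n$ in some linear basis $\{x_i\}_{i\in I}$ of $V$ indexed by a well-ordered set $I$. *)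

theory Defs
  imports Complex_Main "HOL-Library.Poly_Mapping"
begin

section \<open>Vector spaces given as quotients of subspaces\<close>

text \<open>
  A value \<open>X\<close> of type \<open>kspace\<close> stands for the quotient \<open>car X / nul X\<close> of two subspaces of the
  vector space \<open>'a\<close>.  Elements of the quotient are given by representatives in \<open>car X\<close>; two
  representatives are equal in the quotient iff their difference lies in \<open>nul X\<close>.  Maps between
  quotients are functions on representatives that respect this equality.
\<close>

record ('k, 'a) kspace =
  scl :: "'k \<Rightarrow> 'a \<Rightarrow> 'a"
  car :: "'a set"
  nul :: "'a set"

definition kspace :: "('k::field, 'a::ab_group_add, 'z) kspace_scheme \<Rightarrow> bool" where
  "kspace X \<longleftrightarrow> vector_space (scl X) \<and> module.subspace (scl X) (car X)
     \<and> module.subspace (scl X) (nul X) \<and> nul X \<subseteq> car X"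

definition keq :: "('k, 'a::ab_group_add, 'z) kspace_scheme \<Rightarrow> 'a \<Rightarrow> 'a \<Rightarrow> bool" where
  "keq X x y \<longleftrightarrow> x - y \<in> nul X"

definition full_space :: "('k \<Rightarrow> 'a \<Rightarrow> 'a) \<Rightarrow> ('k, 'a::ab_group_add) kspace" where
  "full_space s = \<lparr>scl = s, car = UNIV, nul = {0}\<rparr>"

definition khom :: "('k::field, 'a::ab_group_add, 'y) kspace_scheme
    \<Rightarrow> ('k, 'b::ab_group_add, 'z) kspace_scheme \<Rightarrow> ('a \<Rightarrow> 'b) \<Rightarrow> bool" where
  "khom X Y f \<longleftrightarrow>
     (\<forall>x\<in>car X. f x \<in> car Y) \<and>
     (\<forall>x\<in>car X. \<forall>y\<in>car X. keq Y (f (x + y)) (f x + f y)) \<and>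
     (\<forall>c. \<forall>x\<in>car X. keq Y (f (scl X c x)) (scl Y c (f x))) \<and>
     (\<forall>x\<in>nul X. f x \<in> nul Y)"

text \<open>Linear independence is taken in the quotient; so distinct elements of \<open>B\<close> remain distinct there.\<close>

definition kbasis :: "('k::field, 'a::ab_group_add, 'z) kspace_scheme \<Rightarrow> 'a set \<Rightarrow> bool" where
  "kbasis X B \<longleftrightarrow> B \<subseteq> car X
     \<and> (\<forall>x\<in>car X. \<exists>y\<in>module.span (scl X) B. keq X x y)
     \<and> (\<forall>F c. finite F \<and> F \<subseteq> B \<and> (\<Sum>b\<in>F. scl X (c b) b) \<in> nul X \<longrightarrow> (\<forall>b\<in>F. c b = 0))"

definition kgrading :: "('k::field, 'a::ab_group_add, 'z) kspace_scheme \<Rightarrow> (nat \<Rightarrow> 'a set) \<Rightarrow> bool" where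
  "kgrading X G \<longleftrightarrow>
     (\<forall>n. module.subspace (scl X) (G n) \<and> nul X \<subseteq> G n \<and> G n \<subseteq> car X) \<and>
     car X = module.span (scl X) (\<Union>n. G n) \<and>
     (\<forall>F x. finite F \<and> (\<forall>n\<in>F. x n \<in> G n) \<and> (\<Sum>n\<in>F. x n) \<in> nul X \<longrightarrow> (\<forall>n\<in>F. x n \<in> nul X))"


section \<open>Tensor powers\<close>

text \<open>
  The tensor algebra of \<open>X\<close> is the free vector space on words (lists) over \<open>car X\<close> modulo
  multilinearity; the word \<open>[x\<^sub>1, \<dots>, x\<^sub>n]\<close> represents \<open>x\<^sub>1 \<otimes> \<dots> \<otimes> x\<^sub>n\<close>, and
  \<open>X \<otimes> X\<close> is the component \<open>tpow X 2\<close>.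
\<close>

abbreviation word :: "'w \<Rightarrow> ('w \<Rightarrow>\<^sub>0 'k::field)" where
  "word w \<equiv> Poly_Mapping.single w 1"

definition smul :: "'k \<Rightarrow> ('w \<Rightarrow>\<^sub>0 'k) \<Rightarrow> ('w \<Rightarrow>\<^sub>0 'k::field)" where
  "smul c p = Poly_Mapping.map ((*) c) p"

definition lin_ext :: "('k::field \<Rightarrow> 'b \<Rightarrow> 'b) \<Rightarrow> ('w \<Rightarrow> 'b) \<Rightarrow> ('w \<Rightarrow>\<^sub>0 'k) \<Rightarrow> 'b::comm_monoid_add" where
  "lin_ext s \<phi> p = (\<Sum>w\<in>Poly_Mapping.keys p. s (Poly_Mapping.lookup p w) (\<phi> w))"

definition tmul :: "('a list \<Rightarrow>\<^sub>0 'k::field) \<Rightarrow> ('a list \<Rightarrow>\<^sub>0 'k) \<Rightarrow> ('a list \<Rightarrow>\<^sub>0 'k)" where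
  "tmul p q = lin_ext smul (\<lambda>u. lin_ext smul (\<lambda>v. word (u @ v)) q) p"

definition tens_rel :: "('k::field, 'a::ab_group_add, 'z) kspace_scheme \<Rightarrow> ('a list \<Rightarrow>\<^sub>0 'k) set" where
  "tens_rel X =
     {word (u @ [x + y] @ v) - word (u @ [x] @ v) - word (u @ [y] @ v) | u x y v.
        set u \<subseteq> car X \<and> x \<in> car X \<and> y \<in> car X \<and> set v \<subseteq> car X}
   \<union> {word (u @ [scl X c x] @ v) - smul c (word (u @ [x] @ v)) | u c x v.
        set u \<subseteq> car X \<and> x \<in> car X \<and> set v \<subseteq> car X}
   \<union> {word (u @ [x] @ v) | u x v. set u \<subseteq> car X \<and> x \<in> nul X \<and> set v \<subseteq> car X}"

definition tens :: "('k::field, 'a::ab_group_add, 'z) kspace_scheme \<Rightarrow> ('k, 'a list \<Rightarrow>\<^sub>0 'k) kspace" where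
  "tens X = \<lparr>scl = smul,
     car = module.span smul {word w | w. set w \<subseteq> car X},
     nul = module.span smul (tens_rel X)\<rparr>"

definition tpow :: "('k::field, 'a::ab_group_add, 'z) kspace_scheme \<Rightarrow> nat
    \<Rightarrow> ('k, 'a list \<Rightarrow>\<^sub>0 'k) kspace" where
  "tpow X n = (let C = module.span smul {word w | w. set w \<subseteq> car X \<and> length w = n} in
     \<lparr>scl = smul, car = C, nul = nul (tens X) \<inter> C\<rparr>)"

text \<open>The subspace \<open>A \<otimes> B\<close> of \<open>X \<otimes> X\<close>, as the set of all its representatives.\<close>

definition tsub :: "('k::field, 'a::ab_group_add, 'z) kspace_scheme \<Rightarrow> 'a set \<Rightarrow> 'a set
    \<Rightarrow> ('a list \<Rightarrow>\<^sub>0 'k) set" where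
  "tsub X A B = {t \<in> car (tpow X 2).
     \<exists>t'\<in>module.span smul {word [a, b] | a b. a \<in> A \<and> b \<in> B}. keq (tpow X 2) t t'}"

definition tmap2 :: "('a \<Rightarrow> 'b) \<Rightarrow> ('a \<Rightarrow> 'b) \<Rightarrow> ('a list \<Rightarrow>\<^sub>0 'k::field) \<Rightarrow> ('b list \<Rightarrow>\<^sub>0 'k)" where
  "tmap2 f g t = lin_ext smul (\<lambda>w. word [f (w ! 0), g (w ! 1)]) t"

definition tswap :: "('a list \<Rightarrow>\<^sub>0 'k::field) \<Rightarrow> ('a list \<Rightarrow>\<^sub>0 'k)" where
  "tswap t = lin_ext smul (\<lambda>w. word [w ! 1, w ! 0]) t"


section \<open>Hopf algebras\<close>

locale hopf_algebra = vector_space scale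
  for scale :: "'k::field \<Rightarrow> 'h::ring_1 \<Rightarrow> 'h" +
  fixes comult :: "'h \<Rightarrow> ('h list \<Rightarrow>\<^sub>0 'k)" and counit :: "'h \<Rightarrow> 'k" and antipode :: "'h \<Rightarrow> 'h"
  assumes scale_mult_left: "scale c x * y = scale c (x * y)"
    and scale_mult_right: "x * scale c y = scale c (x * y)"
    and comult_hom: "khom (full_space scale) (tpow (full_space scale) 2) comult"
    and counit_linear: "Vector_Spaces.linear scale (*) counit"
    and coassoc: "keq (tpow (full_space scale) 3)
          (lin_ext smul (\<lambda>w. tmul (comult (w ! 0)) (word [w ! 1])) (comult x))
          (lin_ext smul (\<lambda>w. tmul (word [w ! 0]) (comult (w ! 1))) (comult x))"
    and counit_left: "lin_ext scale (\<lambda>w. scale (counit (w ! 0)) (w ! 1)) (comult x) = x"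
    and counit_right: "lin_ext scale (\<lambda>w. scale (counit (w ! 1)) (w ! 0)) (comult x) = x"
    and comult_mult: "keq (tpow (full_space scale) 2) (comult (x * y))
          (lin_ext smul (\<lambda>u. lin_ext smul (\<lambda>v. word [u ! 0 * v ! 0, u ! 1 * v ! 1]) (comult y))
             (comult x))"
    and comult_one: "keq (tpow (full_space scale) 2) (comult 1) (word [1, 1])"
    and counit_mult: "counit (x * y) = counit x * counit y"
    and counit_one: "counit 1 = 1"
    and antipode_linear: "Vector_Spaces.linear scale scale antipode"
    and antipode_left: "lin_ext scale (\<lambda>w. antipode (w ! 0) * w ! 1) (comult x) = scale (counit x) 1"
    and antipode_right: "lin_ext scale (\<lambda>w. w ! 0 * antipode (w ! 1)) (comult x) = scale (counit x) 1"

definition subcoalgebra :: "('k::field \<Rightarrow> 'h::ab_group_add \<Rightarrow> 'h) \<Rightarrow> ('h \<Rightarrow> ('h list \<Rightarrow>\<^sub>0 'k))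
    \<Rightarrow> 'h set \<Rightarrow> bool" where
  "subcoalgebra s \<Delta> C \<longleftrightarrow> module.subspace s C \<and> (\<forall>x\<in>C. \<Delta> x \<in> tsub (full_space s) C C)"

definition simple_subcoalgebra :: "('k::field \<Rightarrow> 'h::ab_group_add \<Rightarrow> 'h) \<Rightarrow> ('h \<Rightarrow> ('h list \<Rightarrow>\<^sub>0 'k))
    \<Rightarrow> 'h set \<Rightarrow> bool" where
  "simple_subcoalgebra s \<Delta> C \<longleftrightarrow> subcoalgebra s \<Delta> C \<and> C \<noteq> {0}
     \<and> (\<forall>D. subcoalgebra s \<Delta> D \<and> D \<subseteq> C \<longrightarrow> D = {0} \<or> D = C)"

definition coradical :: "('k::field \<Rightarrow> 'h::ab_group_add \<Rightarrow> 'h) \<Rightarrow> ('h \<Rightarrow> ('h list \<Rightarrow>\<^sub>0 'k)) \<Rightarrow> 'h set" where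
  "coradical s \<Delta> = module.span s (\<Union>{C. simple_subcoalgebra s \<Delta> C})"

definition hopf_subalgebra :: "('k::field \<Rightarrow> 'h::ring_1 \<Rightarrow> 'h) \<Rightarrow> ('h \<Rightarrow> ('h list \<Rightarrow>\<^sub>0 'k))
    \<Rightarrow> ('h \<Rightarrow> 'h) \<Rightarrow> 'h set \<Rightarrow> bool" where
  "hopf_subalgebra s \<Delta> S K \<longleftrightarrow> subcoalgebra s \<Delta> K \<and> 1 \<in> K
     \<and> (\<forall>x\<in>K. \<forall>y\<in>K. x * y \<in> K) \<and> (\<forall>x\<in>K. S x \<in> K)"

definition central_map :: "('k, 'a, 'y) kspace_scheme \<Rightarrow> ('k, 'b::ring_1, 'z) kspace_scheme
    \<Rightarrow> ('a \<Rightarrow> 'b) \<Rightarrow> bool" where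
  "central_map A B f \<longleftrightarrow> (\<forall>a\<in>car A. \<forall>b\<in>car B. keq B (f a * b) (b * f a))"

text \<open>
  Here the target of \<open>f\<close> is a subspace of \<open>A\<close>, so that both sides can be compared in \<open>A \<otimes> A\<close>
  (tensor products over a field preserve injections).
\<close>

definition cocentral_map :: "('k::field, 'a::ab_group_add, 'z) kspace_scheme
    \<Rightarrow> ('a \<Rightarrow> ('a list \<Rightarrow>\<^sub>0 'k)) \<Rightarrow> ('a \<Rightarrow> 'a) \<Rightarrow> bool" where
  "cocentral_map A \<Delta> f \<longleftrightarrow> (\<forall>a\<in>car A.
     keq (tpow A 2) (tmap2 f (\<lambda>x. x) (\<Delta> a)) (tmap2 f (\<lambda>x. x) (tswap (\<Delta> a))) \<and>
     keq (tpow A 2) (tmap2 (\<lambda>x. x) f (\<Delta> a)) (tmap2 (\<lambda>x. x) f (tswap (\<Delta> a))))"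


section \<open>The associated graded Hopf algebra\<close>

fun wedge :: "('k::field \<Rightarrow> 'h::ab_group_add \<Rightarrow> 'h) \<Rightarrow> ('h \<Rightarrow> ('h list \<Rightarrow>\<^sub>0 'k)) \<Rightarrow> 'h set
    \<Rightarrow> nat \<Rightarrow> 'h set" where
  "wedge s \<Delta> K 0 = {0}"
| "wedge s \<Delta> K (Suc 0) = K"
| "wedge s \<Delta> K (Suc (Suc n)) = {x. \<exists>t u.
     t \<in> tsub (full_space s) K UNIV \<and>
     u \<in> tsub (full_space s) UNIV (wedge s \<Delta> K (Suc n)) \<and>
     keq (tpow (full_space s) 2) (\<Delta> x) (t + u)}"

text \<open>
  With \<open>F\<^sub>n = wedge (Suc n)\<close>, an element of the sum of the \<open>F\<^sub>n / F\<^sub>n\<^sub>-\<^sub>1\<close> is represented by a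
  finitely supported sequence \<open>a\<close> with \<open>a\<^sub>n \<in> F\<^sub>n\<close>; it is zero if \<open>a\<^sub>n \<in> F\<^sub>n\<^sub>-\<^sub>1\<close> for all \<open>n\<close>.  The
  product is the convolution product of \<open>nat \<Rightarrow>\<^sub>0 'h\<close>, and its unit is \<open>1\<close>.
\<close>

definition gr :: "('k::field \<Rightarrow> 'h::ring_1 \<Rightarrow> 'h) \<Rightarrow> ('h \<Rightarrow> ('h list \<Rightarrow>\<^sub>0 'k)) \<Rightarrow> 'h set
    \<Rightarrow> ('k, nat \<Rightarrow>\<^sub>0 'h) kspace" where
  "gr s \<Delta> K = \<lparr>scl = (\<lambda>c. Poly_Mapping.map (s c)),
     car = {a. \<forall>n. Poly_Mapping.lookup a n \<in> wedge s \<Delta> K (Suc n)},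
     nul = {a. \<forall>n. Poly_Mapping.lookup a n \<in> wedge s \<Delta> K n}\<rparr>"

definition ungrade :: "(nat \<Rightarrow>\<^sub>0 'h) \<Rightarrow> 'h::comm_monoid_add" where
  "ungrade a = (\<Sum>n\<in>Poly_Mapping.keys a. Poly_Mapping.lookup a n)"

text \<open>
  On the class of \<open>x \<in> F\<^sub>n\<close>, the comultiplication is obtained by writing \<open>\<Delta> x\<close> as a sum of tensors
  \<open>y \<otimes> z\<close> with \<open>y \<in> F\<^sub>i\<close>, \<open>z \<in> F\<^sub>j\<close>, \<open>i + j = n\<close>, and placing \<open>y\<close> in degree \<open>i\<close> and \<open>z\<close> in degree \<open>j\<close>.
  The result does not depend on the decomposition, as an element of the tensor square of \<open>gr\<close>.
\<close>

definition gr_comult_at :: "('k::field \<Rightarrow> 'h::ring_1 \<Rightarrow> 'h) \<Rightarrow> ('h \<Rightarrow> ('h list \<Rightarrow>\<^sub>0 'k)) \<Rightarrow> 'h set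
    \<Rightarrow> nat \<Rightarrow> 'h \<Rightarrow> ((nat \<Rightarrow>\<^sub>0 'h) list \<Rightarrow>\<^sub>0 'k)" where
  "gr_comult_at s \<Delta> K n x = (SOME t.
     t \<in> module.span smul {word [Poly_Mapping.single i y, Poly_Mapping.single j z] | i j y z.
            i + j = n \<and> y \<in> wedge s \<Delta> K (Suc i) \<and> z \<in> wedge s \<Delta> K (Suc j)} \<and>
     keq (tpow (full_space s) 2) (tmap2 ungrade ungrade t) (\<Delta> x))"

definition gr_comult :: "('k::field \<Rightarrow> 'h::ring_1 \<Rightarrow> 'h) \<Rightarrow> ('h \<Rightarrow> ('h list \<Rightarrow>\<^sub>0 'k)) \<Rightarrow> 'h set
    \<Rightarrow> (nat \<Rightarrow>\<^sub>0 'h) \<Rightarrow> ((nat \<Rightarrow>\<^sub>0 'h) list \<Rightarrow>\<^sub>0 'k)" where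
  "gr_comult s \<Delta> K a =
     (\<Sum>n\<in>Poly_Mapping.keys a. gr_comult_at s \<Delta> K n (Poly_Mapping.lookup a n))"

definition gr_antipode :: "('h \<Rightarrow> 'h) \<Rightarrow> (nat \<Rightarrow>\<^sub>0 'h) \<Rightarrow> (nat \<Rightarrow>\<^sub>0 'h::ring_1)" where
  "gr_antipode S a = Poly_Mapping.map S a"

definition gr_incl :: "'h::ring_1 \<Rightarrow> (nat \<Rightarrow>\<^sub>0 'h)" where
  "gr_incl x = Poly_Mapping.single 0 x"

text \<open>The projection onto \<open>K\<close>, with \<open>K\<close> identified with the degree zero component.\<close>

definition gr_proj :: "(nat \<Rightarrow>\<^sub>0 'h) \<Rightarrow> (nat \<Rightarrow>\<^sub>0 'h::ring_1)" where
  "gr_proj a = Poly_Mapping.single 0 (Poly_Mapping.lookup a 0)"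


section \<open>Braided graded spaces and algebras\<close>

text \<open>
  The braiding is a map on representatives of the tensor square.  The sets \<open>grd X n\<close> contain all
  representatives of the elements of degree \<open>n\<close>.
\<close>

record (overloaded) ('k::zero, 'a) bgspace = "('k, 'a) kspace" +
  brd :: "('a list \<Rightarrow>\<^sub>0 'k) \<Rightarrow> ('a list \<Rightarrow>\<^sub>0 'k)"
  grd :: "nat \<Rightarrow> 'a set"

record (overloaded) ('k::zero, 'a) bgalg = "('k, 'a) bgspace" +
  mlt :: "'a \<Rightarrow> 'a \<Rightarrow> 'a"
  unt :: "'a"

text \<open>The map \<open>c\<^sub>j\<close> applying \<open>c\<close> in positions \<open>j\<close>, \<open>j + 1\<close>, counted from 1.\<close>

definition brd_at :: "(('a list \<Rightarrow>\<^sub>0 'k) \<Rightarrow> ('a list \<Rightarrow>\<^sub>0 'k)) \<Rightarrow> nat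
    \<Rightarrow> ('a list \<Rightarrow>\<^sub>0 'k::field) \<Rightarrow> ('a list \<Rightarrow>\<^sub>0 'k)" where
  "brd_at c j t = lin_ext smul (\<lambda>w. tmul (word (take (j - 1) w))
     (tmul (c (word [w ! (j - 1), w ! j])) (word (drop (j + 1) w)))) t"

definition braided_graded_space :: "('k::field, 'a::ab_group_add, 'z) bgspace_scheme \<Rightarrow> bool" where
  "braided_graded_space V \<longleftrightarrow> kspace V \<and> kgrading V (grd V) \<and>
     khom (tpow V 2) (tpow V 2) (brd V) \<and>
     (\<forall>t\<in>car (tpow V 3). keq (tpow V 3)
        (brd_at (brd V) 1 (brd_at (brd V) 2 (brd_at (brd V) 1 t)))
        (brd_at (brd V) 2 (brd_at (brd V) 1 (brd_at (brd V) 2 t)))) \<and>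
     (\<forall>n. brd V ` tsub V (grd V n) (car V) \<subseteq> tsub V (car V) (grd V n)) \<and>
     (\<forall>n. brd V ` tsub V (car V) (grd V n) \<subseteq> tsub V (grd V n) (car V))"

definition bgalg_iso :: "('k::field, 'a::ab_group_add, 'y) bgalg_scheme
    \<Rightarrow> ('k, 'b::ab_group_add, 'z) bgalg_scheme \<Rightarrow> ('a \<Rightarrow> 'b) \<Rightarrow> bool" where
  "bgalg_iso A B f \<longleftrightarrow> khom A B f \<and>
     (\<forall>x\<in>car A. f x \<in> nul B \<longrightarrow> x \<in> nul A) \<and>
     (\<forall>y\<in>car B. \<exists>x\<in>car A. keq B (f x) y) \<and>
     keq B (f (unt A)) (unt B) \<and>
     (\<forall>x\<in>car A. \<forall>y\<in>car A. keq B (f (mlt A x y)) (mlt B (f x) (f y))) \<and>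
     (\<forall>n. f ` grd A n \<subseteq> grd B n) \<and>
     (\<forall>t\<in>car (tpow A 2). keq (tpow B 2) (tmap2 f f (brd A t)) (brd B (tmap2 f f t)))"

text \<open>\<open>brd_row c i n = c\<^sub>i \<circ> \<dots> \<circ> c\<^sub>i\<^sub>+\<^sub>n\<^sub>-\<^sub>1\<close> and
  \<open>brd_block c n m = brd_row c m n \<circ> \<dots> \<circ> brd_row c 1 n\<close>\<close>

definition brd_row :: "(('a list \<Rightarrow>\<^sub>0 'k) \<Rightarrow> ('a list \<Rightarrow>\<^sub>0 'k)) \<Rightarrow> nat \<Rightarrow> nat
    \<Rightarrow> ('a list \<Rightarrow>\<^sub>0 'k::field) \<Rightarrow> ('a list \<Rightarrow>\<^sub>0 'k)" where
  "brd_row c i n = foldr (\<lambda>j g. brd_at c j \<circ> g) [i..<i + n] id"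

definition brd_block :: "(('a list \<Rightarrow>\<^sub>0 'k) \<Rightarrow> ('a list \<Rightarrow>\<^sub>0 'k)) \<Rightarrow> nat \<Rightarrow> nat
    \<Rightarrow> ('a list \<Rightarrow>\<^sub>0 'k::field) \<Rightarrow> ('a list \<Rightarrow>\<^sub>0 'k)" where
  "brd_block c n m = foldr (\<lambda>i g. brd_row c i n \<circ> g) (rev [1..<m + 1]) id"

text \<open>
  The braiding of the tensor algebra: a product of words \<open>u \<otimes> v\<close> is sent to
  \<open>brd_block c (length u) (length v) (u @ v)\<close>, split after the first \<open>length v\<close> letters.
\<close>

definition tens_brd :: "(('a list \<Rightarrow>\<^sub>0 'k) \<Rightarrow> ('a list \<Rightarrow>\<^sub>0 'k))
    \<Rightarrow> (('a list \<Rightarrow>\<^sub>0 'k::field) list \<Rightarrow>\<^sub>0 'k) \<Rightarrow> (('a list \<Rightarrow>\<^sub>0 'k) list \<Rightarrow>\<^sub>0 'k)" where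
  "tens_brd c t = lin_ext smul (\<lambda>pq. lin_ext smul (\<lambda>u. lin_ext smul (\<lambda>v.
       lin_ext smul (\<lambda>w. word [word (take (length v) w), word (drop (length v) w)])
         (brd_block c (length u) (length v) (word (u @ v))))
       (pq ! 1)) (pq ! 0)) t"

definition sym_nul :: "('k::field, 'a::ab_group_add, 'z) bgspace_scheme \<Rightarrow> ('a list \<Rightarrow>\<^sub>0 'k) set" where
  "sym_nul V = module.span smul (nul (tens V) \<union>
     {tmul p (tmul (t - brd V t) q) | p t q.
        p \<in> car (tens V) \<and> t \<in> car (tpow V 2) \<and> q \<in> car (tens V)})"

definition sym_alg :: "('k::field, 'a::ab_group_add, 'z) bgspace_scheme
    \<Rightarrow> ('k, 'a list \<Rightarrow>\<^sub>0 'k) bgalg" where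
  "sym_alg V = \<lparr>scl = smul, car = car (tens V), nul = sym_nul V,
     brd = tens_brd (brd V),
     grd = (\<lambda>n. module.span smul (sym_nul V \<union>
       {word w | w d. list_all2 (\<lambda>x i. x \<in> grd V i) w d \<and> sum_list d = n})),
     mlt = tmul, unt = word []\<rparr>"


section \<open>Coinvariants and PBW bases\<close>

definition coinv :: "('k::field \<Rightarrow> 'h::ring_1 \<Rightarrow> 'h) \<Rightarrow> ('h \<Rightarrow> ('h list \<Rightarrow>\<^sub>0 'k)) \<Rightarrow> 'h set
    \<Rightarrow> ('k, nat \<Rightarrow>\<^sub>0 'h) kspace" where
  "coinv s \<Delta> K = (gr s \<Delta> K)\<lparr>car := {b \<in> car (gr s \<Delta> K).
     keq (tpow (gr s \<Delta> K) 2) (tmap2 (\<lambda>x. x) gr_proj (gr_comult s \<Delta> K b)) (word [b, 1])}\<rparr>"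

definition gr_ad :: "('k::field \<Rightarrow> 'h::ring_1 \<Rightarrow> 'h) \<Rightarrow> ('h \<Rightarrow> ('h list \<Rightarrow>\<^sub>0 'k)) \<Rightarrow> ('h \<Rightarrow> 'h) \<Rightarrow> 'h set
    \<Rightarrow> (nat \<Rightarrow>\<^sub>0 'h) \<Rightarrow> (nat \<Rightarrow>\<^sub>0 'h) \<Rightarrow> (nat \<Rightarrow>\<^sub>0 'h)" where
  "gr_ad s \<Delta> S K a r = lin_ext (scl (gr s \<Delta> K)) (\<lambda>w. w ! 0 * r * gr_antipode S (w ! 1))
     (gr_comult s \<Delta> K a)"

definition gr_coact :: "('k::field \<Rightarrow> 'h::ring_1 \<Rightarrow> 'h) \<Rightarrow> ('h \<Rightarrow> ('h list \<Rightarrow>\<^sub>0 'k)) \<Rightarrow> 'h set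
    \<Rightarrow> (nat \<Rightarrow>\<^sub>0 'h) \<Rightarrow> ((nat \<Rightarrow>\<^sub>0 'h) list \<Rightarrow>\<^sub>0 'k)" where
  "gr_coact s \<Delta> K r = tmap2 gr_proj (\<lambda>x. x) (gr_comult s \<Delta> K r)"

text \<open>
  \<open>r \<otimes> r' \<mapsto> ad(r\<^sub>(\<^sub>-\<^sub>1\<^sub>), r') \<otimes> r\<^sub>(\<^sub>0\<^sub>)\<close>.  The formula gives a tensor over \<open>gr\<close>;
  \<open>coinv_brd\<close> re-expresses it by a tensor over the coinvariants, which is unique up to equality
  in their tensor square.
\<close>

definition coinv_brd :: "('k::field \<Rightarrow> 'h::ring_1 \<Rightarrow> 'h) \<Rightarrow> ('h \<Rightarrow> ('h list \<Rightarrow>\<^sub>0 'k)) \<Rightarrow> ('h \<Rightarrow> 'h)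
    \<Rightarrow> 'h set \<Rightarrow> ((nat \<Rightarrow>\<^sub>0 'h) list \<Rightarrow>\<^sub>0 'k) \<Rightarrow> ((nat \<Rightarrow>\<^sub>0 'h) list \<Rightarrow>\<^sub>0 'k)" where
  "coinv_brd s \<Delta> S K t = (SOME t'. t' \<in> car (tpow (coinv s \<Delta> K) 2) \<and>
     keq (tpow (gr s \<Delta> K) 2) t'
       (lin_ext smul (\<lambda>w. lin_ext smul (\<lambda>v. word [gr_ad s \<Delta> S K (v ! 0) (w ! 1), v ! 1])
          (gr_coact s \<Delta> K (w ! 0))) t))"

definition coinv_alg :: "('k::field \<Rightarrow> 'h::ring_1 \<Rightarrow> 'h) \<Rightarrow> ('h \<Rightarrow> ('h list \<Rightarrow>\<^sub>0 'k)) \<Rightarrow> ('h \<Rightarrow> 'h)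
    \<Rightarrow> 'h set \<Rightarrow> ('k, nat \<Rightarrow>\<^sub>0 'h) bgalg" where
  "coinv_alg s \<Delta> S K = \<lparr>scl = scl (coinv s \<Delta> K), car = car (coinv s \<Delta> K), nul = nul (coinv s \<Delta> K),
     brd = coinv_brd s \<Delta> S K,
     grd = (\<lambda>n. {b \<in> car (coinv s \<Delta> K). \<forall>m. m \<noteq> n \<longrightarrow> Poly_Mapping.lookup b m \<in> wedge s \<Delta> K m}),
     mlt = (*), unt = 1\<rparr>"

text \<open>
  The graded coalgebra of \<open>J = H/HK\<^sup>+\<close> is the algebra of coinvariants, which carries its braided
  algebra structure.  It costs no generality to let the space \<open>V\<close> have representatives in
  \<open>nat \<Rightarrow>\<^sub>0 'h\<close>: the PBW condition makes \<open>V\<close> embed into its symmetric algebra, hence into the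
  coinvariants.  The index set of the basis of \<open>V\<close> is the basis itself, well-ordered by \<open>r\<close>.
\<close>

definition has_PBW_basis :: "('k::field \<Rightarrow> 'h::ring_1 \<Rightarrow> 'h) \<Rightarrow> ('h \<Rightarrow> ('h list \<Rightarrow>\<^sub>0 'k)) \<Rightarrow> ('h \<Rightarrow> 'h)
    \<Rightarrow> 'h set \<Rightarrow> bool" where
  "has_PBW_basis s \<Delta> S K \<longleftrightarrow> (\<exists>V :: ('k, nat \<Rightarrow>\<^sub>0 'h) bgspace.
     braided_graded_space V \<and>
     (\<exists>f. bgalg_iso (coinv_alg s \<Delta> S K) (sym_alg V) f) \<and>
     (\<exists>B r. kbasis V B \<and> well_order_on B r \<and>
        kbasis (sym_alg V) {word w | w. set w \<subseteq> B \<and> sorted_wrt (\<lambda>x y. (x, y) \<in> r) w}))"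

end

theory Submission
  imports Defs "HOL-Library.Multiset"
begin

text \<open>
  Functionals \<open>f\<close> on \<open>H\<close> act by \<open>x \<mapsto> f(x\<^sub>1)x\<^sub>2\<close>, and the filtration, its multiplicativity and the
  coinvariants are all described through this action, without passing to quotients:
  the coinvariants of degree \<open>n\<close> are represented by the set \<open>A n\<close> of those \<open>x \<in> F\<^sub>n\<close> with
  \<open>f(x\<^sub>1)x\<^sub>2 = f(x)1\<close> for all \<open>f\<close> vanishing on \<open>F\<^sub>n\<^sub>-\<^sub>1\<close>.

  In both cases the braiding of the coinvariants is the flip.  They are commutative: by induction on
  the degree, a commutator in degree \<open>n \<ge> 2\<close> has no component in \<open>gr\<^sub>1 \<otimes> gr\<^sub>n\<^sub>-\<^sub>1\<close>, hence lies in \<open>F\<^sub>n\<^sub>-\<^sub>1\<close> by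
  the definition of the wedge.  A functional of degree \<open>d\<close> that vanishes on decomposable coinvariants
  acts as a derivation of degree \<open>-d\<close>; in the central case it must first be composed with the retraction
  \<open>a \<mapsto> a\<^sub>1 S(\<pi>(a\<^sub>2))\<close>.  Take homogeneous generators that are linearly independent modulo decomposables.  In a
  polynomial relation between them of minimal weight, the derivation dual to a generator of maximal
  degree acts as a partial derivative and, in characteristic zero, gives a shorter relation.  So the
  coinvariants form a polynomial algebra, the symmetric algebra of a trivially braided space.
\<close>

section \<open>Linear algebra and tensor powers\<close>

text \<open>Tensors are representatives modulo relations, and the graded comultiplication and the
  braiding are chosen representatives. They are known only through pairings with f \<otimes> g;
  these separate tensors, so identities are tested on functionals. Both hypotheses enter through one
  dichotomy for a leg of degree zero in \<Delta>(x), x coinvariant: it commutes with the graded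
  algebra (central case), or it may be replaced by 1 (cocentral case). A product of two legs of
  total degree one has a factor of degree zero, and so the component of a commutator in gr_1
  \<otimes> gr_(n-1) vanishes. The retraction is needed because coinvariants form only a left
  coideal: left legs of \<Delta>(x) lie in the whole graded algebra, where vanishing on decomposable
  coinvariants says nothing. In the cocentral case left legs are coinvariant too. In the central
  case they are sums of ak with a coinvariant and k in K, and the retraction sends ak to
  \<epsilon>(k)a. The generator chosen in a relation has maximal degree so that its derivation sends
  every letter of the relation to a known scalar.\<close>

definition linmap :: "('k \<Rightarrow> 'a \<Rightarrow> 'a) \<Rightarrow> ('k \<Rightarrow> 'b \<Rightarrow> 'b) \<Rightarrow> ('a::ab_group_add \<Rightarrow> 'b::ab_group_add) \<Rightarrow> bool"
  where "linmap s m f \<longleftrightarrow> (\<forall>x y. f (x + y) = f x + f y) \<and> (\<forall>c x. f (s c x) = m c (f x))"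

lemma linmapI:
  "(\<And>x y. f (x + y) = f x + f y) \<Longrightarrow> (\<And>c x. f (s c x) = m c (f x)) \<Longrightarrow> linmap s m f"
  by (auto simp: linmap_def)

lemma linmap_add: "linmap s m f \<Longrightarrow> f (x + y) = f x + f y"
  and linmap_scale: "linmap s m f \<Longrightarrow> f (s c x) = m c (f x)"
  by (auto simp: linmap_def)

lemma linmap_0: "linmap s m f \<Longrightarrow> f 0 = 0"
  using linmap_add[of s m f 0 0] by simp

lemma linmap_minus: "linmap s m f \<Longrightarrow> f (- x) = - f x"
  using linmap_add[of s m f x "- x"] by (simp add: linmap_0 eq_neg_iff_add_eq_0 add.commute)

lemma linmap_diff: "linmap s m f \<Longrightarrow> f (x - y) = f x - f y"
  using linmap_add[of s m f x "- y"] by (simp add: linmap_minus)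

lemma linmap_sum: "linmap s m f \<Longrightarrow> f (sum g A) = (\<Sum>a\<in>A. f (g a))"
  by (induction A rule: infinite_finite_induct) (auto simp: linmap_0 linmap_add)

lemma linmap_comp: "linmap s m f \<Longrightarrow> linmap r s g \<Longrightarrow> linmap r m (\<lambda>x. f (g x))"
  by (auto simp: linmap_def)

lemma linmap_id: "linmap s s (\<lambda>x. x)"
  by (auto simp: linmap_def)

lemma linmap_fun_add: "vector_space m \<Longrightarrow> linmap s m f \<Longrightarrow> linmap s m g \<Longrightarrow> linmap s m (\<lambda>x. f x + g x)"
  by (auto simp: linmap_def vector_space.vector_space_assms)

lemma linmap_fun_scale: "vector_space m \<Longrightarrow> linmap s m f \<Longrightarrow> linmap s m (\<lambda>x. m c (f x))"
  for m :: "'k::field \<Rightarrow> _"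
  by (auto simp: linmap_def vector_space.vector_space_assms mult.commute)

lemma linmap_fun_zero: "vector_space m \<Longrightarrow> linmap s m (\<lambda>x. 0)"
  for m :: "'k::field \<Rightarrow> _"
  by (auto simp: linmap_def module.scale_zero_right module_iff_vector_space)

lemma linmap_fun_sum:
  assumes "vector_space m" "\<And>a. a \<in> A \<Longrightarrow> linmap s m (f a)"
  shows "linmap s m (\<lambda>x. \<Sum>a\<in>A. f a x)"
  using assms(2) by (induction A rule: infinite_finite_induct) (auto simp: linmap_fun_zero linmap_fun_add assms(1))

lemma vector_space_mult: "vector_space ((*) :: 'k::field \<Rightarrow> 'k \<Rightarrow> 'k)"
  by unfold_locales (auto simp: algebra_simps)

lemma linmap_times_const: "linmap s (*) f \<Longrightarrow> linmap s (*) (\<lambda>x. f x * c)"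
  for f :: "_ \<Rightarrow> 'k::field"
  by (auto simp: linmap_def algebra_simps)

lemma linmap_const_times: "linmap s (*) f \<Longrightarrow> linmap s (*) (\<lambda>x. c * f x)"
  for f :: "_ \<Rightarrow> 'k::field"
  by (auto simp: linmap_def algebra_simps)

lemma linmap_scale_by:
  assumes "vector_space m" "linmap s (*) f"
  shows "linmap s m (\<lambda>x. m (f x) v)"
  using assms by (auto simp: linmap_def vector_space.vector_space_assms)

section \<open>Free vector spaces on words and linear extension\<close>

abbreviation keys :: "('w \<Rightarrow>\<^sub>0 'k::zero) \<Rightarrow> 'w set" where "keys \<equiv> Poly_Mapping.keys"

lemma lookup_map_zero: "f 0 = 0 \<Longrightarrow> Poly_Mapping.lookup (Poly_Mapping.map f p) k = f (Poly_Mapping.lookup p k)"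
  by (simp add: Poly_Mapping.map.rep_eq when_def)

lemma lookup_smul [simp]: "Poly_Mapping.lookup (smul c p) k = c * Poly_Mapping.lookup p k"
  by (simp add: smul_def lookup_map_zero)

global_interpretation free: vector_space "smul :: 'k::field \<Rightarrow> ('w \<Rightarrow>\<^sub>0 'k) \<Rightarrow> _"
  by unfold_locales (auto intro!: poly_mapping_eqI simp: lookup_add algebra_simps)

lemmas vector_space_smul = free.vector_space_axioms

lemma smul_single [simp]: "smul c (Poly_Mapping.single w a) = Poly_Mapping.single w (c * a)"
  by (rule poly_mapping_eqI) (simp add: lookup_single when_def)

lemma poly_mapping_sum_single:
  assumes "finite A" "keys p \<subseteq> A"
  shows "p = (\<Sum>w\<in>A. Poly_Mapping.single w (Poly_Mapping.lookup p w))"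
proof (rule poly_mapping_eqI)
  fix k
  have "(\<Sum>w\<in>A. Poly_Mapping.lookup (Poly_Mapping.single w (Poly_Mapping.lookup p w)) k)
      = (\<Sum>w\<in>A. if w = k then Poly_Mapping.lookup p k else 0)"
    by (rule sum.cong) (auto simp: lookup_single when_def)
  also have "\<dots> = Poly_Mapping.lookup p k"
    using assms by (auto simp: sum.delta' not_in_keys_iff_lookup_eq_zero)
  finally show "Poly_Mapping.lookup p k = Poly_Mapping.lookup (\<Sum>w\<in>A. Poly_Mapping.single w (Poly_Mapping.lookup p w)) k"
    by (simp add: lookup_sum)
qed

lemma poly_mapping_decomp: "p = (\<Sum>w\<in>keys p. smul (Poly_Mapping.lookup p w) (word w))"
  for p :: "'w \<Rightarrow>\<^sub>0 'k::field"
  using poly_mapping_sum_single[of "keys p" p] by simp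

text \<open>The carriers of tensor powers are defined as spans of words; as conditions on supports
  they can be checked word by word.\<close>

lemma free_span_words:
  "module.span smul {word w | w. P w} = {t :: 'w \<Rightarrow>\<^sub>0 'k::field. \<forall>w\<in>keys t. P w}" (is "?L = ?R")
proof
  show "?L \<subseteq> ?R"
  proof (rule free.span_minimal)
    show "free.subspace ?R"
      by (rule free.subspaceI) (use keys_add in \<open>auto simp: in_keys_iff lookup_add\<close>)
  qed auto
  show "?R \<subseteq> ?L"
  proof
    fix t :: "'w \<Rightarrow>\<^sub>0 'k" assume "t \<in> ?R"
    then have "(\<Sum>w\<in>keys t. smul (Poly_Mapping.lookup t w) (word w)) \<in> ?L"
      by (intro free.span_sum free.span_scale free.span_base) auto
    then show "t \<in> ?L" using poly_mapping_decomp[of t] by simp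
  qed
qed

lemma lin_ext_superset:
  assumes "vector_space m" "finite A" "keys p \<subseteq> A"
  shows "lin_ext m \<phi> p = (\<Sum>w\<in>A. m (Poly_Mapping.lookup p w) (\<phi> w))"
proof -
  interpret vector_space m by fact
  show ?thesis unfolding lin_ext_def
    using assms by (intro sum.mono_neutral_left) (auto simp: in_keys_iff)
qed

lemma linmap_lin_ext:
  fixes m :: "'k::field \<Rightarrow> 'b::ab_group_add \<Rightarrow> 'b"
  assumes "vector_space m"
  shows "linmap smul m (lin_ext m \<phi> :: ('w \<Rightarrow>\<^sub>0 'k) \<Rightarrow> 'b)"
proof -
  interpret vector_space m by fact
  show ?thesis
  proof (rule linmapI)
    fix p q :: "'w \<Rightarrow>\<^sub>0 'k"
    let ?A = "keys p \<union> keys q"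
    have "lin_ext m \<phi> r = (\<Sum>w\<in>?A. m (Poly_Mapping.lookup r w) (\<phi> w))" if "r \<in> {p, q, p + q}" for r
      using that keys_add[of p q] by (intro lin_ext_superset[OF assms]) auto
    then show "lin_ext m \<phi> (p + q) = lin_ext m \<phi> p + lin_ext m \<phi> q"
      by (simp add: lookup_add scale_left_distrib sum.distrib)
  next
    fix c and p :: "'w \<Rightarrow>\<^sub>0 'k"
    have "lin_ext m \<phi> r = (\<Sum>w\<in>keys p. m (Poly_Mapping.lookup r w) (\<phi> w))" if "r \<in> {p, smul c p}" for r
      using that by (intro lin_ext_superset[OF assms]) (auto simp: in_keys_iff)
    then show "lin_ext m \<phi> (smul c p) = m c (lin_ext m \<phi> p)"
      by (simp add: scale_sum_right)
  qed
qed

lemmas lin_ext_add = linmap_add[OF linmap_lin_ext]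
  and lin_ext_smul = linmap_scale[OF linmap_lin_ext]
  and lin_ext_diff = linmap_diff[OF linmap_lin_ext]
  and lin_ext_sum = linmap_sum[OF linmap_lin_ext]

lemma lin_ext_0 [simp]: "lin_ext m \<phi> 0 = 0"
  by (simp add: lin_ext_def)

lemma lin_ext_single:
  assumes "vector_space m"
  shows "lin_ext m \<phi> (Poly_Mapping.single w c) = m c (\<phi> w)"
  using lin_ext_superset[OF assms, of "{w}" "Poly_Mapping.single w c" \<phi>] by simp

lemma lin_ext_word:
  assumes "vector_space m"
  shows "lin_ext m \<phi> (word w) = \<phi> w"
proof -
  interpret vector_space m by fact
  show ?thesis by (simp add: lin_ext_single[OF assms])
qed

lemma lin_ext_cong:
  "(\<And>w. w \<in> keys p \<Longrightarrow> \<phi> w = \<psi> w) \<Longrightarrow> lin_ext m \<phi> p = lin_ext m \<psi> p"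
  by (simp add: lin_ext_def)

lemma linmap_lin_ext_comp:
  assumes "linmap m m' f"
  shows "f (lin_ext m \<phi> p) = lin_ext m' (\<lambda>w. f (\<phi> w)) p"
  by (simp add: lin_ext_def linmap_sum[OF assms] linmap_scale[OF assms])

lemma lin_ext_lin_ext:
  assumes "vector_space m"
  shows "lin_ext m \<phi> (lin_ext smul \<psi> p) = lin_ext m (\<lambda>w. lin_ext m \<phi> (\<psi> w)) p"
  by (rule linmap_lin_ext_comp[OF linmap_lin_ext[OF assms]])

lemma lin_ext_word_id: "lin_ext smul word p = p"
  using poly_mapping_decomp[of p] by (simp add: lin_ext_def)

lemma lin_ext_fun_add:
  assumes "vector_space m"
  shows "lin_ext m (\<lambda>w. \<phi> w + \<psi> w) p = lin_ext m \<phi> p + lin_ext m \<psi> p"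
proof -
  interpret vector_space m by fact
  show ?thesis by (simp add: lin_ext_def scale_right_distrib sum.distrib)
qed

lemma lin_ext_fun_diff:
  assumes "vector_space m"
  shows "lin_ext m (\<lambda>w. \<phi> w - \<psi> w) p = lin_ext m \<phi> p - lin_ext m \<psi> p"
proof -
  interpret vector_space m by fact
  show ?thesis by (simp add: lin_ext_def scale_right_diff_distrib sum_subtractf)
qed

lemma lin_ext_fun_scale:
  assumes "vector_space m"
  shows "lin_ext m (\<lambda>w. m c (\<phi> w)) p = m c (lin_ext m \<phi> p)"
proof -
  interpret vector_space m by fact
  show ?thesis by (simp add: lin_ext_def scale_sum_right mult.commute)
qed

lemma lin_ext_fun_zero: "vector_space m \<Longrightarrow> lin_ext m (\<lambda>w. 0) p = 0"
  by (simp add: lin_ext_def module.scale_zero_right module_iff_vector_space)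

lemma lin_ext_fun_sum:
  assumes "vector_space m"
  shows "lin_ext m (\<lambda>w. \<Sum>a\<in>A. \<phi> a w) p = (\<Sum>a\<in>A. lin_ext m (\<phi> a) p)"
  by (induction A rule: infinite_finite_induct)
    (auto simp: lin_ext_fun_zero lin_ext_fun_add assms)

lemma lin_ext_swap:
  assumes "vector_space m"
  shows "lin_ext m (\<lambda>v. lin_ext m (\<lambda>w. \<phi> v w) q) p = lin_ext m (\<lambda>w. lin_ext m (\<lambda>v. \<phi> v w) p) q"
proof -
  interpret vector_space m by fact
  show ?thesis
    unfolding lin_ext_def scale_sum_right
    by (subst sum.swap) (simp add: mult.commute)
qed

lemma linmap_lin_ext_fun:
  assumes "vector_space m" "\<And>w. w \<in> keys p \<Longrightarrow> linmap s m (\<lambda>x. \<phi> x w)"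
  shows "linmap s m (\<lambda>x. lin_ext m (\<phi> x) p)"
  unfolding lin_ext_def
  by (intro linmap_fun_sum linmap_fun_scale assms)

section \<open>Adapted bases and separating functionals\<close>

context vector_space
begin

lemma linmap_representation:
  assumes "independent B" "span B = UNIV"
  shows "linmap scale (*) (\<lambda>u. representation B u b)"
  by (rule linmapI) (auto simp: representation_add representation_scale assms)

text \<open>Bases of the members are extended along the chain; their union is directed, hence
  independent, and is extended once more to the whole space. One basis thus fits all
  \<open>G n\<close> at once, and the coordinate of a basis vector outside \<open>G n\<close> is a
  functional vanishing on \<open>G n\<close>.\<close>

lemma adapted_basis:
  assumes G: "\<And>n. subspace (G n)" "\<And>n. G n \<subseteq> G (Suc n)"
  obtains B where "independent B" "span B = UNIV" "\<And>n. span (B \<inter> G n) = G n"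
proof -
  define P where "P n C \<longleftrightarrow> C \<subseteq> G n \<and> independent C \<and> span C = G n" for n :: nat and C
  have "\<exists>C. P 0 C"
  proof -
    obtain C where "C \<subseteq> G 0" "independent C" "G 0 \<subseteq> span C"
      using maximal_independent_subset[of "G 0"] by blast
    then show ?thesis unfolding P_def
      using span_subspace[OF _ _ G(1), of C 0] by auto
  qed
  moreover have "\<exists>D. P (Suc n) D \<and> C \<subseteq> D" if "P n C" for n C
  proof -
    from that have "C \<subseteq> G (Suc n)" "independent C" using G(2) by (auto simp: P_def)
    then obtain D where "C \<subseteq> D" "D \<subseteq> G (Suc n)" "independent D" "G (Suc n) \<subseteq> span D"
      using maximal_independent_subset_extend by blast
    then show ?thesis unfolding P_def
      using span_subspace[OF _ _ G(1), of D "Suc n"] by auto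
  qed
  ultimately obtain C where C: "\<And>n. P n (C n)" "\<And>n. C n \<subseteq> C (Suc n)"
    using dependent_nat_choice[of P "\<lambda>n C D. C \<subseteq> D"] by metis
  have mono: "C i \<subseteq> C j" if "i \<le> j" for i j
    using C(2) that by (rule lift_Suc_mono_le)
  have ind: "independent (\<Union>(range C))"
  proof (rule independent_Union_directed)
    fix c d assume "c \<in> range C" "d \<in> range C"
    then obtain i j where "c = C i" "d = C j" by auto
    then show "c \<subseteq> d \<or> d \<subseteq> c" using mono nat_le_linear by metis
  qed (use C in \<open>auto simp: P_def\<close>)
  then obtain B where B: "\<Union>(range C) \<subseteq> B" "independent B" "UNIV \<subseteq> span B"
    using maximal_independent_subset_extend[OF subset_UNIV ind] by metis
  have "span (B \<inter> G n) = G n" for n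
  proof
    show "span (B \<inter> G n) \<subseteq> G n" by (rule span_minimal) (auto simp: G)
    have "C n \<subseteq> B \<inter> G n" using B C(1)[of n] by (auto simp: P_def)
    then have "span (C n) \<subseteq> span (B \<inter> G n)" by (rule span_mono)
    then show "G n \<subseteq> span (B \<inter> G n)" using C(1)[of n] by (auto simp: P_def)
  qed
  then show ?thesis using that B by blast
qed

lemma representation_adapted_zero:
  assumes "independent B" "span (B \<inter> U) = U" "u \<in> U" "b \<notin> U"
  shows "representation B u b = 0"
proof -
  have "representation B u = representation (B \<inter> U) u"
    using assms by (intro representation_extend) auto
  then show ?thesis using representation_ne_zero[of "B \<inter> U" u b] assms(4) by auto
qed

lemma separating_functional:
  assumes "subspace U" "x \<notin> U"
  obtains f where "linmap scale (*) f" "\<And>u. u \<in> U \<Longrightarrow> f u = 0" "f x \<noteq> 0"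
proof -
  obtain B where B: "independent B" "span B = UNIV" "span (B \<inter> U) = U"
    using adapted_basis[of "\<lambda>_. U"] assms(1) by auto
  have "\<exists>b. b \<notin> U \<and> representation B x b \<noteq> 0"
  proof (rule ccontr)
    assume "\<not> ?thesis"
    then have "\<And>b. representation B x b \<noteq> 0 \<Longrightarrow> b \<in> U" by blast
    then have "(\<Sum>b | representation B x b \<noteq> 0. representation B x b *s b) \<in> U"
      by (intro subspace_sum subspace_scale assms(1)) auto
    then show False using sum_nonzero_representation_eq[of B x] B assms(2) by auto
  qed
  then obtain b where "b \<notin> U" "representation B x b \<noteq> 0" by blast
  moreover have "\<And>u. u \<in> U \<Longrightarrow> representation B u b = 0"
    using representation_adapted_zero[OF B(1,3)] calculation by blast
  ultimately show ?thesis
    using that linmap_representation[OF B(1,2)] by blast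
qed

text \<open>A subspace is the common kernel of the functionals that vanish on it. Congruences modulo
  a step of the filtration are proved by this test, without forming quotients.\<close>

lemma in_subspace_test:
  assumes "subspace U" "\<And>f. linmap scale (*) f \<Longrightarrow> (\<And>u. u \<in> U \<Longrightarrow> f u = 0) \<Longrightarrow> f x = 0"
  shows "x \<in> U"
  using separating_functional[OF assms(1)] assms(2) by metis

lemma eq_test:
  assumes "\<And>f. linmap scale (*) f \<Longrightarrow> f x = f y"
  shows "x = y"
proof -
  have "x - y \<in> {0}"
    by (rule in_subspace_test) (auto simp: linmap_diff assms)
  then show ?thesis by simp
qed

end

section \<open>Tensor squares of quotients and their pairings\<close>

lemma car_tpow: "car (tpow X n) = {t. \<forall>w\<in>keys t. set w \<subseteq> car X \<and> length w = n}"
  by (simp add: tpow_def Let_def free_span_words)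

lemma car_tens: "car (tens X) = {t. \<forall>w\<in>keys t. set w \<subseteq> car X}"
  by (simp add: tens_def free_span_words)

lemma nul_tens: "nul (tens X) = free.span (tens_rel X)"
  by (simp add: tens_def)

lemma nul_tpow: "nul (tpow X n) = free.span (tens_rel X) \<inter> car (tpow X n)"
  by (simp add: tpow_def tens_def Let_def)

lemma subspace_car_tpow: "free.subspace (car (tpow X n))"
  by (simp add: tpow_def Let_def)

lemma subspace_nul_tpow: "free.subspace (nul (tpow X n))"
  unfolding nul_tpow by (intro free.subspace_inter free.subspace_span subspace_car_tpow)

lemma keys_tpow:
  assumes "t \<in> car (tpow X n)" "w \<in> keys t"
  shows "length w = n" "set w \<subseteq> car X"
  using assms by (auto simp: car_tpow)

lemma word_in_tpow2 [simp]: "word [x, y] \<in> car (tpow X 2) \<longleftrightarrow> x \<in> car X \<and> y \<in> car X"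
  by (simp add: car_tpow)

text \<open>The universal property of the tensor algebra, in the form that a multilinear function on
  words which vanishes on null letters kills all relations.\<close>

lemma lin_ext_tens_rel:
  fixes m :: "'k::field \<Rightarrow> 'b::ab_group_add \<Rightarrow> 'b"
  assumes m: "vector_space m"
    and add: "\<And>u x y v. set u \<subseteq> car X \<Longrightarrow> x \<in> car X \<Longrightarrow> y \<in> car X \<Longrightarrow> set v \<subseteq> car X \<Longrightarrow>
      \<phi> (u @ [x + y] @ v) = \<phi> (u @ [x] @ v) + \<phi> (u @ [y] @ v)"
    and scl: "\<And>u c x v. set u \<subseteq> car X \<Longrightarrow> x \<in> car X \<Longrightarrow> set v \<subseteq> car X \<Longrightarrow>
      \<phi> (u @ [scl X c x] @ v) = m c (\<phi> (u @ [x] @ v))"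
    and nul: "\<And>u x v. set u \<subseteq> car X \<Longrightarrow> x \<in> nul X \<Longrightarrow> set v \<subseteq> car X \<Longrightarrow> \<phi> (u @ [x] @ v) = 0"
    and t: "t \<in> free.span (tens_rel X)"
  shows "lin_ext m \<phi> t = 0"
proof -
  interpret vector_space m by fact
  have "free.subspace {t. lin_ext m \<phi> t = 0}"
    by (rule free.subspaceI) (auto simp: lin_ext_add[OF m] lin_ext_smul[OF m])
  moreover have "tens_rel X \<subseteq> {t. lin_ext m \<phi> t = 0}"
    unfolding tens_rel_def
    using add scl nul
    by (auto simp: lin_ext_diff[OF m] lin_ext_smul[OF m] lin_ext_word[OF m] lin_ext_single[OF m])
  ultimately have "free.span (tens_rel X) \<subseteq> {t. lin_ext m \<phi> t = 0}"
    by (intro free.span_minimal)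
  then show ?thesis using t by auto
qed

text \<open>Vanishing on \<open>nul X\<close> lets the form descend to the tensor square of
  \<open>car X / nul X\<close>. Linearity is asked on \<open>car X\<close> only, because maps built
  from chosen lifts, as in \<open>lft_braid\<close>, are additive only there.\<close>

definition bilin_on :: "('k::field, 'a::ab_group_add, 'z) kspace_scheme \<Rightarrow> ('k \<Rightarrow> 'b \<Rightarrow> 'b)
    \<Rightarrow> ('a \<Rightarrow> 'a \<Rightarrow> 'b::ab_group_add) \<Rightarrow> bool" where
  "bilin_on X m \<beta> \<longleftrightarrow>
    (\<forall>z\<in>car X. (\<forall>x\<in>car X. (\<forall>y\<in>car X. \<beta> (x + y) z = \<beta> x z + \<beta> y z \<and> \<beta> z (x + y) = \<beta> z x + \<beta> z y)
        \<and> (\<forall>c. \<beta> (scl X c x) z = m c (\<beta> x z) \<and> \<beta> z (scl X c x) = m c (\<beta> z x)))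
      \<and> (\<forall>x\<in>nul X. \<beta> x z = 0 \<and> \<beta> z x = 0))"

abbreviation ev2 :: "('k::field \<Rightarrow> 'b \<Rightarrow> 'b) \<Rightarrow> ('a \<Rightarrow> 'a \<Rightarrow> 'b::ab_group_add) \<Rightarrow> ('a list \<Rightarrow>\<^sub>0 'k) \<Rightarrow> 'b" where
  "ev2 m \<beta> \<equiv> lin_ext m (\<lambda>w. \<beta> (w ! 0) (w ! 1))"

abbreviation evf :: "('a \<Rightarrow> 'k::field) \<Rightarrow> ('a \<Rightarrow> 'k) \<Rightarrow> ('a list \<Rightarrow>\<^sub>0 'k) \<Rightarrow> 'k" where
  "evf f g \<equiv> ev2 (*) (\<lambda>x y. f x * g y)"

lemma length_2_conv: "length w = 2 \<longleftrightarrow> (\<exists>a b. w = [a, b])"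
  by (auto simp: length_Suc_conv numeral_2_eq_2)

lemma ev2_nul:
  assumes m: "vector_space m" and \<beta>: "bilin_on X m \<beta>" and t: "t \<in> nul (tpow X 2)"
  shows "ev2 m \<beta> t = 0"
proof -
  interpret vector_space m by fact
  \<comment> \<open>\<open>nul (tpow X 2)\<close> is cut out of the span of relations of all
    lengths. Extending by 0 to other lengths is harmless, as all words of one relation have the same
    length.\<close>
  define \<phi> where "\<phi> w = (if length w = 2 then \<beta> (w ! 0) (w ! 1) else 0)" for w
  have len: "length (u @ [x] @ v) = 2 \<longleftrightarrow> (\<exists>z. u = [z] \<and> v = []) \<or> (\<exists>z. u = [] \<and> v = [z])" for u v x
    by (cases u; cases v) (auto)
  have "lin_ext m \<phi> t = 0"
  proof (rule lin_ext_tens_rel[OF m])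
    show "t \<in> free.span (tens_rel X)" using t by (simp add: nul_tpow)
  qed (use \<beta> in \<open>unfold \<phi>_def len bilin_on_def, auto\<close>)
  moreover have "lin_ext m \<phi> t = ev2 m \<beta> t"
    using t by (intro lin_ext_cong) (auto simp: \<phi>_def nul_tpow car_tpow)
  ultimately show ?thesis by simp
qed

lemma ev2_keq:
  assumes "vector_space m" "bilin_on X m \<beta>" "keq (tpow X 2) t t'"
  shows "ev2 m \<beta> t = ev2 m \<beta> t'"
  using ev2_nul[OF assms(1,2), of "t - t'"] assms(3)
  by (simp add: keq_def lin_ext_diff[OF assms(1)])

lemma tens_relI:
  "set u \<subseteq> car X \<Longrightarrow> x \<in> car X \<Longrightarrow> y \<in> car X \<Longrightarrow> set v \<subseteq> car X \<Longrightarrow>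
    word (u @ [x + y] @ v) - word (u @ [x] @ v) - word (u @ [y] @ v) \<in> tens_rel X"
  "set u \<subseteq> car X \<Longrightarrow> x \<in> car X \<Longrightarrow> set v \<subseteq> car X \<Longrightarrow>
    word (u @ [scl X c x] @ v) - smul c (word (u @ [x] @ v)) \<in> tens_rel X"
  "set u \<subseteq> car X \<Longrightarrow> x \<in> nul X \<Longrightarrow> set v \<subseteq> car X \<Longrightarrow> word (u @ [x] @ v) \<in> tens_rel X"
  unfolding tens_rel_def by blast+

lemma tens_rel_nul_tpow2:
  assumes "kspace X"
  shows "x \<in> car X \<Longrightarrow> y \<in> car X \<Longrightarrow> z \<in> car X \<Longrightarrow> word [x + y, z] - word [x, z] - word [y, z] \<in> nul (tpow X 2)"
    "x \<in> car X \<Longrightarrow> y \<in> car X \<Longrightarrow> z \<in> car X \<Longrightarrow> word [z, x + y] - word [z, x] - word [z, y] \<in> nul (tpow X 2)"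
    "x \<in> car X \<Longrightarrow> z \<in> car X \<Longrightarrow> word [scl X c x, z] - smul c (word [x, z]) \<in> nul (tpow X 2)"
    "x \<in> car X \<Longrightarrow> z \<in> car X \<Longrightarrow> word [z, scl X c x] - smul c (word [z, x]) \<in> nul (tpow X 2)"
    "x \<in> nul X \<Longrightarrow> z \<in> car X \<Longrightarrow> word [x, z] \<in> nul (tpow X 2)"
    "x \<in> nul X \<Longrightarrow> z \<in> car X \<Longrightarrow> word [z, x] \<in> nul (tpow X 2)"
proof -
  interpret vector_space "scl X" using assms by (simp add: kspace_def)
  have sub: "subspace (car X)" "nul X \<subseteq> car X" using assms by (auto simp: kspace_def)
  have I: "t \<in> nul (tpow X 2)" if "t \<in> tens_rel X" "t \<in> car (tpow X 2)" for t
    using that by (simp add: nul_tpow free.span_base)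
  note C = free.subspace_diff[OF subspace_car_tpow] free.subspace_scale[OF subspace_car_tpow]
    word_in_tpow2[THEN iffD2] conjI subspace_add[OF sub(1)] subspace_scale[OF sub(1)]
  show "word [x + y, z] - word [x, z] - word [y, z] \<in> nul (tpow X 2)" if "x \<in> car X" "y \<in> car X" "z \<in> car X"
    using that tens_relI(1)[of "[]" X x y "[z]"] by (intro I C) auto
  show "word [z, x + y] - word [z, x] - word [z, y] \<in> nul (tpow X 2)" if "x \<in> car X" "y \<in> car X" "z \<in> car X"
    using that tens_relI(1)[of "[z]" X x y "[]"] by (intro I C) auto
  show "word [scl X c x, z] - smul c (word [x, z]) \<in> nul (tpow X 2)" if "x \<in> car X" "z \<in> car X"
    using that tens_relI(2)[of "[]" X x "[z]" c] by (intro I C) (auto simp del: smul_single)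
  show "word [z, scl X c x] - smul c (word [z, x]) \<in> nul (tpow X 2)" if "x \<in> car X" "z \<in> car X"
    using that tens_relI(2)[of "[z]" X x "[]" c] by (intro I C) (auto simp del: smul_single)
  show "word [x, z] \<in> nul (tpow X 2)" if "x \<in> nul X" "z \<in> car X"
    using that sub(2) tens_relI(3)[of "[]" X x "[z]"] by (intro I C) auto
  show "word [z, x] \<in> nul (tpow X 2)" if "x \<in> nul X" "z \<in> car X"
    using that sub(2) tens_relI(3)[of "[z]" X x "[]"] by (intro I C) auto
qed

text \<open>Converse of \<open>ev2_nul\<close>: over a field, the functionals f \<otimes> g separate
  the points of the tensor square of \<open>car X / nul X\<close>. Expanding both letters in a basis
  adapted to \<open>nul X\<close> \<subseteq> \<open>car X\<close> leaves words in basis vectors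
  outside \<open>nul X\<close>, and their coefficients are pairings of t with coordinate
  functionals.\<close>

lemma tpow2_test:
  fixes X :: "('k::field, 'a::ab_group_add, 'z) kspace_scheme"
  assumes X: "kspace X" and t: "t \<in> car (tpow X 2)"
    and test: "\<And>f g. linmap (scl X) (*) f \<Longrightarrow> linmap (scl X) (*) g \<Longrightarrow> (\<And>x. x \<in> nul X \<Longrightarrow> f x = 0) \<Longrightarrow>
      (\<And>x. x \<in> nul X \<Longrightarrow> g x = 0) \<Longrightarrow> evf f g t = 0"
  shows "t \<in> nul (tpow X 2)"
proof -
  interpret vector_space "scl X" using X by (simp add: kspace_def)
  have sub: "subspace (car X)" "subspace (nul X)" "nul X \<subseteq> car X" using X by (auto simp: kspace_def)
  define G where "G n = (if n = 0 then nul X else car X)" for n :: nat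
  obtain B where B: "independent B" "span B = UNIV" and BG: "\<And>n. span (B \<inter> G n) = G n"
    by (rule adapted_basis[of G]) (use sub in \<open>auto simp: G_def\<close>)
  have Bn: "span (B \<inter> nul X) = nul X" and Bc: "span (B \<inter> car X) = car X"
    using BG[of 0] BG[of 1] by (auto simp: G_def)
  let ?r = "representation B"
  let ?N = "nul (tpow X 2)"
  note N = free.subspace_0[OF subspace_nul_tpow] free.subspace_add[OF subspace_nul_tpow]
    free.subspace_diff[OF subspace_nul_tpow]
    free.subspace_scale[OF subspace_nul_tpow] free.subspace_sum[OF subspace_nul_tpow]
  define L where "L = (\<Union>w\<in>keys t. set w)"
  have L: "finite L" "L \<subseteq> car X" using t by (auto simp: L_def car_tpow)
  \<comment> \<open>Only finitely many basis vectors outside \<open>nul X\<close> occur in the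
    letters of t; those inside \<open>nul X\<close> contribute null words and are left out of the
    sums.\<close>
  define D where "D = (\<Union>u\<in>L. {b. ?r u b \<noteq> 0}) - nul X"
  have "b \<in> B \<inter> car X" if "u \<in> L" "?r u b \<noteq> 0" for u b
    using that L representation_ne_zero[of B u b] representation_adapted_zero[OF B(1) Bc, of u b] by blast
  then have D: "finite D" "D \<subseteq> B \<inter> car X" "D \<inter> nul X = {}"
    using L finite_representation[of B] by (auto simp: D_def)
  have rD: "?r b b' = (if b' = b then 1 else 0)" if "b \<in> B" for b b'
    using representation_basis[OF B(1) that] by simp
  define S where "S = span ((B \<inter> nul X) \<union> D)"
  have SD: "u \<in> S" if "u \<in> L" for u
  proof -
    have "b \<in> S" if "?r u b \<noteq> 0" for b
      using that \<open>u \<in> L\<close> representation_ne_zero[of B u b] unfolding S_def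
      by (intro span_base) (auto simp: D_def)
    then have "(\<Sum>b | ?r u b \<noteq> 0. scl X (?r u b) b) \<in> S"
      unfolding S_def by (intro span_sum span_scale) auto
    then show ?thesis using sum_nonzero_representation_eq[of B u] B by auto
  qed
  have rn: "?r x b = 0" if "x \<in> nul X" "b \<in> D" for x b
    using representation_adapted_zero[OF B(1) Bn] that D by blast
  have Scar: "S \<subseteq> car X" unfolding S_def using D sub by (intro span_minimal) auto
  \<comment> \<open>\<open>q\<close> stands for the word [x, z] and for the word [z, x] with z
    fixed, so one induction gives the expansion in either position.\<close>
  have half: "x \<in> car X \<and> q x - (\<Sum>b\<in>D. smul (?r x b) (q b)) \<in> ?N"
    if q: "\<And>x y. x \<in> car X \<Longrightarrow> y \<in> car X \<Longrightarrow> q (x + y) - q x - q y \<in> ?N"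
      "\<And>c x. x \<in> car X \<Longrightarrow> q (scl X c x) - smul c (q x) \<in> ?N" "\<And>x. x \<in> nul X \<Longrightarrow> q x \<in> ?N"
      and x: "x \<in> S" for q x
    using x unfolding S_def
  proof (induction rule: span_induct_alt)
    case base
    have "q 0 \<in> ?N" using sub subspace_0 by (intro q) auto
    then show ?case using sub subspace_0 by (simp add: representation_zero)
  next
    case (step c b y)
    have b: "b \<in> car X" using step D sub by auto
    have cb: "scl X c b \<in> car X" by (rule subspace_scale[OF sub(1) b])
    have "q b - (\<Sum>b'\<in>D. smul (?r b b') (q b')) \<in> ?N"
    proof (cases "b \<in> nul X")
      case True
      then show ?thesis using q(3)[OF True] rn[OF True] by simp
    next
      case False
      then have "b \<in> D" "b \<in> B" using step D by auto
      then have "(\<Sum>b'\<in>D. smul (?r b b') (q b')) = (\<Sum>b'\<in>D. if b' = b then q b' else 0)"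
        by (intro sum.cong) (auto simp: rD)
      then show ?thesis using \<open>b \<in> D\<close> D N(1) by simp
    qed
    then have "smul c (q b - (\<Sum>b'\<in>D. smul (?r b b') (q b'))) + (q (scl X c b) - smul c (q b)) +
        (q y - (\<Sum>b'\<in>D. smul (?r y b') (q b'))) + (q (scl X c b + y) - q (scl X c b) - q y) \<in> ?N"
      using step.IH b cb by (intro N(2) N(4) q) simp_all
    also have "smul c (q b - (\<Sum>b'\<in>D. smul (?r b b') (q b'))) + (q (scl X c b) - smul c (q b)) +
        (q y - (\<Sum>b'\<in>D. smul (?r y b') (q b'))) + (q (scl X c b + y) - q (scl X c b) - q y)
       = q (scl X c b + y) - (\<Sum>b'\<in>D. smul (?r (scl X c b + y) b') (q b'))"
      using B by (simp del: smul_single add: representation_add representation_scale free.scale_right_diff_distrib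
          free.scale_sum_right free.scale_left_distrib sum.distrib)
    finally show ?case using subspace_add[OF sub(1) cb] step.IH by simp
  qed
  have left: "word [x, z] - (\<Sum>b\<in>D. smul (?r x b) (word [b, z])) \<in> ?N"
    and right: "word [z, x] - (\<Sum>b\<in>D. smul (?r x b) (word [z, b])) \<in> ?N" if "z \<in> car X" "x \<in> S" for x z
    by (rule conjunct2[OF half[OF _ _ _ that(2)]]; rule tens_rel_nul_tpow2[OF X]; (assumption | rule that(1)))+
  have both: "word w - (\<Sum>b\<in>D. \<Sum>b'\<in>D. smul (?r (w ! 0) b * ?r (w ! 1) b') (word [b, b'])) \<in> ?N"
    if wt: "w \<in> keys t" for w
  proof -
    obtain x y where w: "w = [x, y]" using keys_tpow[OF t wt] by (auto simp: length_2_conv)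
    have "x \<in> L" "y \<in> L" using wt w unfolding L_def by (auto intro!: bexI[of _ w])
    then have xy: "x \<in> S" "y \<in> S" using SD by auto
    have "(word [x, y] - (\<Sum>b\<in>D. smul (?r x b) (word [b, y])))
        + (\<Sum>b\<in>D. smul (?r x b) (word [b, y] - (\<Sum>b'\<in>D. smul (?r y b') (word [b, b'])))) \<in> ?N"
      using xy Scar D by (intro N left right) auto
    also have "(word [x, y] - (\<Sum>b\<in>D. smul (?r x b) (word [b, y])))
        + (\<Sum>b\<in>D. smul (?r x b) (word [b, y] - (\<Sum>b'\<in>D. smul (?r y b') (word [b, b']))))
      = word w - (\<Sum>b\<in>D. \<Sum>b'\<in>D. smul (?r (w ! 0) b * ?r (w ! 1) b') (word [b, b']))"
      by (simp del: smul_single add: w free.scale_right_diff_distrib sum_subtractf free.scale_sum_right free.scale_scale)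
    finally show ?thesis .
  qed
  \<comment> \<open>Summing over the words of t turns the coefficients of the expansion into
    pairings of t with two coordinate functionals, which vanish by \<open>test\<close>.\<close>
  have "lin_ext smul (\<lambda>w. word w - (\<Sum>b\<in>D. \<Sum>b'\<in>D. smul (?r (w ! 0) b * ?r (w ! 1) b') (word [b, b']))) t \<in> ?N"
    unfolding lin_ext_def by (intro N both)
  also have "lin_ext smul (\<lambda>w. word w - (\<Sum>b\<in>D. \<Sum>b'\<in>D. smul (?r (w ! 0) b * ?r (w ! 1) b') (word [b, b']))) t
      = t - (\<Sum>b\<in>D. \<Sum>b'\<in>D. lin_ext smul (\<lambda>w. smul (?r (w ! 0) b * ?r (w ! 1) b') (word [b, b'])) t)"
    by (simp add: lin_ext_fun_diff lin_ext_fun_sum vector_space_smul lin_ext_word_id del: smul_single)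
  also have "(\<Sum>b\<in>D. \<Sum>b'\<in>D. lin_ext smul (\<lambda>w. smul (?r (w ! 0) b * ?r (w ! 1) b') (word [b, b'])) t) = 0"
  proof (intro sum.neutral ballI)
    fix b b' assume "b \<in> D" "b' \<in> D"
    have "ev2 (*) (\<lambda>x y. ?r x b * ?r y b') t = 0"
      using \<open>b \<in> D\<close> \<open>b' \<in> D\<close> rn by (intro test linmap_representation B) auto
    moreover have "lin_ext smul (\<lambda>w. smul (?r (w ! 0) b * ?r (w ! 1) b') (word [b, b'])) t
      = smul (ev2 (*) (\<lambda>x y. ?r x b * ?r y b') t) (word [b, b'])"
      unfolding lin_ext_def
      by (subst free.scale_sum_left) simp
    ultimately show "lin_ext smul (\<lambda>w. smul (?r (w ! 0) b * ?r (w ! 1) b') (word [b, b'])) t = 0" by simp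
  qed
  finally show ?thesis by simp
qed

lemma tpow2_keqI:
  fixes X :: "('k::field, 'a::ab_group_add, 'z) kspace_scheme"
  assumes X: "kspace X" and t: "t \<in> car (tpow X 2)" "t' \<in> car (tpow X 2)"
    and test: "\<And>f g. linmap (scl X) (*) f \<Longrightarrow> linmap (scl X) (*) g \<Longrightarrow> (\<And>x. x \<in> nul X \<Longrightarrow> f x = 0) \<Longrightarrow>
      (\<And>x. x \<in> nul X \<Longrightarrow> g x = 0) \<Longrightarrow> evf f g t = evf f g t'"
  shows "keq (tpow X 2) t t'"
  unfolding keq_def
  by (rule tpow2_test[OF X free.subspace_diff[OF subspace_car_tpow t]])
    (simp add: lin_ext_diff[OF vector_space_mult] test del: One_nat_def)

lemma bilin_on_functionals:
  fixes X :: "('k::field, 'a::ab_group_add, 'z) kspace_scheme"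
  assumes "linmap (scl X) (*) f" "linmap (scl X) (*) g" "\<And>x. x \<in> nul X \<Longrightarrow> f x = 0" "\<And>x. x \<in> nul X \<Longrightarrow> g x = 0"
  shows "bilin_on X (*) (\<lambda>x y. f x * g y)"
  using assms by (auto simp: bilin_on_def linmap_def algebra_simps)

lemma free_span_words2:
  "free.span {word [a, b] | a b. a \<in> U \<and> b \<in> V}
    = {t :: 'a list \<Rightarrow>\<^sub>0 'k::field. \<forall>w\<in>keys t. \<exists>a\<in>U. \<exists>b\<in>V. w = [a, b]}"
proof -
  have "{word [a, b] | a b. a \<in> U \<and> b \<in> V} = {word w :: 'a list \<Rightarrow>\<^sub>0 'k | w. \<exists>a\<in>U. \<exists>b\<in>V. w = [a, b]}" by blast
  then show ?thesis using free_span_words[of "\<lambda>w. \<exists>a\<in>U. \<exists>b\<in>V. w = [a, b]"] by (simp only:)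
qed

lemma ev2_tmap2:
  assumes "vector_space m"
  shows "ev2 m \<beta> (tmap2 f g t) = ev2 m (\<lambda>x y. \<beta> (f x) (g y)) t"
  by (simp add: tmap2_def lin_ext_lin_ext[OF assms] lin_ext_word[OF assms])

lemma ev2_tswap:
  assumes "vector_space m"
  shows "ev2 m \<beta> (tswap t) = ev2 m (\<lambda>x y. \<beta> y x) t"
  by (simp add: tswap_def lin_ext_lin_ext[OF assms] lin_ext_word[OF assms])

lemma ev2_cong:
  assumes "t \<in> car (tpow X 2)" "\<And>x y. [x, y] \<in> keys t \<Longrightarrow> x \<in> car X \<Longrightarrow> y \<in> car X \<Longrightarrow> \<beta> x y = \<gamma> x y"
  shows "ev2 m \<beta> t = ev2 m \<gamma> t"
proof (rule lin_ext_cong)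
  fix w assume w: "w \<in> keys t"
  then obtain x y where "w = [x, y]" using keys_tpow[OF assms(1) w] by (auto simp: length_2_conv)
  then show "\<beta> (w ! 0) (w ! 1) = \<gamma> (w ! 0) (w ! 1)"
    using assms(2) w keys_tpow[OF assms(1) w] by auto
qed

lemma lin_ext_car:
  assumes "module.subspace smul C" "\<And>w. w \<in> keys t \<Longrightarrow> \<phi> w \<in> C"
  shows "lin_ext smul \<phi> t \<in> C"
  unfolding lin_ext_def
  by (intro free.subspace_sum free.subspace_scale assms)

lemma tmap2_car:
  assumes "t \<in> car (tpow X 2)" "\<And>x. x \<in> car X \<Longrightarrow> f x \<in> car Y" "\<And>x. x \<in> car X \<Longrightarrow> g x \<in> car Y"
  shows "tmap2 f g t \<in> car (tpow Y 2)"
  unfolding tmap2_def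
proof (intro lin_ext_car subspace_car_tpow)
  fix w assume "w \<in> keys t"
  then show "word [f (w ! 0), g (w ! 1)] \<in> car (tpow Y 2)"
    using keys_tpow[OF assms(1)] assms(2,3) by (fastforce simp: length_2_conv)
qed

lemma tswap_car:
  assumes "t \<in> car (tpow X 2)"
  shows "tswap t \<in> car (tpow X 2)"
  unfolding tswap_def
proof (intro lin_ext_car subspace_car_tpow)
  fix w assume "w \<in> keys t"
  then show "word [w ! 1, w ! 0] \<in> car (tpow X 2)"
    using keys_tpow[OF assms] by (fastforce simp: length_2_conv)
qed

lemma keq_refl: "keq (tpow X n) t t"
  using free.subspace_0[OF subspace_nul_tpow] by (simp add: keq_def)

lemma scl_tpow: "scl (tpow X n) = smul"
  by (simp add: tpow_def Let_def)

lemma linmap_brd_at: "linmap smul smul (brd_at c j)"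
  unfolding brd_at_def[abs_def] by (rule linmap_lin_ext[OF vector_space_smul])

lemma linmap_tswap: "linmap smul smul tswap"
  unfolding tswap_def[abs_def] by (rule linmap_lin_ext[OF vector_space_smul])

lemma tswap_nul:
  assumes "kspace X" and t: "t \<in> nul (tpow X 2)"
  shows "tswap t \<in> nul (tpow X 2)"
proof (rule tpow2_test[OF assms(1)])
  show "tswap t \<in> car (tpow X 2)" using t by (intro tswap_car) (simp add: nul_tpow)
  fix f g assume fg: "linmap (scl X) (*) f" "linmap (scl X) (*) g" "\<And>x. x \<in> nul X \<Longrightarrow> f x = 0" "\<And>x. x \<in> nul X \<Longrightarrow> g x = 0"
  have "evf g f t = 0"
    by (rule ev2_nul[OF vector_space_mult bilin_on_functionals t]) (use fg in auto)
  then show "evf f g (tswap t) = 0"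
    unfolding ev2_tswap[OF vector_space_mult, of "\<lambda>x y. f x * g y"] by (simp add: mult.commute)
qed

lemma tswap_tsub:
  assumes X: "kspace X"
  shows "tswap ` tsub X U U' \<subseteq> tsub X U' U"
proof
  fix s assume "s \<in> tswap ` tsub X U U'"
  then obtain t t' where s: "s = tswap t" and t: "t \<in> car (tpow X 2)" "keq (tpow X 2) t t'"
    and t': "t' \<in> free.span {word [a, b] | a b. a \<in> U \<and> b \<in> U'}"
    by (auto simp: tsub_def)
  have "tswap t' \<in> free.span {word [a, b] | a b. a \<in> U' \<and> b \<in> U}"
    unfolding tswap_def
  proof (rule lin_ext_car)
    fix w assume "w \<in> keys t'"
    then obtain a b where "w = [a, b]" "a \<in> U" "b \<in> U'" using t' unfolding free_span_words2 by blast
    then show "word [w ! 1, w ! 0] \<in> free.span {word [a, b] | a b. a \<in> U' \<and> b \<in> U}"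
      by (intro free.span_base) auto
  qed simp
  moreover have "keq (tpow X 2) s (tswap t')"
    using tswap_nul[OF X, of "t - t'"] t(2) by (simp add: keq_def s linmap_diff[OF linmap_tswap])
  ultimately show "s \<in> tsub X U' U" using tswap_car[OF t(1)] by (auto simp: tsub_def s)
qed

section \<open>Symmetric algebras of trivially braided spaces\<close>

lemma insert_sorted_exists:
  assumes "sorted_wrt P xs" "\<And>y. y \<in> set xs \<Longrightarrow> P x y \<or> P y x" "transp_on (insert x (set xs)) P"
  shows "\<exists>ys. mset ys = mset (x # xs) \<and> sorted_wrt P ys"
  using assms
proof (induction xs)
  case (Cons y xs)
  then obtain ys where ys: "mset ys = mset (x # xs)" "sorted_wrt P ys"
    by (auto intro: transp_on_subset)
  have sy: "set ys = insert x (set xs)" using ys(1) by (metis list.simps(15) set_mset_mset)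
  show ?case
  proof (cases "P x y")
    case True
    have "P x z" if "z \<in> set xs" for z
      using transp_onD[OF Cons.prems(3), of x y z] True that Cons.prems(1) by auto
    then have "sorted_wrt P (x # y # xs)" using True Cons.prems(1) by auto
    then show ?thesis by (metis)
  next
    case False
    then have "P y x" using Cons.prems(2)[of y] by auto
    then have "sorted_wrt P (y # ys)" using ys(2) sy Cons.prems(1) by auto
    moreover have "mset (y # ys) = mset (x # y # xs)" using ys(1) by simp
    ultimately show ?thesis by metis
  qed
qed (auto intro: exI[of _ "[x]"])

text \<open>Insertion sort, since the order is a relation on \<open>B\<close> and not the order of a
  type.\<close>

lemma sorted_exists:
  assumes r: "well_order_on B r" and w: "set w \<subseteq> B"
  shows "\<exists>w'. mset w' = mset w \<and> sorted_wrt (\<lambda>x y. (x, y) \<in> r) w'"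
  using w
proof (induction w)
  case (Cons x w)
  then obtain w' where w': "mset w' = mset w" "sorted_wrt (\<lambda>x y. (x, y) \<in> r) w'" by auto
  have sub: "set (x # w') \<subseteq> B" using w' Cons.prems by (metis insert_subset list.simps(15) set_mset_mset)
  have ro: "refl_on B r" "trans r" "total_on B r"
    using r by (auto simp: well_order_on_def linear_order_on_def partial_order_on_def preorder_on_def)
  have "\<exists>ys. mset ys = mset (x # w') \<and> sorted_wrt (\<lambda>x y. (x, y) \<in> r) ys"
  proof (rule insert_sorted_exists[OF w'(2)])
    show "(x, y) \<in> r \<or> (y, x) \<in> r" if "y \<in> set w'" for y
      using that sub ro by (cases "x = y") (auto simp: refl_on_def total_on_def)
    show "transp_on (insert x (set w')) (\<lambda>x y. (x, y) \<in> r)"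
      using ro(2) by (auto simp: transp_on_def dest: transD)
  qed
  then show ?case using w'(1) by simp
qed simp

lemma sorted_unique:
  assumes "antisym r" "sorted_wrt (\<lambda>x y. (x, y) \<in> r) w" "sorted_wrt (\<lambda>x y. (x, y) \<in> r) w'" "mset w = mset w'"
  shows "w = w'"
  using assms(2-4)
proof (induction w arbitrary: w')
  case (Cons x u)
  then obtain y v where w': "w' = y # v" by (cases w') auto
  have "set (x # u) = set (y # v)" using Cons.prems(3) w' by (metis set_mset_mset)
  then have "x = y \<or> ((x, y) \<in> r \<and> (y, x) \<in> r)"
    using Cons.prems(1,2) w' by (auto simp: set_eq_iff)
  then have "x = y" using assms(1) by (auto dest: antisymD)
  then show ?case using Cons w' by auto
qed simp

section \<open>The braiding of the tensor algebra induced by the flip\<close>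

lemma tmul_word [simp]: "tmul (word u) (word v) = word (u @ v)"
  by (simp add: tmul_def lin_ext_word[OF vector_space_smul])

lemma linmap_tmul: "linmap smul smul (\<lambda>p. tmul p q)" "linmap smul smul (\<lambda>q. tmul p q)"
  unfolding tmul_def
  by (intro linmap_lin_ext linmap_lin_ext_fun vector_space_smul)+

lemma tmul_car: "p \<in> car (tens V) \<Longrightarrow> q \<in> car (tens V) \<Longrightarrow> tmul p q \<in> car (tens V)"
proof -
  assume "p \<in> car (tens V)" "q \<in> car (tens V)"
  moreover have "free.subspace (car (tens V))" by (simp add: tens_def)
  ultimately show ?thesis
    unfolding tmul_def by (intro lin_ext_car) (auto simp: car_tens)
qed

lemma subspace_car_tens: "free.subspace (car (tens V))"
  by (simp add: tens_def)

lemma tswap_word: "tswap (word [a, b]) = word [b, a]"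
  by (simp add: tswap_def lin_ext_word[OF vector_space_smul])

lemma brd_at_swap: "brd_at tswap (Suc (length u)) (word (u @ [a, b] @ v)) = word (u @ [b, a] @ v)"
  by (simp add: brd_at_def lin_ext_word[OF vector_space_smul] tswap_word nth_append)

lemma foldr_comp_append: "foldr (\<lambda>j g. F j \<circ> g) (xs @ ys) id = foldr (\<lambda>j g. F j \<circ> g) xs id \<circ> foldr (\<lambda>j g. F j \<circ> g) ys id"
  by (induction xs) auto

text \<open>The last factor of the row acts first and exchanges \<open>b\<close> with the last
  letter of \<open>u\<close>; the row carries \<open>b\<close> leftwards over \<open>u\<close> one
  letter at a time, hence the induction from the right end of \<open>u\<close>. Prefix and suffix
  are arbitrary because the row is applied in the middle of longer words.\<close>

lemma brd_row_swap:
  "brd_row tswap (Suc (length p)) (length u) (word (p @ u @ [b] @ q)) = (word (p @ [b] @ u @ q) :: 'a list \<Rightarrow>\<^sub>0 'k::field)"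
proof (induction u arbitrary: q rule: rev_induct)
  case Nil
  then show ?case by (simp add: brd_row_def)
next
  case (snoc a u)
  have upt: "[Suc (length p)..<Suc (length p) + length (u @ [a])] =
      [Suc (length p)..<Suc (length p) + length u] @ [Suc (length (p @ u))]"
    by simp
  have "brd_row tswap (Suc (length p)) (length (u @ [a])) (word (p @ (u @ [a]) @ [b] @ q) :: 'a list \<Rightarrow>\<^sub>0 'k)
     = brd_row tswap (Suc (length p)) (length u) (brd_at tswap (Suc (length (p @ u))) (word ((p @ u) @ [a, b] @ q)))"
    unfolding brd_row_def upt foldr_comp_append by simp
  also have "\<dots> = word (p @ [b] @ (u @ [a]) @ q)"
    unfolding brd_at_swap using snoc.IH[of "[a] @ q"] by simp
  finally show ?case .
qed

lemma brd_block_swap: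
  "brd_block tswap (length u) (length v) (word (u @ v)) = (word (v @ u) :: 'a list \<Rightarrow>\<^sub>0 'k::field)"
proof -
  \<comment> \<open>After k rows the first k letters of \<open>v\<close> have passed in front of
    \<open>u\<close>.\<close>
  have "foldr (\<lambda>i g. brd_row tswap i (length u) \<circ> g) (rev [1..<k + 1]) id (word (u @ v)) = (word (take k v @ u @ drop k v) :: 'a list \<Rightarrow>\<^sub>0 'k)"
    if "k \<le> length v" for k
    using that
  proof (induction k)
    case (Suc k)
    have "brd_row tswap (Suc (length (take k v))) (length u) (word (take k v @ u @ [v ! k] @ drop (Suc k) v))
       = (word (take k v @ [v ! k] @ u @ drop (Suc k) v) :: 'a list \<Rightarrow>\<^sub>0 'k)"
      by (rule brd_row_swap)
    then show ?case using Suc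
      by (simp add: take_Suc_conv_app_nth Cons_nth_drop_Suc[symmetric] min_def)
  qed simp
  from this[of "length v"] show ?thesis by (simp add: brd_block_def)
qed

lemma linmap_words: "linmap smul m g \<Longrightarrow> lin_ext m (\<lambda>v. g (word v)) q = g q"
  using linmap_lin_ext_comp[of smul m g word q] by (simp add: lin_ext_word_id)

text \<open>\<open>tens_brd\<close> takes the entries of a tensor apart into words, so it agrees
  with the flip only up to tensor relations; under pairings the two agree exactly.\<close>

lemma ev2_tens_brd_swap:
  fixes g h :: "('a list \<Rightarrow>\<^sub>0 'k::field) \<Rightarrow> 'k"
  assumes g: "linmap smul (*) g" and h: "linmap smul (*) h"
  shows "evf g h (tens_brd tswap s) = ev2 (*) (\<lambda>x y. g y * h x) s"
proof -
  have "lin_ext (*) (\<lambda>v. g (word v) * h (word u)) q = g q * h (word u)" for u q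
    using linmap_words[OF linmap_times_const[OF g]] by simp
  moreover have "lin_ext (*) (\<lambda>u. g q * h (word u)) p = g q * h p" for p q
    using linmap_words[OF linmap_const_times[OF h]] by simp
  ultimately show ?thesis
    by (simp add: tens_brd_def brd_block_swap lin_ext_word[OF vector_space_smul] lin_ext_word[OF vector_space_mult]
        lin_ext_lin_ext[OF vector_space_mult] del: One_nat_def)
qed

lemma tens_brd_swap_car:
  fixes V :: "('k::field, 'a::ab_group_add, 'z) bgspace_scheme"
  assumes s: "s \<in> car (tpow (sym_alg V) 2)"
  shows "tens_brd tswap s \<in> car (tpow (sym_alg V) 2)"
  unfolding tens_brd_def
proof (rule lin_ext_car[OF subspace_car_tpow], rule lin_ext_car[OF subspace_car_tpow], rule lin_ext_car[OF subspace_car_tpow])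
  fix pq u v assume pq: "pq \<in> keys s" and u: "u \<in> keys (pq ! 0)" and v: "v \<in> keys (pq ! 1)"
  obtain p q where "pq = [p, q]" "p \<in> car (tens V)" "q \<in> car (tens V)"
    using keys_tpow[OF s pq] by (auto simp: length_2_conv sym_alg_def)
  then have "set u \<subseteq> car V" "set v \<subseteq> car V" using u v by (auto simp: car_tens)
  then show "lin_ext smul (\<lambda>w. word [word (take (length v) w), word (drop (length v) w)])
      (brd_block tswap (length u) (length v) (word (u @ v))) \<in> car (tpow (sym_alg V) 2)"
    by (simp add: brd_block_swap lin_ext_word[OF vector_space_smul]) (simp add: sym_alg_def car_tens)
qed

section \<open>The symmetric algebra of a flip is spanned by sorted words\<close>

context
  fixes V :: "('k::field, 'a::ab_group_add, 'z) bgspace_scheme"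
  assumes kV: "kspace V" and brdV: "brd V = tswap"
begin

lemma tens_rel_car: "tens_rel V \<subseteq> car (tens V)"
proof -
  interpret vector_space "scl V" using kV by (simp add: kspace_def)
  have sub: "subspace (car V)" "nul V \<subseteq> car V" using kV by (auto simp: kspace_def)
  have w: "word w \<in> car (tens V)" if "set w \<subseteq> car V" for w using that by (simp add: car_tens)
  show ?thesis
    unfolding tens_rel_def
    using subspace_add[OF sub(1)] subspace_scale[OF sub(1)] sub(2)
    by (auto intro!: free.subspace_diff[OF subspace_car_tens] free.subspace_scale[OF subspace_car_tens] w simp del: smul_single)
qed

lemma sym_nul_car: "sym_nul V \<subseteq> car (tens V)"
  unfolding sym_nul_def
proof (rule free.span_minimal[OF _ subspace_car_tens], intro Un_least)
  show "nul (tens V) \<subseteq> car (tens V)"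
    unfolding nul_tens by (rule free.span_minimal[OF tens_rel_car subspace_car_tens])
  have "t - brd V t \<in> car (tens V)" if "t \<in> car (tpow V 2)" for t
  proof -
    have "t \<in> car (tens V)" "tswap t \<in> car (tens V)"
      using that tswap_car[OF that] by (auto simp: car_tens car_tpow)
    then show ?thesis using free.subspace_diff[OF subspace_car_tens] by (simp add: brdV)
  qed
  then show "{tmul p (tmul (t - brd V t) q) |p t q. p \<in> car (tens V) \<and> t \<in> car (tpow V 2) \<and> q \<in> car (tens V)} \<subseteq> car (tens V)"
    by (auto intro!: tmul_car)
qed

lemma subspace_sym_nul: "free.subspace (sym_nul V)"
  by (simp add: sym_nul_def)

lemma kspace_sym_alg: "kspace (sym_alg V)"
  using sym_nul_car
  by (simp add: kspace_def sym_alg_def subspace_sym_nul subspace_car_tens vector_space_smul)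

lemma nul_tens_sym: "nul (tens V) \<subseteq> sym_nul V"
  unfolding sym_nul_def by (auto intro: free.span_base)

lemma sym_swap:
  assumes "set u \<subseteq> car V" "a \<in> car V" "b \<in> car V" "set v \<subseteq> car V"
  shows "word (u @ [a, b] @ v) - word (u @ [b, a] @ v) \<in> sym_nul V"
proof -
  have "tmul (word u) (tmul (word [a, b] - brd V (word [a, b])) (word v)) \<in> sym_nul V"
    unfolding sym_nul_def using assms by (intro free.span_base UnI2) (fastforce simp: car_tens)
  then show ?thesis
    by (simp add: brdV tswap_word linmap_diff[OF linmap_tmul(1)] linmap_diff[OF linmap_tmul(2)])
qed

text \<open>Each adjacent swap costs an element of \<open>sym_nul V\<close>. The letters standing
  before \<open>x\<close> move into the prefix \<open>u\<close> during the induction, which is why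
  \<open>u\<close> is arbitrary.\<close>

lemma sym_extract:
  "set (u @ w) \<subseteq> car V \<Longrightarrow> x \<in> set w \<Longrightarrow> word (u @ w) - word (u @ x # remove1 x w) \<in> sym_nul V"
proof (induction w arbitrary: u)
  case (Cons y w)
  show ?case
  proof (cases "x = y")
    case True
    then show ?thesis using free.subspace_0[OF subspace_sym_nul] by simp
  next
    case False
    then have x: "x \<in> set w" using Cons.prems by auto
    have "word ((u @ [y]) @ w) - word ((u @ [y]) @ x # remove1 x w) \<in> sym_nul V"
      using Cons.prems x by (intro Cons.IH) auto
    moreover have "word (u @ [y, x] @ remove1 x w) - word (u @ [x, y] @ remove1 x w) \<in> sym_nul V"
      using Cons.prems x set_remove1_subset[of x w] by (intro sym_swap) auto
    ultimately have "(word ((u @ [y]) @ w) - word ((u @ [y]) @ x # remove1 x w)) +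
       (word (u @ [y, x] @ remove1 x w) - word (u @ [x, y] @ remove1 x w)) \<in> sym_nul V"
      by (rule free.subspace_add[OF subspace_sym_nul])
    then show ?thesis using False by simp
  qed
qed simp

lemma sym_perm:
  "mset w = mset w' \<Longrightarrow> set (u @ w) \<subseteq> car V \<Longrightarrow> word (u @ w) - word (u @ w') \<in> sym_nul V"
proof (induction w arbitrary: u w')
  case Nil
  then show ?case using free.subspace_0[OF subspace_sym_nul] by simp
next
  case (Cons x w)
  have x: "x \<in> set w'" using Cons.prems(1) by (metis list.set_intros(1) set_mset_mset)
  have "mset w = mset (remove1 x w')" using Cons.prems(1) by (metis add_mset_remove_trivial mset.simps(2) mset_remove1)
  then have "word ((u @ [x]) @ w) - word ((u @ [x]) @ remove1 x w') \<in> sym_nul V"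
    using Cons.prems by (intro Cons.IH) auto
  moreover have "set w' = set (x # w)" using Cons.prems(1) by (metis set_mset_mset)
  then have "word (u @ w') - word (u @ x # remove1 x w') \<in> sym_nul V"
    using Cons.prems by (intro sym_extract x) auto
  ultimately have "(word ((u @ [x]) @ w) - word ((u @ [x]) @ remove1 x w')) - (word (u @ w') - word (u @ x # remove1 x w')) \<in> sym_nul V"
    by (rule free.subspace_diff[OF subspace_sym_nul])
  then show ?case by simp
qed

text \<open>The letters are expanded in \<open>B\<close> from left to right: \<open>u\<close> is the
  part already expanded, \<open>w\<close> the part still to do.\<close>

lemma tens_generated:
  assumes B: "B \<subseteq> car V" "car V \<subseteq> module.span (scl V) B"
  shows "set u \<subseteq> B \<Longrightarrow> set w \<subseteq> car V \<Longrightarrow> word (u @ w) \<in> free.span ({word w | w. set w \<subseteq> B} \<union> nul (tens V))"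
    (is "_ \<Longrightarrow> _ \<Longrightarrow> _ \<in> ?T")
proof (induction w arbitrary: u)
  case Nil
  then show ?case by (intro free.span_base) auto
next
  case (Cons x w)
  interpret vector_space "scl V" using kV by (simp add: kspace_def)
  have sub: "subspace (car V)" "subspace (nul V)" using kV by (auto simp: kspace_def)
  have uV: "set u \<subseteq> car V" using Cons.prems B by auto
  have nulT: "z \<in> ?T" if "z \<in> tens_rel V" for z
    using that by (intro free.span_base UnI2) (simp add: nul_tens free.span_base)
  have "x \<in> span B" using Cons.prems B by auto
  then have "x \<in> car V \<and> word (u @ [x] @ w) \<in> ?T"
  proof (induction rule: span_induct_alt)
    case base
    have "word (u @ [0] @ w) \<in> tens_rel V"
      using uV Cons.prems subspace_0[OF sub(2)] by (intro tens_relI) auto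
    then show ?case using nulT subspace_0[OF sub(1)] by blast
  next
    case (step c b y)
    have b: "b \<in> car V" using step B by auto
    have cb: "scl V c b \<in> car V" by (rule subspace_scale[OF sub(1) b])
    have y: "y \<in> car V" using step by simp
    have w: "set w \<subseteq> car V" using Cons.prems by simp
    have 1: "word (u @ [b] @ w) \<in> ?T"
      using Cons.IH[of "u @ [b]"] Cons.prems step.hyps by simp
    have 2: "word (u @ [scl V c b] @ w) - smul c (word (u @ [b] @ w)) \<in> ?T"
      using uV b w by (intro nulT tens_relI)
    have 3: "word (u @ [scl V c b + y] @ w) - word (u @ [scl V c b] @ w) - word (u @ [y] @ w) \<in> ?T"
      using uV cb y w by (intro nulT tens_relI)
    have "(word (u @ [scl V c b + y] @ w) - word (u @ [scl V c b] @ w) - word (u @ [y] @ w))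
      + (word (u @ [scl V c b] @ w) - smul c (word (u @ [b] @ w))) + smul c (word (u @ [b] @ w)) + word (u @ [y] @ w) \<in> ?T"
      using step.IH by (intro free.span_add 1 2 3 free.span_scale) auto
    then show ?case using subspace_add[OF sub(1) cb y] by simp
  qed
  then show ?case by simp
qed

text \<open>The spanning half of the PBW statement holds in every symmetric algebra of a flip:
  expand the letters in \<open>B\<close>, then sort them.\<close>

lemma sym_generated:
  assumes B: "B \<subseteq> car V" "car V \<subseteq> module.span (scl V) B" and r: "well_order_on B r"
    and t: "t \<in> car (tens V)"
  shows "\<exists>s\<in>free.span {word w | w. set w \<subseteq> B \<and> sorted_wrt (\<lambda>x y. (x, y) \<in> r) w}. t - s \<in> sym_nul V"
proof -
  let ?S = "{word w | w. set w \<subseteq> B \<and> sorted_wrt (\<lambda>x y. (x, y) \<in> r) w} :: ('a list \<Rightarrow>\<^sub>0 'k) set"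
  have "word w \<in> free.span (?S \<union> sym_nul V)" if w: "set w \<subseteq> B" for w
  proof -
    obtain w' where w': "mset w' = mset w" "sorted_wrt (\<lambda>x y. (x, y) \<in> r) w'"
      using sorted_exists[OF r w] by blast
    have "set w' \<subseteq> B" using w'(1) w by (metis set_mset_mset)
    then have "word w' \<in> free.span (?S \<union> sym_nul V)" using w' by (intro free.span_base) auto
    moreover have "word w - word w' \<in> sym_nul V" using sym_perm[of w w' "[]"] w' w B by auto
    then have "word w - word w' \<in> free.span (?S \<union> sym_nul V)" by (intro free.span_base) auto
    ultimately have "word w' + (word w - word w') \<in> free.span (?S \<union> sym_nul V)" by (rule free.span_add)
    then show ?thesis by simp
  qed
  then have "{word w | w. set w \<subseteq> B} \<union> nul (tens V) \<subseteq> free.span (?S \<union> sym_nul V)"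
    using nul_tens_sym by (auto intro: free.span_base)
  then have T: "free.span ({word w | w. set w \<subseteq> B} \<union> nul (tens V)) \<subseteq> free.span (?S \<union> sym_nul V)"
    by (rule free.span_minimal) simp
  have "lin_ext smul word t \<in> free.span (?S \<union> sym_nul V)"
    by (rule lin_ext_car) (use t tens_generated[OF B, of "[]"] T in \<open>auto simp: car_tens\<close>)
  then have "t \<in> free.span (?S \<union> sym_nul V)" by (simp add: lin_ext_word_id)
  then obtain s z where "t = s + z" "s \<in> free.span ?S" "z \<in> free.span (sym_nul V)"
    unfolding free.span_Un by blast
  moreover have "free.span (sym_nul V) = sym_nul V" by (simp add: subspace_sym_nul)
  ultimately show ?thesis by (intro bexI[of _ s]) auto
qed

end

section \<open>Functionals acting on a Hopf algebra\<close>

definition bilin :: "('k \<Rightarrow> 'a \<Rightarrow> 'a) \<Rightarrow> ('k \<Rightarrow> 'b \<Rightarrow> 'b) \<Rightarrow> ('a::ab_group_add \<Rightarrow> 'a \<Rightarrow> 'b::ab_group_add) \<Rightarrow> bool"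
  where "bilin s m \<beta> \<longleftrightarrow> (\<forall>x. linmap s m (\<beta> x)) \<and> (\<forall>y. linmap s m (\<lambda>x. \<beta> x y))"

lemma bilinI: "(\<And>x. linmap s m (\<lambda>y. \<beta> x y)) \<Longrightarrow> (\<And>y. linmap s m (\<lambda>x. \<beta> x y)) \<Longrightarrow> bilin s m \<beta>"
  by (simp add: bilin_def)

lemma bilinD: "bilin s m \<beta> \<Longrightarrow> linmap s m (\<lambda>y. \<beta> x y)" "bilin s m \<beta> \<Longrightarrow> linmap s m (\<lambda>x. \<beta> x y)"
  by (simp_all add: bilin_def)

lemma bilin_functionals:
  fixes f :: "_ \<Rightarrow> 'k::field"
  shows "linmap s (*) f \<Longrightarrow> linmap s (*) g \<Longrightarrow> bilin s (*) (\<lambda>x y. f x * g y)"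
  by (intro bilinI linmap_const_times linmap_times_const)

lemma bilin_imp_bilin_on: "bilin s m \<beta> \<Longrightarrow> bilin_on (full_space s) m \<beta>"
  using linmap_0[OF bilinD(1), of s m \<beta>] linmap_0[OF bilinD(2), of s m \<beta>]
  by (simp add: bilin_on_def full_space_def bilin_def linmap_def)

lemma car_full [simp]: "car (full_space s) = UNIV" "nul (full_space s) = {0}" "scl (full_space s) = s"
  by (simp_all add: full_space_def)

lemma kspace_full: "vector_space s \<Longrightarrow> kspace (full_space s)"
  by (simp add: kspace_def module.subspace_UNIV module.subspace_single_0 module_iff_vector_space)

section \<open>Sweedler sums of bilinear forms\<close>

context hopf_algebra
begin

abbreviation H2 :: "('k, 'h list \<Rightarrow>\<^sub>0 'k) kspace" where "H2 \<equiv> tpow (full_space scale) 2"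

abbreviation functional :: "('h \<Rightarrow> 'k) \<Rightarrow> bool" where "functional \<equiv> linmap scale (*)"

text \<open>The Sweedler sum of \<beta>(x_1, x_2). As \<open>comult x\<close> is only a
  representative, the value is meaningful for bilinear \<open>\<beta>\<close>, whence the many
  bilinearity premises below.\<close>

definition sw :: "('k \<Rightarrow> 'm \<Rightarrow> 'm) \<Rightarrow> ('h \<Rightarrow> 'h \<Rightarrow> 'm::ab_group_add) \<Rightarrow> 'h \<Rightarrow> 'm" where
  "sw m \<beta> x = ev2 m \<beta> (comult x)"

lemma comult_car: "comult x \<in> car H2"
  using comult_hom by (auto simp: khom_def)

lemma keys_comult:
  assumes "w \<in> keys (comult x)"
  obtains a b where "w = [a, b]"
  using keys_tpow(1)[OF comult_car assms] by (auto simp: length_2_conv)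

lemma sw_cong: "(\<And>a b. \<beta> a b = \<gamma> a b) \<Longrightarrow> sw m \<beta> x = sw m \<gamma> x"
  unfolding sw_def by (intro lin_ext_cong) auto

lemma sw_keq:
  assumes "vector_space m" "bilin scale m \<beta>" "keq H2 (comult x) t"
  shows "sw m \<beta> x = ev2 m \<beta> t"
  unfolding sw_def by (rule ev2_keq[OF assms(1) bilin_imp_bilin_on[OF assms(2)] assms(3)])

lemma linmap_sw:
  assumes "vector_space m" "bilin scale m \<beta>"
  shows "linmap scale m (sw m \<beta>)"
proof (rule linmapI)
  interpret m: vector_space m by fact
  note e = ev2_keq[OF assms(1) bilin_imp_bilin_on[OF assms(2)]]
  show "sw m \<beta> (x + y) = sw m \<beta> x + sw m \<beta> y" for x y
    using e[of "comult (x + y)" "comult x + comult y"] comult_hom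
    by (simp add: khom_def sw_def lin_ext_add[OF assms(1)])
  show "sw m \<beta> (scale c x) = m c (sw m \<beta> x)" for c x
    using e[of "comult (scale c x)" "smul c (comult x)"] comult_hom
    by (simp add: khom_def sw_def lin_ext_smul[OF assms(1)] tpow_def Let_def)
qed

lemma linmap_sw_param:
  assumes "vector_space m" "\<And>a b. linmap s m (\<lambda>y. \<beta> y a b)"
  shows "linmap s m (\<lambda>y. sw m (\<beta> y) x)"
  unfolding sw_def by (rule linmap_lin_ext_fun[OF assms(1)]) (rule assms(2))

lemma sw_fun_scale: "vector_space m \<Longrightarrow> sw m (\<lambda>a b. m c (\<beta> a b)) x = m c (sw m \<beta> x)"
  unfolding sw_def by (rule lin_ext_fun_scale)

lemma linmap_sw_out: "linmap m m' f \<Longrightarrow> f (sw m \<beta> x) = sw m' (\<lambda>a b. f (\<beta> a b)) x"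
  unfolding sw_def by (rule linmap_lin_ext_comp)

lemma sw_commute:
  "vector_space m \<Longrightarrow> sw m (\<lambda>a b. sw m (\<lambda>c d. \<phi> a b c d) y) x = sw m (\<lambda>c d. sw m (\<lambda>a b. \<phi> a b c d) x) y"
  unfolding sw_def by (rule lin_ext_swap)

lemma mult_linear: "linmap scale scale (\<lambda>x. a * x)" "linmap scale scale (\<lambda>x. x * a)"
  by (auto simp: linmap_def algebra_simps scale_mult_left scale_mult_right)

lemma linmap_counit: "functional counit"
  using counit_linear by (simp add: linmap_def Vector_Spaces.linear_iff)

lemma linmap_antipode: "linmap scale scale antipode"
  using antipode_linear by (simp add: linmap_def Vector_Spaces.linear_iff)

lemma sw_mult:
  assumes m: "vector_space m" and \<beta>: "bilin scale m \<beta>"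
  shows "sw m \<beta> (x * y) = sw m (\<lambda>a b. sw m (\<lambda>c d. \<beta> (a * c) (b * d)) y) x"
proof -
  have "sw m \<beta> (x * y) = ev2 m \<beta> (lin_ext smul (\<lambda>u. lin_ext smul (\<lambda>v. word [u ! 0 * v ! 0, u ! 1 * v ! 1])
      (comult y)) (comult x))"
    by (rule sw_keq[OF m \<beta> comult_mult])
  also have "\<dots> = sw m (\<lambda>a b. sw m (\<lambda>c d. \<beta> (a * c) (b * d)) y) x"
    by (simp add: sw_def lin_ext_lin_ext[OF m] lin_ext_word[OF m])
  finally show ?thesis .
qed

lemma sw_one:
  assumes m: "vector_space m" and \<beta>: "bilin scale m \<beta>"
  shows "sw m \<beta> 1 = \<beta> 1 1"
  using sw_keq[OF m \<beta> comult_one] by (simp add: lin_ext_word[OF m])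

lemma sw_counit:
  assumes f: "linmap scale m f"
  shows "sw m (\<lambda>a b. m (counit a) (f b)) x = f x" "sw m (\<lambda>a b. m (counit b) (f a)) x = f x"
proof -
  have "f (lin_ext scale (\<lambda>w. scale (counit (w ! 0)) (w ! 1)) (comult x)) = sw m (\<lambda>a b. m (counit a) (f b)) x"
    by (simp add: linmap_lin_ext_comp[OF f] sw_def linmap_scale[OF f])
  then show "sw m (\<lambda>a b. m (counit a) (f b)) x = f x" by (simp only: counit_left)
  have "f (lin_ext scale (\<lambda>w. scale (counit (w ! 1)) (w ! 0)) (comult x)) = sw m (\<lambda>a b. m (counit b) (f a)) x"
    by (simp add: linmap_lin_ext_comp[OF f] sw_def linmap_scale[OF f])
  then show "sw m (\<lambda>a b. m (counit b) (f a)) x = f x" by (simp only: counit_right)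
qed

lemma sw_antipode_collapse:
  assumes f: "linmap scale m f"
  shows "sw m (\<lambda>a b. f (antipode a * b)) x = m (counit x) (f 1)"
    "sw m (\<lambda>a b. f (a * antipode b)) x = m (counit x) (f 1)"
proof -
  have "f (lin_ext scale (\<lambda>w. antipode (w ! 0) * w ! 1) (comult x)) = sw m (\<lambda>a b. f (antipode a * b)) x"
    by (simp add: linmap_lin_ext_comp[OF f] sw_def)
  then show "sw m (\<lambda>a b. f (antipode a * b)) x = m (counit x) (f 1)"
    by (simp only: antipode_left linmap_scale[OF f])
  have "f (lin_ext scale (\<lambda>w. w ! 0 * antipode (w ! 1)) (comult x)) = sw m (\<lambda>a b. f (a * antipode b)) x"
    by (simp add: linmap_lin_ext_comp[OF f] sw_def)
  then show "sw m (\<lambda>a b. f (a * antipode b)) x = m (counit x) (f 1)"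
    by (simp only: antipode_right linmap_scale[OF f])
qed

definition trilin :: "('k \<Rightarrow> 'm \<Rightarrow> 'm) \<Rightarrow> ('h \<Rightarrow> 'h \<Rightarrow> 'h \<Rightarrow> 'm::ab_group_add) \<Rightarrow> bool" where
  "trilin m \<gamma> \<longleftrightarrow> (\<forall>y z. linmap scale m (\<lambda>x. \<gamma> x y z)) \<and> (\<forall>x z. linmap scale m (\<lambda>y. \<gamma> x y z))
    \<and> (\<forall>x y. linmap scale m (\<lambda>z. \<gamma> x y z))"

text \<open>Both iterated sums are values of one trilinear form on the two iterated coproducts,
  which differ by tensor relations.\<close>

lemma sw_coassoc:
  assumes m: "vector_space m" and \<gamma>: "trilin m \<gamma>"
  shows "sw m (\<lambda>a b. sw m (\<lambda>c d. \<gamma> c d b) a) x = sw m (\<lambda>a b. sw m (\<lambda>c d. \<gamma> a c d) b) x"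
proof -
  interpret m: vector_space m by fact
  \<comment> \<open>Extended by 0 to words of length other than 3, since the relations come in all
    lengths.\<close>
  define \<phi> where "\<phi> w = (if length w = 3 then \<gamma> (w ! 0) (w ! 1) (w ! 2) else 0)" for w
  let ?L = "lin_ext smul (\<lambda>w. tmul (comult (w ! 0)) (word [w ! 1])) (comult x)"
  let ?R = "lin_ext smul (\<lambda>w. tmul (word [w ! 0]) (comult (w ! 1))) (comult x)"
  have len: "length (u @ [z] @ v) = 3 \<longleftrightarrow> (\<exists>a b. u = [a, b] \<and> v = []) \<or> (\<exists>a b. u = [a] \<and> v = [b])
      \<or> (\<exists>a b. u = [] \<and> v = [a, b])" for u v and z :: 'h
    by (auto simp: length_Suc_conv numeral_3_eq_3 add_eq_if length_0_conv split: if_splits)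
      (auto simp: length_Suc_conv neq_Nil_conv)
  have g: "\<gamma> (p + p') q r = \<gamma> p q r + \<gamma> p' q r" "\<gamma> p (q + q') r = \<gamma> p q r + \<gamma> p q' r"
     "\<gamma> p q (r + r') = \<gamma> p q r + \<gamma> p q r'" "\<gamma> (scale c p) q r = m c (\<gamma> p q r)"
     "\<gamma> p (scale c q) r = m c (\<gamma> p q r)" "\<gamma> p q (scale c r) = m c (\<gamma> p q r)"
     "\<gamma> 0 q r = 0" "\<gamma> p 0 r = 0" "\<gamma> p q 0 = 0"
    for p q r p' q' r' c
    using \<gamma> linmap_0[of scale m "\<lambda>x. \<gamma> x q r"] linmap_0[of scale m "\<lambda>x. \<gamma> p x r"] linmap_0[of scale m "\<lambda>x. \<gamma> p q x"]
    by (auto simp: trilin_def linmap_def)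
  have "lin_ext m \<phi> (?L - ?R) = 0"
  proof (rule lin_ext_tens_rel[OF m])
    show "?L - ?R \<in> free.span (tens_rel (full_space scale))"
      using coassoc[of x] by (simp add: keq_def nul_tpow)
    show "\<phi> (u @ [z + y] @ v) = \<phi> (u @ [z] @ v) + \<phi> (u @ [y] @ v)" for u z y v
      unfolding \<phi>_def len by (auto simp: g numeral_2_eq_2)
    show "\<phi> (u @ [scl (full_space scale) c z] @ v) = m c (\<phi> (u @ [z] @ v))" for u c z v
      unfolding \<phi>_def len by (auto simp: g numeral_2_eq_2)
    show "\<phi> (u @ [z] @ v) = 0" if "z \<in> nul (full_space scale)" for u z v
      using that unfolding \<phi>_def len by (auto simp: g numeral_2_eq_2)
  qed
  moreover have "lin_ext m \<phi> ?L = sw m (\<lambda>a b. sw m (\<lambda>c d. \<gamma> c d b) a) x"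
    unfolding sw_def lin_ext_lin_ext[OF m]
  proof (intro lin_ext_cong)
    fix w assume "w \<in> keys (comult x)"
    show "lin_ext m \<phi> (tmul (comult (w ! 0)) (word [w ! 1])) = ev2 m (\<lambda>c d. \<gamma> c d (w ! 1)) (comult (w ! 0))"
      unfolding tmul_def lin_ext_lin_ext[OF m]
      by (intro lin_ext_cong) (auto simp: lin_ext_word[OF vector_space_smul] lin_ext_word[OF m] \<phi>_def elim!: keys_comult)
  qed
  moreover have "lin_ext m \<phi> ?R = sw m (\<lambda>a b. sw m (\<lambda>c d. \<gamma> a c d) b) x"
    unfolding sw_def lin_ext_lin_ext[OF m]
  proof (intro lin_ext_cong)
    fix w assume "w \<in> keys (comult x)"
    show "lin_ext m \<phi> (tmul (word [w ! 0]) (comult (w ! 1))) = ev2 m (\<lambda>c d. \<gamma> (w ! 0) c d) (comult (w ! 1))"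
      unfolding tmul_def lin_ext_lin_ext[OF m] lin_ext_word[OF m]
      by (intro lin_ext_cong) (auto simp: \<phi>_def elim!: keys_comult)
  qed
  ultimately show ?thesis by (simp add: lin_ext_diff[OF m])
qed

section \<open>The dual algebra and its two actions\<close>

definition conv :: "('h \<Rightarrow> 'k) \<Rightarrow> ('h \<Rightarrow> 'k) \<Rightarrow> 'h \<Rightarrow> 'k" where
  "conv f g x = sw (*) (\<lambda>a b. f a * g b) x"

text \<open>Under \<open>conv\<close> the functionals form an algebra with unit
  \<open>counit\<close>. \<open>hit\<close> is its right action on H and \<open>tih\<close> its left
  action; pairing with a functional turns either one into a convolution.\<close>

definition hit :: "('h \<Rightarrow> 'k) \<Rightarrow> 'h \<Rightarrow> 'h" where
  "hit f x = sw scale (\<lambda>a b. scale (f a) b) x"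

definition tih :: "('h \<Rightarrow> 'k) \<Rightarrow> 'h \<Rightarrow> 'h" where
  "tih f x = sw scale (\<lambda>a b. scale (f b) a) x"

lemma linmap_conv: "functional f \<Longrightarrow> functional g \<Longrightarrow> functional (conv f g)"
  unfolding conv_def[abs_def] by (intro linmap_sw vector_space_mult bilin_functionals)

lemma linmap_hit: "functional f \<Longrightarrow> linmap scale scale (hit f)"
  unfolding hit_def[abs_def]
  by (intro linmap_sw bilinI vector_space_axioms linmap_scale_by linmap_fun_scale linmap_id)

lemma functional_hit: "functional g \<Longrightarrow> g (hit f x) = conv f g x"
  unfolding hit_def conv_def by (simp add: linmap_sw_out[of scale "(*)" g] linmap_scale)

lemma functional_tih: "functional f \<Longrightarrow> f (tih g x) = conv f g x"
  unfolding tih_def conv_def by (simp add: linmap_sw_out[of scale "(*)" f] linmap_scale mult.commute)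

lemma linmap_hit_out: "linmap scale m F \<Longrightarrow> F (hit f x) = sw m (\<lambda>a b. m (f a) (F b)) x"
  unfolding hit_def by (simp add: linmap_sw_out linmap_scale)

lemma conv_assoc:
  assumes "functional f" "functional g" "functional h"
  shows "conv (conv f g) h x = conv f (conv g h) x"
proof -
  have "conv (conv f g) h x = sw (*) (\<lambda>a b. sw (*) (\<lambda>c d. f c * g d * h b) a) x"
    unfolding conv_def
    by (intro sw_cong) (simp add: linmap_sw_out[OF linmap_times_const[OF linmap_id]])
  also have "\<dots> = sw (*) (\<lambda>a b. sw (*) (\<lambda>c d. f a * g c * h d) b) x"
    by (intro sw_coassoc vector_space_mult)
      (auto simp: trilin_def assms intro!: linmap_times_const linmap_const_times)
  also have "\<dots> = conv f (conv g h) x"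
    unfolding conv_def
    by (intro sw_cong) (simp add: linmap_sw_out[OF linmap_const_times[OF linmap_id]] mult.assoc)
  finally show ?thesis .
qed

lemma hit_hit:
  assumes "functional f" "functional g"
  shows "hit g (hit f x) = hit (conv f g) x"
  by (rule eq_test) (simp add: functional_hit assms linmap_conv conv_assoc)

lemma hit_counit: "hit counit x = x"
  unfolding hit_def using sw_counit(1)[OF linmap_id, of x] by simp

lemma tih_counit: "tih counit x = x"
  unfolding tih_def using sw_counit(2)[OF linmap_id, of x] by simp

lemma conv_counit: "functional f \<Longrightarrow> conv counit f x = f x" "functional f \<Longrightarrow> conv f counit x = f x"
  using functional_hit[of f counit x] functional_tih[of f counit x] by (simp_all add: hit_counit tih_counit)

lemma hit_one: "functional f \<Longrightarrow> hit f 1 = scale (f 1) 1"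
  unfolding hit_def
  by (intro sw_one bilinI vector_space_axioms linmap_scale_by linmap_fun_scale linmap_id)

section \<open>Expansion of Sweedler sums in a basis\<close>

definition legs :: "'h set \<Rightarrow> 'h \<Rightarrow> 'h set" where
  "legs B x = (\<Union>w\<in>keys (comult x). {b. representation B (w ! 0) b \<noteq> 0})"

abbreviation coord :: "'h set \<Rightarrow> 'h \<Rightarrow> 'h \<Rightarrow> 'k" where "coord B b \<equiv> \<lambda>u. representation B u b"

lemma finite_legs: "finite (legs B x)"
  by (auto simp: legs_def finite_representation)

lemma legs_subset: "legs B x \<subseteq> B"
  by (auto simp: legs_def dest: representation_ne_zero)

text \<open>Writing the left legs in a basis collects the right legs, so \<Delta>(x) becomes the
  finite sum of b \<otimes> \<open>hit (coord B b) x\<close>. With an adapted basis each term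
  carries information on the degrees of both legs.\<close>

lemma sw_expand:
  assumes m: "vector_space m" and \<beta>: "bilin scale m \<beta>" and B: "independent B" "span B = UNIV"
  shows "sw m \<beta> x = (\<Sum>b\<in>legs B x. \<beta> b (hit (coord B b) x))"
proof -
  interpret m: vector_space m by fact
  have "sw m \<beta> x = lin_ext m (\<lambda>w. \<Sum>b\<in>legs B x. m (representation B (w ! 0) b) (\<beta> b (w ! 1))) (comult x)"
    unfolding sw_def
  proof (rule lin_ext_cong)
    fix w assume w: "w \<in> keys (comult x)"
    have "w ! 0 = (\<Sum>b | representation B (w ! 0) b \<noteq> 0. scale (representation B (w ! 0) b) b)"
      using sum_nonzero_representation_eq[of B "w ! 0"] B by simp
    also have "\<dots> = (\<Sum>b\<in>legs B x. scale (representation B (w ! 0) b) b)"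
      using w by (intro sum.mono_neutral_left finite_legs) (auto simp: legs_def)
    finally have "\<beta> (w ! 0) (w ! 1) = \<beta> (\<Sum>b\<in>legs B x. scale (representation B (w ! 0) b) b) (w ! 1)"
      by simp
    also have "\<dots> = (\<Sum>b\<in>legs B x. m (representation B (w ! 0) b) (\<beta> b (w ! 1)))"
      unfolding linmap_sum[OF bilinD(2)[OF \<beta>, of "w ! 1"]] linmap_scale[OF bilinD(2)[OF \<beta>, of "w ! 1"]] ..
    finally show "\<beta> (w ! 0) (w ! 1) = (\<Sum>b\<in>legs B x. m (representation B (w ! 0) b) (\<beta> b (w ! 1)))" .
  qed
  also have "\<dots> = (\<Sum>b\<in>legs B x. \<beta> b (hit (coord B b) x))"
    by (simp add: lin_ext_fun_sum[OF m] linmap_hit_out[OF bilinD(1)[OF \<beta>]] sw_def)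
  finally show ?thesis .
qed

lemma hit_expand:
  assumes "independent B" "span B = UNIV" "functional f"
  shows "hit f x = (\<Sum>b\<in>legs B x. scale (f b) (hit (coord B b) x))"
  unfolding hit_def[of f]
  by (intro sw_expand assms bilinI vector_space_axioms linmap_scale_by linmap_fun_scale linmap_id)

lemma hit_mult:
  assumes B: "independent B" "span B = UNIV" and f: "functional f"
  shows "hit f (x * y) = (\<Sum>b\<in>legs B x. \<Sum>c\<in>legs B y.
      scale (f (b * c)) (hit (coord B b) x * hit (coord B c) y))"
proof -
  have l: "linmap scale (*) (\<lambda>u. f (u * c))" "linmap scale (*) (\<lambda>u. f (c * u))" for c
    using linmap_comp[OF f] mult_linear by blast+
  have "hit f (x * y) = sw scale (\<lambda>a b. sw scale (\<lambda>c d. scale (f (a * c)) (b * d)) y) x"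
    unfolding hit_def
    by (intro sw_mult bilinI vector_space_axioms linmap_scale_by linmap_fun_scale linmap_id f)
  also have "\<dots> = (\<Sum>b\<in>legs B x. sw scale (\<lambda>c d. scale (f (b * c)) (hit (coord B b) x * d)) y)"
    by (intro sw_expand[OF _ _ B] bilinI vector_space_axioms linmap_sw_param linmap_fun_scale linmap_scale_by mult_linear l)
  also have "\<dots> = (\<Sum>b\<in>legs B x. \<Sum>c\<in>legs B y. scale (f (b * c)) (hit (coord B b) x * hit (coord B c) y))"
    by (intro sum.cong refl sw_expand[OF _ _ B] bilinI vector_space_axioms linmap_sw_param linmap_fun_scale linmap_scale_by mult_linear l)
  finally show ?thesis .
qed

lemma antipode_one: "antipode 1 = 1"
proof -
  have "sw scale (\<lambda>a b. antipode a * b) 1 = scale (counit 1) 1"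
    by (rule sw_antipode_collapse(1)[OF linmap_id])
  moreover have "sw scale (\<lambda>a b. antipode a * b) 1 = antipode 1 * 1"
    by (intro sw_one bilinI vector_space_axioms mult_linear linmap_comp[OF _ linmap_antipode])
  ultimately show ?thesis by (simp add: counit_one)
qed

lemma linmap_mult_left: "linmap s scale f \<Longrightarrow> linmap s scale (\<lambda>x. f x * c)"
  and linmap_mult_right: "linmap s scale f \<Longrightarrow> linmap s scale (\<lambda>x. c * f x)"
  by (auto simp: linmap_def algebra_simps scale_mult_left scale_mult_right)

text \<open>\<open>\<Delta> \<circ> S\<close> and \<open>(S \<otimes> S) \<circ> \<tau> \<circ> \<Delta>\<close> are a left and a right convolution inverse of \<open>\<Delta>\<close>;
  the two ways of evaluating \<open>\<Delta>(S x\<^sub>1) \<Delta>(x\<^sub>2) (S x\<^sub>4 \<otimes> S x\<^sub>3)\<close> identify them.\<close>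

lemma sw_antipode:
  assumes m: "vector_space m" and \<beta>: "bilin scale m \<beta>"
  shows "sw m \<beta> (antipode x) = sw m (\<lambda>a b. \<beta> (antipode b) (antipode a)) x"
proof -
  note l\<beta> = linmap_comp[OF bilinD(2)[OF \<beta>]] linmap_comp[OF bilinD(1)[OF \<beta>]]
  note lm = linmap_mult_left linmap_mult_right linmap_comp[OF linmap_antipode] linmap_id
  \<comment> \<open>\<open>Q a b c\<close> is the value of \<open>\<beta>\<close> on \<Delta>(S a)
    \<Delta>(b) (S c_2 \<otimes> S c_1); \<open>R\<close> and \<open>T\<close> are its inner
    sums.\<close>
  define T where "T p q u v c = sw m (\<lambda>y z. \<beta> (p * u * antipode z) (q * v * antipode y)) c" for p q u v c
  define R where "R p q b c = sw m (\<lambda>u v. T p q u v c) b" for p q b c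
  define Q where "Q a b c = sw m (\<lambda>p q. R p q b c) (antipode a)" for a b c
  have lT: "linmap scale m (\<lambda>p. T p q u v c)" "linmap scale m (\<lambda>q. T p q u v c)" "linmap scale m (\<lambda>u. T p q u v c)"
    "linmap scale m (\<lambda>v. T p q u v c)" "linmap scale m (\<lambda>c. T p q u v c)" for p q u v c
    unfolding T_def
    by (intro linmap_sw_param m l\<beta> lm linmap_sw bilinI)+
  have lR: "linmap scale m (\<lambda>p. R p q b c)" "linmap scale m (\<lambda>q. R p q b c)" "linmap scale m (\<lambda>b. R p q b c)"
    "linmap scale m (\<lambda>c. R p q b c)" for p q b c
    unfolding R_def
    by (intro linmap_sw_param m lT linmap_sw bilinI)+
  have lQ: "linmap scale m (\<lambda>a. Q a b c)" "linmap scale m (\<lambda>b. Q a b c)"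
    "linmap scale m (\<lambda>c. Q a b c)" for a b c
    unfolding Q_def
    by (intro linmap_sw_param m lR linmap_comp[OF linmap_sw linmap_antipode] bilinI)+
  define G where "G c = sw m (\<lambda>y z. \<beta> (antipode z) (antipode y)) c" for c
  \<comment> \<open>First evaluation: S a and b collapse, as \<Delta> is multiplicative.\<close>
  have "sw m (\<lambda>a b. Q a b c) r = m (counit r) (G c)" for r c
  proof -
    define \<beta>' where "\<beta>' s t = sw m (\<lambda>y z. \<beta> (s * antipode z) (t * antipode y)) c" for s t
    have \<beta>': "bilin scale m \<beta>'"
      unfolding \<beta>'_def by (intro bilinI linmap_sw_param m l\<beta> lm)
    have "Q a b c = sw m \<beta>' (antipode a * b)" for a b
      unfolding sw_mult[OF m \<beta>'] Q_def R_def T_def \<beta>'_def ..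
    then show ?thesis
      using sw_antipode_collapse(1)[OF linmap_sw[OF m \<beta>']] sw_one[OF m \<beta>']
      by (simp add: \<beta>'_def G_def)
  qed
  then have "sw m (\<lambda>r c. sw m (\<lambda>a b. Q a b c) r) x = sw m (\<lambda>r c. m (counit r) (G c)) x"
    by simp
  also have "\<dots> = G x"
    unfolding G_def by (intro sw_counit linmap_sw m bilinI l\<beta> lm)
  finally have 1: "sw m (\<lambda>r c. sw m (\<lambda>a b. Q a b c) r) x = G x" .
  \<comment> \<open>Second evaluation: b and c collapse, the inner pair of legs before the outer
    one.\<close>
  have 2: "sw m (\<lambda>b c. R p q b c) s = m (counit s) (\<beta> p q)" for p q s
  proof -
    have "sw m (\<lambda>v c. T p q u v c) r = \<beta> (p * u * antipode r) q" for u r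
    proof -
      have "sw m (\<lambda>v c. T p q u v c) r = sw m (\<lambda>w z. sw m (\<lambda>v y. \<beta> (p * u * antipode z) (q * v * antipode y)) w) r"
        unfolding T_def
        by (rule sw_coassoc[OF m, symmetric]) (auto simp: trilin_def intro!: l\<beta> lm)
      also have "\<dots> = sw m (\<lambda>w z. m (counit w) (\<beta> (p * u * antipode z) q)) r"
      proof (rule sw_cong)
        show "sw m (\<lambda>v y. \<beta> (p * u * antipode z) (q * v * antipode y)) w = m (counit w) (\<beta> (p * u * antipode z) q)" for w z
          using sw_antipode_collapse(2)[OF linmap_comp[OF bilinD(1)[OF \<beta>] mult_linear(1)], of "p * u * antipode z" q w]
          by (simp add: mult.assoc)
      qed
      also have "\<dots> = \<beta> (p * u * antipode r) q"
        by (intro sw_counit l\<beta> lm)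
      finally show ?thesis .
    qed
    moreover have "sw m (\<lambda>b c. R p q b c) s = sw m (\<lambda>u r. sw m (\<lambda>v c. T p q u v c) r) s"
      unfolding R_def by (rule sw_coassoc[OF m]) (auto simp: trilin_def intro: lT)
    ultimately show ?thesis
      using sw_antipode_collapse(2)[OF linmap_comp[OF bilinD(2)[OF \<beta>] mult_linear(1)], of p q s]
      by (simp add: mult.assoc)
  qed
  have "sw m (\<lambda>a s. sw m (\<lambda>b c. Q a b c) s) x = sw m (\<lambda>a s. m (counit s) (sw m \<beta> (antipode a))) x"
  proof (rule sw_cong)
    show "sw m (\<lambda>b c. Q a b c) s = m (counit s) (sw m \<beta> (antipode a))" for a s
      unfolding Q_def sw_commute[OF m, of _ "antipode a"] 2 sw_fun_scale[OF m] ..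
  qed
  also have "\<dots> = sw m \<beta> (antipode x)"
    by (intro sw_counit linmap_comp[OF linmap_sw linmap_antipode] m \<beta>)
  finally show ?thesis
    using 1 sw_coassoc[OF m, of Q x] lQ by (simp add: trilin_def G_def)
qed

end

section \<open>The wedge filtration\<close>

definition perp :: "'a set \<Rightarrow> ('a \<Rightarrow> 'k::zero) \<Rightarrow> bool" where
  "perp U f \<longleftrightarrow> (\<forall>u\<in>U. f u = 0)"

lemma perpD: "perp U f \<Longrightarrow> u \<in> U \<Longrightarrow> f u = 0"
  and perpI: "(\<And>u. u \<in> U \<Longrightarrow> f u = 0) \<Longrightarrow> perp U f"
  and perp_mono: "perp U f \<Longrightarrow> V \<subseteq> U \<Longrightarrow> perp V f"
  by (auto simp: perp_def)

locale hopf_pair = hopf_algebra scale comult counit antipode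
  for scale :: "'k::field \<Rightarrow> 'h::ring_1 \<Rightarrow> 'h" and comult counit antipode +
  fixes K :: "'h set"
  assumes K: "hopf_subalgebra scale comult antipode K"
begin

abbreviation W :: "nat \<Rightarrow> 'h set" where "W \<equiv> wedge scale comult K"

lemma subspace_K: "subspace K" and one_K: "1 \<in> K"
  and mult_K: "x \<in> K \<Longrightarrow> y \<in> K \<Longrightarrow> x * y \<in> K" and antipode_K: "x \<in> K \<Longrightarrow> antipode x \<in> K"
  using K by (auto simp: hopf_subalgebra_def subcoalgebra_def)

lemma comult_K:
  assumes "x \<in> K"
  obtains t where "keq H2 (comult x) t" "\<And>w. w \<in> keys t \<Longrightarrow> \<exists>a\<in>K. \<exists>b\<in>K. w = [a, b]"
proof -
  have "comult x \<in> tsub (full_space scale) K K"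
    using K assms by (auto simp: hopf_subalgebra_def subcoalgebra_def)
  then obtain t where t: "t \<in> free.span {word [a, b] | a b. a \<in> K \<and> b \<in> K}" "keq H2 (comult x) t"
    by (auto simp: tsub_def)
  then have "\<forall>w\<in>keys t. \<exists>a\<in>K. \<exists>b\<in>K. w = [a, b]"
    unfolding free_span_words2 by blast
  then show ?thesis using that t(2) by blast
qed

text \<open>\<Delta>(x) has a representative in K \<otimes> K, so the forms only matter there; their
  bilinearity permits the change of representative.\<close>

lemma sw_K_cong:
  assumes "x \<in> K" "vector_space m" "bilin scale m \<beta>" "bilin scale m \<gamma>"
    and "\<And>a b. a \<in> K \<Longrightarrow> b \<in> K \<Longrightarrow> \<beta> a b = \<gamma> a b"
  shows "sw m \<beta> x = sw m \<gamma> x"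
proof -
  obtain t where t: "keq H2 (comult x) t" "\<And>w. w \<in> keys t \<Longrightarrow> \<exists>a\<in>K. \<exists>b\<in>K. w = [a, b]"
    using comult_K[OF assms(1)] by blast
  show ?thesis unfolding sw_keq[OF assms(2,3) t(1)] sw_keq[OF assms(2,4) t(1)]
    by (intro lin_ext_cong) (use t(2) assms(5) in fastforce)
qed

lemma sw_K_zero:
  assumes "x \<in> K" "vector_space m" "bilin scale m \<beta>" "\<And>a b. a \<in> K \<Longrightarrow> b \<in> K \<Longrightarrow> \<beta> a b = 0"
  shows "sw m \<beta> x = 0"
proof -
  have "sw m \<beta> x = sw m (\<lambda>a b. 0) x"
    by (rule sw_K_cong[OF assms(1-3)]) (auto intro!: bilinI linmap_fun_zero assms)
  then show ?thesis by (simp add: sw_def lin_ext_fun_zero[OF assms(2)])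
qed

text \<open>Because K is a subcoalgebra, its annihilator is a two-sided ideal of the dual
  algebra.\<close>

lemma perp_conv_K:
  assumes "functional f" "functional g" "perp K f \<or> perp K g"
  shows "perp K (conv f g)"
  unfolding conv_def
  by (intro perpI sw_K_zero vector_space_mult bilin_functionals assms)
    (use assms(3) in \<open>auto dest: perpD\<close>)

lemma comult_expand:
  assumes B: "independent B" "span B = UNIV"
  shows "keq H2 (comult x) (\<Sum>b\<in>legs B x. word [b, hit (coord B b) x])"
proof (rule tpow2_keqI[OF kspace_full[OF vector_space_axioms] comult_car])
  show "(\<Sum>b\<in>legs B x. word [b, hit (coord B b) x]) \<in> car H2"
    by (intro free.subspace_sum subspace_car_tpow) simp
  fix f g assume fg: "linmap (scl (full_space scale)) (*) f" "linmap (scl (full_space scale)) (*) g"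
  show "evf f g (comult x) = evf f g (\<Sum>b\<in>legs B x. word [b, hit (coord B b) x])"
    using sw_expand[OF vector_space_mult bilin_functionals B, of f g x] fg
    by (simp add: sw_def lin_ext_sum[OF vector_space_mult] lin_ext_word[OF vector_space_mult] del: One_nat_def)
qed

lemma tsub_kills:
  assumes t: "t \<in> tsub (full_space scale) U V" and fg: "functional f" "functional g"
    and "perp U f \<or> perp V g"
  shows "evf f g t = 0"
proof -
  obtain t' where t': "t' \<in> free.span {word [a, b] | a b. a \<in> U \<and> b \<in> V}" "keq H2 t t'"
    using t by (auto simp: tsub_def)
  then have w: "\<forall>w\<in>keys t'. \<exists>a\<in>U. \<exists>b\<in>V. w = [a, b]"
    unfolding free_span_words2 by blast
  have "evf f g t = evf f g t'"
    by (rule ev2_keq[OF vector_space_mult bilin_imp_bilin_on[OF bilin_functionals[OF fg]] t'(2)])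
  also have "\<dots> = lin_ext (*) (\<lambda>w. 0) t'"
    by (intro lin_ext_cong) (use w assms(4) in \<open>fastforce dest: perpD\<close>)
  finally show ?thesis by (simp add: lin_ext_fun_zero vector_space_mult)
qed

text \<open>Functionals f vanishing on K detect, through f(x_1)x_2, the part of \<Delta>(x) outside
  K \<otimes> H. The premise is the induction hypothesis of \<open>subspace_W\<close>, which is
  itself proved with this criterion.\<close>

lemma wedge_step_aux:
  assumes sub: "subspace (W (Suc n))"
  shows "x \<in> W (Suc (Suc n)) \<longleftrightarrow> (\<forall>f. functional f \<and> perp K f \<longrightarrow> hit f x \<in> W (Suc n))"
proof
  assume "x \<in> W (Suc (Suc n))"
  then obtain t u where tu: "t \<in> tsub (full_space scale) K UNIV"
     "u \<in> tsub (full_space scale) UNIV (W (Suc n))" "keq H2 (comult x) (t + u)"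
    by auto
  show "\<forall>f. functional f \<and> perp K f \<longrightarrow> hit f x \<in> W (Suc n)"
  proof (intro allI impI in_subspace_test[OF sub])
    fix f g assume f: "functional f \<and> perp K f" and g: "functional g" "\<And>u. u \<in> W (Suc n) \<Longrightarrow> g u = 0"
    have "g (hit f x) = evf f g (t + u)"
      using f g tu(3) by (simp add: functional_hit conv_def sw_keq vector_space_mult bilin_functionals)
    also have "\<dots> = 0"
      unfolding lin_ext_add[OF vector_space_mult]
      using f g tsub_kills[OF tu(1), of f g] tsub_kills[OF tu(2), of f g] by (auto simp: perp_def)
    finally show "g (hit f x) = 0" .
  qed
next
  assume R: "\<forall>f. functional f \<and> perp K f \<longrightarrow> hit f x \<in> W (Suc n)"
  \<comment> \<open>Basis vectors in K give the part in K \<otimes> H. The coordinates of the others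
    vanish on K, so their right legs lie in \<open>W (Suc n)\<close> by assumption.\<close>
  obtain B where B: "independent B" "span B = UNIV" "span (B \<inter> K) = K"
    using adapted_basis[of "\<lambda>_. K"] subspace_K by auto
  let ?w = "\<lambda>b. word [b, hit (coord B b) x] :: 'h list \<Rightarrow>\<^sub>0 'k"
  let ?t = "\<Sum>b\<in>legs B x \<inter> K. ?w b" and ?u = "\<Sum>b\<in>legs B x - K. ?w b"
  have refl: "keq H2 z z" for z :: "'h list \<Rightarrow>\<^sub>0 'k"
    using free.subspace_0[OF subspace_nul_tpow] by (simp add: keq_def)
  have car: "?t \<in> car H2" "?u \<in> car H2"
    by (intro free.subspace_sum subspace_car_tpow, simp)+
  have "?t \<in> free.span {word [a, b] | a b. a \<in> K \<and> b \<in> UNIV}"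
    by (intro free.span_sum free.span_base) auto
  then have "?t \<in> tsub (full_space scale) K UNIV"
    using car refl unfolding tsub_def by blast
  moreover have "hit (coord B b) x \<in> W (Suc n)" if "b \<in> legs B x - K" for b
    using R that linmap_representation[OF B(1,2)] representation_adapted_zero[OF B(1,3)]
    by (auto simp: perp_def)
  then have "?u \<in> free.span {word [a, b] | a b. a \<in> UNIV \<and> b \<in> W (Suc n)}"
    by (intro free.span_sum free.span_base) auto
  then have "?u \<in> tsub (full_space scale) UNIV (W (Suc n))"
    using car refl unfolding tsub_def by blast
  moreover have "?t + ?u = (\<Sum>b\<in>legs B x. ?w b)"
    by (subst sum.Int_Diff[OF finite_legs, of _ _ _ K]) simp
  then have "keq H2 (comult x) (?t + ?u)" using comult_expand[OF B(1,2), of x] by simp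
  ultimately show "x \<in> W (Suc (Suc n))" by auto
qed

lemma subspace_W: "subspace (W n)"
proof (induction n rule: induct_nat_012)
  case (ge2 n)
  note 3 = ge2(2)
  show ?case
  proof (rule subspaceI)
    show "0 \<in> W (Suc (Suc n))"
      unfolding wedge_step_aux[OF 3] using 3 by (auto simp: linmap_0[OF linmap_hit] subspace_0)
    show "x + y \<in> W (Suc (Suc n))" if "x \<in> W (Suc (Suc n))" "y \<in> W (Suc (Suc n))" for x y
      using that unfolding wedge_step_aux[OF 3] using 3 by (auto simp: linmap_add[OF linmap_hit] subspace_add)
    show "scale c x \<in> W (Suc (Suc n))" if "x \<in> W (Suc (Suc n))" for c x
      using that unfolding wedge_step_aux[OF 3] using 3 by (auto simp: linmap_scale[OF linmap_hit] subspace_scale)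
  qed
qed (auto simp: subspace_K)

lemmas wedge_step = wedge_step_aux[OF subspace_W]

text \<open>With I the annihilator of K in the dual algebra, \<open>idl n\<close> consists of the
  products of n elements of I and a functional. They span the power I^n, and annihilation by I^n can
  be read off from them.\<close>

primrec idl :: "nat \<Rightarrow> ('h \<Rightarrow> 'k) set" where
  "idl 0 = {f. functional f}"
| "idl (Suc n) = {conv f g | f g. functional f \<and> perp K f \<and> g \<in> idl n}"

lemma idl_functional: "f \<in> idl n \<Longrightarrow> functional f"
  by (induction n arbitrary: f) (auto intro: linmap_conv)

lemma idl_conv_left: "functional f \<Longrightarrow> g \<in> idl n \<Longrightarrow> conv f g \<in> idl n"
proof (induction n)
  case (Suc n)
  then obtain a h where g: "g = conv a h" "functional a" "perp K a" "h \<in> idl n" by auto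
  then have "conv f g = conv (conv f a) h"
    unfolding g(1) using conv_assoc[OF Suc.prems(1) g(2) idl_functional[OF g(4)]] by (intro ext) simp
  moreover have "functional (conv f a)" "perp K (conv f a)"
    using g Suc.prems perp_conv_K linmap_conv by auto
  ultimately show ?case using g(4) unfolding idl.simps by blast
qed (auto intro: linmap_conv)

lemma idl_mult: "f \<in> idl i \<Longrightarrow> g \<in> idl j \<Longrightarrow> conv f g \<in> idl (i + j)"
proof (induction i arbitrary: f)
  case 0
  then show ?case using idl_conv_left by simp
next
  case (Suc i)
  then obtain a h where f: "f = conv a h" "functional a" "perp K a" "h \<in> idl i" by auto
  then have "conv f g = conv a (conv h g)"
    unfolding f(1) using conv_assoc[OF f(2) idl_functional[OF f(4)] idl_functional[OF Suc.prems(2)]] by (intro ext) simp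
  then show ?case using f Suc by auto
qed

text \<open>The wedge powers of K are the annihilators of the powers of I. This turns inclusions
  between filtration steps into inclusions between products of ideals.\<close>

lemma W_iff: "x \<in> W n \<longleftrightarrow> (\<forall>f\<in>idl n. f x = 0)"
proof (induction n arbitrary: x)
  case 0
  show ?case using eq_test[of x 0] by (auto simp: linmap_0)
next
  case (Suc n)
  show ?case
  proof (cases n)
    case 0
    \<comment> \<open>The step from 0 to 1 is separate because \<open>W 1\<close> is K by definition
      and not by a wedge condition; \<open>counit\<close> as second factor recovers f
      itself.\<close>
    have "x \<in> K \<longleftrightarrow> (\<forall>f g. functional f \<and> perp K f \<and> functional g \<longrightarrow> conv f g x = 0)"
    proof
      show "\<forall>f g. functional f \<and> perp K f \<and> functional g \<longrightarrow> conv f g x = 0" if "x \<in> K"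
        using that perp_conv_K by (auto simp: perp_def)
      show "x \<in> K" if "\<forall>f g. functional f \<and> perp K f \<and> functional g \<longrightarrow> conv f g x = 0"
      proof (rule in_subspace_test[OF subspace_K])
        show "f x = 0" if "functional f" "\<And>u. u \<in> K \<Longrightarrow> f u = 0" for f
          using \<open>\<forall>f g. _\<close>[rule_format, of f counit] that linmap_counit conv_counit(2) by (auto simp: perp_def)
      qed
    qed
    then show ?thesis using 0 by auto
  next
    case (Suc k)
    have "x \<in> W (Suc n) \<longleftrightarrow> (\<forall>f. functional f \<and> perp K f \<longrightarrow> (\<forall>g\<in>idl n. g (hit f x) = 0))"
      unfolding Suc wedge_step using Suc.IH Suc by simp
    also have "\<dots> \<longleftrightarrow> (\<forall>f\<in>idl (Suc n). f x = 0)"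
      by (auto simp: functional_hit[OF idl_functional])
    finally show ?thesis .
  qed
qed

lemma W_0 [simp]: "W 0 = {0}" and W_1 [simp]: "W (Suc 0) = K"
  by simp_all

declare wedge.simps [simp del]

lemma W_Suc: "W n \<subseteq> W (Suc n)"
  using idl_conv_left by (auto simp: W_iff)

lemma W_mono: "i \<le> j \<Longrightarrow> W i \<subseteq> W j"
  by (rule lift_Suc_mono_le[of W, OF W_Suc])

text \<open>This expresses \<Delta>(W n) \<subseteq> W p \<otimes> H + H \<otimes> W (n - p) and
  follows from I^p I^(n-p) \<subseteq> I^n. Subtraction is truncated: for p \<ge> n the result says
  that \<open>hit f x\<close> is 0.\<close>

lemma hit_W:
  assumes x: "x \<in> W n" and f: "functional f" "perp (W p) f"
  shows "hit f x \<in> W (n - p)"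
  unfolding W_iff[of _ "n - p"]
proof
  fix g assume g: "g \<in> idl (n - p)"
  have "tih g x \<in> W p"
    unfolding W_iff[of _ p]
  proof
    fix h assume h: "h \<in> idl p"
    have "conv h g \<in> idl (p + (n - p))" by (rule idl_mult[OF h g])
    moreover have "x \<in> W (p + (n - p))" using W_mono[of n "p + (n - p)"] x by (auto simp: subset_iff)
    ultimately show "h (tih g x) = 0"
      using W_iff by (auto simp: functional_tih[OF idl_functional[OF h]])
  qed
  then show "g (hit f x) = 0"
    using f by (auto simp: functional_hit[OF idl_functional[OF g]] functional_tih[OF f(1), symmetric] perp_def)
qed

lemma tih_W:
  assumes x: "x \<in> W n" and f: "functional f" "perp (W p) f"
  shows "tih f x \<in> W (n - p)"
  unfolding W_iff[of _ "n - p"]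
proof
  fix g assume g: "g \<in> idl (n - p)"
  have "hit g x \<in> W p"
    unfolding W_iff[of _ p]
  proof
    fix h assume h: "h \<in> idl p"
    have "conv g h \<in> idl ((n - p) + p)" by (rule idl_mult[OF g h])
    moreover have "x \<in> W ((n - p) + p)" using W_mono[of n "(n - p) + p"] x by (auto simp: subset_iff)
    ultimately show "h (hit g x) = 0"
      using W_iff by (auto simp: functional_hit[OF idl_functional[OF h]])
  qed
  then show "g (tih f x) = 0"
    using f by (auto simp: functional_tih[OF idl_functional[OF g]] functional_hit[OF f(1), symmetric] perp_def)
qed

lemma perp_W0: "functional f \<Longrightarrow> perp (W 0) f"
  by (simp add: perp_def linmap_0)

text \<open>\<open>W m\<close> is the filtration step m - 1, which explains the index m + n - 1. In
  f(x_1 y_1) x_2 y_2 with f vanishing on K, left legs that both lie in K are killed by f; otherwise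
  one of the right legs has dropped by a step and induction applies.\<close>

lemma W_mult: "x \<in> W m \<Longrightarrow> y \<in> W n \<Longrightarrow> x * y \<in> W (m + n - 1)"
proof (induction "m + n" arbitrary: m n x y rule: less_induct)
  case less
  consider "m = 0 \<or> n = 0" | "m = 1" "n = 1" | "m \<ge> 1" "n \<ge> 1" "m + n \<ge> 3" by linarith
  then show ?case
  proof cases
    case 1
    then show ?thesis using less.prems subspace_W subspace_0 by auto
  next
    case 2
    then show ?thesis using less.prems mult_K by simp
  next
    case 3
    obtain B where B: "independent B" "span B = UNIV" "span (B \<inter> K) = K"
      using adapted_basis[of "\<lambda>_. K"] subspace_K by auto
    note lc = linmap_representation[OF B(1,2)]
    have bK: "perp (W 1) (coord B b)" if "b \<notin> K" for b
      using that representation_adapted_zero[OF B(1,3)] by (auto simp: perp_def)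
    \<comment> \<open>For m + n \<ge> 3 the target index is at least 2, which is where
      \<open>wedge_step\<close> applies.\<close>
    define k where "k = m + n - 3"
    have k: "m + n - 1 = Suc (Suc k)" "m - 1 + n - 1 = Suc k" "m + (n - 1) - 1 = Suc k"
      using 3 by (auto simp: k_def)
    show ?thesis unfolding k wedge_step
    proof (intro allI impI)
      fix f assume f: "functional f \<and> perp K f"
      show "hit f (x * y) \<in> W (Suc k)"
        unfolding hit_mult[OF B(1,2) conjunct1[OF f]]
      proof (intro subspace_sum subspace_W)
        fix b c
        have x: "hit (coord B b) x \<in> W m" and y: "hit (coord B c) y \<in> W n"
          using hit_W[OF less.prems(1) lc perp_W0[OF lc]] hit_W[OF less.prems(2) lc perp_W0[OF lc]] by auto
        consider "b \<in> K" "c \<in> K" | "b \<notin> K" | "c \<notin> K" by blast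
        then show "scale (f (b * c)) (hit (coord B b) x * hit (coord B c) y) \<in> W (Suc k)"
        proof cases
          case 1
          then show ?thesis using f mult_K subspace_0[OF subspace_W] by (simp add: perp_def)
        next
          case 2
          have "hit (coord B b) x \<in> W (m - 1)" by (rule hit_W[OF less.prems(1) lc bK[OF 2]])
          then have "hit (coord B b) x * hit (coord B c) y \<in> W (m - 1 + n - 1)"
            using 3 y by (intro less.hyps) auto
          then show ?thesis unfolding k by (rule subspace_scale[OF subspace_W])
        next
          case c: 3
          have "hit (coord B c) y \<in> W (n - 1)" by (rule hit_W[OF less.prems(2) lc bK[OF c]])
          then have "hit (coord B b) x * hit (coord B c) y \<in> W (m + (n - 1) - 1)"
            using 3 x by (intro less.hyps) auto
          then show ?thesis unfolding k by (rule subspace_scale[OF subspace_W])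
        qed
      qed
    qed
  qed
qed

lemma W_mult_Suc: "x \<in> W (Suc m) \<Longrightarrow> y \<in> W (Suc n) \<Longrightarrow> x * y \<in> W (Suc (m + n))"
  using W_mult[of x "Suc m" y "Suc n"] by simp

lemma W_mult_left: "x \<in> W (Suc m) \<Longrightarrow> y \<in> W n \<Longrightarrow> x * y \<in> W (m + n)"
  using W_mult[of x "Suc m" y n] by simp

lemma W_mult_right: "x \<in> W m \<Longrightarrow> y \<in> W (Suc n) \<Longrightarrow> x * y \<in> W (m + n)"
  using W_mult[of x m y "Suc n"] by simp

text \<open>A functional vanishing on \<open>W n\<close> sees only the part of \<Delta>(x) in gr_n
  \<otimes> gr_0, so the condition says x_1 \<otimes> \<pi>(x_2) = x \<otimes> 1 for the class of x
  in degree n. All representatives of such classes are included, hence \<open>W n\<close>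
  itself.\<close>

definition A :: "nat \<Rightarrow> 'h set" where
  "A n = {x \<in> W (Suc n). \<forall>f. functional f \<and> perp (W n) f \<longrightarrow> hit f x = scale (f x) 1}"

lemma A_W: "x \<in> A n \<Longrightarrow> x \<in> W (Suc n)"
  by (simp add: A_def)

lemma A_hit_scalar: "x \<in> A n \<Longrightarrow> functional f \<Longrightarrow> perp (W n) f \<Longrightarrow> hit f x = scale (f x) 1"
  by (simp add: A_def)

text \<open>Applying the counit to f(x_1)x_2 gives f(x), so no other scalar can occur.
  \<open>A_I\<close> therefore asks only for some scalar.\<close>

lemma hit_scalar_eq:
  assumes "functional f" "hit f x = scale c 1"
  shows "hit f x = scale (f x) 1"
proof -
  have "f x = counit (hit f x)"
    using functional_hit[OF linmap_counit, of f x] conv_counit(2)[OF assms(1), of x] by simp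
  also have "\<dots> = c" unfolding assms(2) linmap_scale[OF linmap_counit] by (simp add: counit_one)
  finally show ?thesis using assms by simp
qed

lemma A_I:
  assumes "x \<in> W (Suc n)" "\<And>f. functional f \<Longrightarrow> perp (W n) f \<Longrightarrow> \<exists>c. hit f x = scale c 1"
  shows "x \<in> A n"
  using assms hit_scalar_eq unfolding A_def by blast

lemma subspace_A: "subspace (A n)"
proof (rule subspaceI)
  show "0 \<in> A n"
    using linmap_0[OF linmap_hit] linmap_0 by (auto simp: A_def subspace_0[OF subspace_W])
  show "x + y \<in> A n" if "x \<in> A n" "y \<in> A n" for x y
    using that by (auto simp: A_def subspace_add[OF subspace_W] linmap_add[OF linmap_hit]
        scale_left_distrib[symmetric]) (metis linmap_add)
  show "scale c x \<in> A n" if "x \<in> A n" for c x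
    using that by (auto simp: A_def subspace_scale[OF subspace_W] linmap_scale[OF linmap_hit])
      (metis linmap_scale)
qed

lemma W_A: "W n \<subseteq> A n"
proof
  fix x assume x: "x \<in> W n"
  show "x \<in> A n"
  proof (rule A_I)
    show "x \<in> W (Suc n)" using x W_Suc by auto
    fix f assume "functional f" "perp (W n) f"
    then have "hit f x \<in> W (n - n)" by (intro hit_W x)
    then have "hit f x = scale 0 1" by simp
    then show "\<exists>c. hit f x = scale c 1" by blast
  qed
qed

lemma perp_conv_W:
  assumes f: "functional f" "perp (W p) f" and g: "functional g" "perp (W (n - p)) g"
  shows "perp (W n) (conv f g)"
proof (rule perpI)
  fix y assume "y \<in> W n"
  then have "hit f y \<in> W (n - p)" using f by (intro hit_W)
  then show "conv f g y = 0" using g by (simp add: functional_hit[symmetric] perp_def)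
qed

text \<open>Coassociativity makes the coinvariants a left coideal: right legs of \<Delta>(x) are
  coinvariant again. Here \<open>hit_hit\<close> merges two functionals into one that vanishes on
  \<open>W n\<close>.\<close>

lemma A_hit:
  assumes x: "x \<in> A n" and f: "functional f" "perp (W p) f"
  shows "hit f x \<in> A (n - p)"
proof (cases "p \<le> n")
  case True
  show ?thesis
  proof (rule A_I)
    show "hit f x \<in> W (Suc (n - p))"
      using hit_W[OF A_W[OF x] f] True by (simp add: Suc_diff_le)
    fix g assume g: "functional g" "perp (W (n - p)) g"
    show "\<exists>c. hit g (hit f x) = scale c 1"
      unfolding hit_hit[OF f(1) g(1)]
      using A_hit_scalar[OF x linmap_conv[OF f(1) g(1)] perp_conv_W[OF f g]] by blast
  qed
next
  case False
  then have "hit f x \<in> W 0" using hit_W[OF A_W[OF x] f] by simp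
  then show ?thesis using subspace_0[OF subspace_A] by simp
qed

text \<open>\<open>W 0\<close> is {0}, so the counit is an admissible functional.\<close>

lemma A_0: "x \<in> A 0 \<Longrightarrow> x = scale (counit x) 1"
  using A_hit_scalar[of x 0 counit] linmap_counit perp_W0 by (simp add: hit_counit)

lemma one_A: "1 \<in> A 0"
  by (rule A_I) (use one_K hit_one in auto)

definition adapted :: "'h set \<Rightarrow> bool" where
  "adapted B \<longleftrightarrow> independent B \<and> span B = UNIV \<and> (\<forall>n. span (B \<inter> W n) = W n) \<and> (\<forall>n. span (B \<inter> A n) = A n)"

text \<open>The two families interleave as A 0 \<subseteq> W 1 \<subseteq> A 1 \<subseteq> W 2
  \<subseteq> ..., hence form a single chain: even positions are the \<open>A\<close>, odd ones the
  \<open>W\<close>. Only \<open>W 0\<close> stands outside and is checked by hand.\<close>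

lemma ex_adapted: "\<exists>B. adapted B"
proof -
  define G where "G k = (if even k then A (k div 2) else W (Suc (k div 2)))" for k
  have "subspace (G k)" for k by (simp add: G_def subspace_A subspace_W)
  moreover have "G k \<subseteq> G (Suc k)" for k
    using A_W W_A by (auto simp: G_def elim!: evenE oddE)
  ultimately obtain B where B: "independent B" "span B = UNIV" "\<And>k. span (B \<inter> G k) = G k"
    using adapted_basis[of G] by blast
  have "span (B \<inter> A n) = A n" for n using B(3)[of "2 * n"] by (simp add: G_def)
  moreover have "span (B \<inter> W n) = W n" for n
  proof (cases n)
    case 0
    have "0 \<notin> B" using B(1) dependent_zero by blast
    then show ?thesis using 0 by simp
  next
    case (Suc k)
    then show ?thesis using B(3)[of "2 * k + 1"] by (simp add: G_def)
  qed
  ultimately show ?thesis using B unfolding adapted_def by blast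
qed

end

locale hopf_pair_basis = hopf_pair scale comult counit antipode K
  for scale :: "'k::field \<Rightarrow> 'h::ring_1 \<Rightarrow> 'h" and comult counit antipode K +
  fixes B :: "'h set"
  assumes B: "adapted B"
begin

lemma B_basis: "independent B" "span B = UNIV"
  using B by (auto simp: adapted_def)

abbreviation cf :: "'h \<Rightarrow> 'h \<Rightarrow> 'k" where "cf b \<equiv> coord B b"

lemma lc: "functional (cf b)"
  by (rule linmap_representation[OF B_basis])

lemma cf_perp_W: "b \<notin> W n \<Longrightarrow> perp (W n) (cf b)"
  using representation_adapted_zero[of B "W n"] B by (auto simp: adapted_def perp_def)

lemma cf_perp_A: "b \<notin> A n \<Longrightarrow> perp (A n) (cf b)"
  using representation_adapted_zero[of B "A n"] B by (auto simp: adapted_def perp_def)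

lemma hit_cf_zero: "x \<in> W n \<Longrightarrow> b \<notin> W n \<Longrightarrow> hit (cf b) x = 0"
  using hit_W[of x n "cf b" n] lc cf_perp_W by simp

text \<open>Sort the left legs b, c by degree. Unless b has degree exactly m and c degree exactly n,
  the product bc lies in \<open>W (m + n)\<close> or a right leg vanishes; in the remaining terms
  both right legs are scalars by coinvariance.\<close>

lemma A_mult:
  assumes x: "x \<in> A m" and y: "y \<in> A n"
  shows "x * y \<in> A (m + n)"
proof (rule A_I)
  show "x * y \<in> W (Suc (m + n))" using A_W[OF x] A_W[OF y] by (rule W_mult_Suc)
  fix f assume f: "functional f" "perp (W (m + n)) f"
  have "hit f (x * y) = (\<Sum>b\<in>legs B x. \<Sum>c\<in>legs B y. scale (f (b * c)) (hit (cf b) x * hit (cf c) y))"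
    by (rule hit_mult[OF B_basis f(1)])
  also have "\<dots> = (\<Sum>b\<in>legs B x. \<Sum>c\<in>legs B y. scale (f (b * c) * (cf b x * cf c y)) 1)"
  proof (intro sum.cong refl)
    fix b c
    have fW: "f z = 0" if "z \<in> W (m + n)" for z using that f by (simp add: perp_def)
    consider "b \<notin> W (Suc m)" | "c \<notin> W (Suc n)" | "b \<in> W m" "c \<in> W (Suc n)" | "c \<in> W n" "b \<in> W (Suc m)"
      | "b \<notin> W m" "c \<notin> W n" by blast
    then show "scale (f (b * c)) (hit (cf b) x * hit (cf c) y) = scale (f (b * c) * (cf b x * cf c y)) 1"
    proof cases
      case 1
      then show ?thesis using hit_cf_zero[OF A_W[OF x]] cf_perp_W[OF 1] A_W[OF x] by (simp add: perp_def)
    next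
      case 2
      then show ?thesis using hit_cf_zero[OF A_W[OF y]] cf_perp_W[OF 2] A_W[OF y] by (simp add: perp_def)
    next
      case 3
      then show ?thesis using fW[OF W_mult_right] by simp
    next
      case 4
      then show ?thesis using fW[OF W_mult_left] by simp
    next
      case 5
      then show ?thesis
        using A_hit_scalar[OF x lc cf_perp_W] A_hit_scalar[OF y lc cf_perp_W]
        by (simp add: scale_mult_left scale_mult_right mult_ac)
    qed
  qed
  also have "\<dots> = scale (\<Sum>b\<in>legs B x. \<Sum>c\<in>legs B y. f (b * c) * (cf b x * cf c y)) 1"
    by (simp add: scale_sum_left)
  finally show "\<exists>c. hit f (x * y) = scale c 1" by blast
qed

end

section \<open>Commutativity and derivations\<close>

context hopf_pair_basis
begin

definition central :: bool where
  "central \<longleftrightarrow> (\<forall>n. \<forall>x\<in>W (Suc n). \<forall>k\<in>K. k * x - x * k \<in> W n)"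

text \<open>As x has degree at most n and g sees degree n only, f meets just the leg of degree zero.
  The condition is therefore \<pi>(x_1) \<otimes> x_2 = \<pi>(x_2) \<otimes> x_1 on classes of
  degree n.\<close>

definition cocentral :: bool where
  "cocentral \<longleftrightarrow> (\<forall>n. \<forall>x\<in>W (Suc n). \<forall>f g. functional f \<and> functional g \<and> perp (W n) g \<longrightarrow> conv f g x = conv g f x)"

text \<open>Cocentrality moves the leg of degree zero from left to right, where coinvariance makes
  it 1. So the left coaction of K on the coinvariants is trivial.\<close>

lemma cocentral_hit:
  assumes cocentral "x \<in> A n" "functional f"
  shows "hit f x - scale (f 1) x \<in> W n"
proof (rule in_subspace_test[OF subspace_W])
  fix g assume g: "functional g" "\<And>u. u \<in> W n \<Longrightarrow> g u = 0"
  then have "conv f g x = conv g f x"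
    using assms(1,3) A_W[OF assms(2)] unfolding cocentral_def perp_def by blast
  then have "g (hit f x) = f (hit g x)"
    by (simp add: functional_hit g assms(3))
  also have "\<dots> = g x * f 1"
    using A_hit_scalar[OF assms(2) g(1)] g(2) by (simp add: perp_def linmap_scale[OF assms(3)])
  finally show "g (hit f x - scale (f 1) x) = 0"
    by (simp add: linmap_diff[OF g(1)] linmap_scale[OF g(1)])
qed

text \<open>The form in which the hypotheses are used for commutators: a leg b in K commutes with
  the graded algebra, or it does not occur in \<Delta> of a coinvariant to leading order. In the
  cocentral case b in \<open>A 0\<close> is a scalar, and the coordinate of a b outside
  \<open>A 0\<close> vanishes on 1; this is why the basis is adapted to \<open>A 0\<close>
  too.\<close>

lemma degree_zero_legs:
  assumes "central \<or> cocentral" "b \<in> K"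
  obtains "\<And>n z. z \<in> W (Suc n) \<Longrightarrow> b * z - z * b \<in> W n" | "\<And>n x. x \<in> A n \<Longrightarrow> hit (cf b) x \<in> W n"
proof -
  consider central | cocentral "b \<in> A 0" | cocentral "b \<notin> A 0" using assms by blast
  then show ?thesis
  proof cases
    case 1
    then show ?thesis using that(1) assms(2) by (auto simp: central_def)
  next
    case 2
    have "b * z - z * b = 0" for z
      by (subst (1 2) A_0[OF 2(2)]) (simp add: scale_mult_left scale_mult_right)
    then show ?thesis using that(1) subspace_0[OF subspace_W] by simp
  next
    case 3
    have "cf b 1 = 0" using cf_perp_A[OF 3(2)] one_A by (simp add: perp_def)
    then show ?thesis using that(2) cocentral_hit[OF 3(1) _ lc[of b]] by simp
  qed
qed

lemma A_commute:
  assumes cc: "central \<or> cocentral"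
  shows "x \<in> A m \<Longrightarrow> y \<in> A n \<Longrightarrow> x * y - y * x \<in> W (m + n)"
proof (induction "m + n" arbitrary: m n x y rule: less_induct)
  case less
  note x = less.prems(1) and y = less.prems(2)
  consider "m = 0" | "n = 0" | "m \<ge> 1" "n \<ge> 1" by linarith
  then show ?case
  proof cases
    case 1
    then have "x * y - y * x = 0"
      using A_0[of x] x by (metis cancel_comm_monoid_add_class.diff_cancel mult_1 mult_1_right scale_mult_left scale_mult_right)
    then show ?thesis using subspace_0[OF subspace_W] by simp
  next
    case 2
    then have "x * y - y * x = 0"
      using A_0[of y] y by (metis cancel_comm_monoid_add_class.diff_cancel mult_1 mult_1_right scale_mult_left scale_mult_right)
    then show ?thesis using subspace_0[OF subspace_W] by simp
  next
    case 3
    define N where "N = m + n - 2"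
    have N: "m + n = Suc (Suc N)" using 3 by (simp add: N_def)
    \<comment> \<open>Terms with exactly one left leg in K. The factors are arbitrary because the
      claim is used a second time with the roles of x and y exchanged.\<close>
    have mixed: "scale (f (b * c)) (hit (cf b) x' * hit (cf c) y') - scale (f (c * b)) (hit (cf c) y' * hit (cf b) x') \<in> W (Suc N)"
      if f: "functional f" "perp K f" and b: "b \<notin> K" and c: "c \<in> K"
        and x: "x' \<in> A m'" and y: "y' \<in> A n'" and mn: "m' + n' = Suc (Suc N)" "m' \<ge> 1" "n' \<ge> 1" for f b c x' y' m' n'
    proof -
      have bp: "perp (W 1) (cf b)" using cf_perp_W[of b 1] b by simp
      have xb: "hit (cf b) x' \<in> A (m' - 1)" by (rule A_hit[OF x lc bp])
      have yc: "hit (cf c) y' \<in> A n'" using A_hit[OF y lc perp_W0[OF lc], of c] by simp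
      note sub = subspace_diff[OF subspace_W] subspace_scale[OF subspace_W]
      have k: "Suc (m' - 1) + n' - 1 = Suc N" "m' - 1 + Suc n' - 1 = Suc N" "n' + Suc (m' - 1) - 1 = Suc N" "Suc n' + (m' - 1) - 1 = Suc N"
        "m' - 1 + n' = Suc N" using mn by auto
      show ?thesis using cc c
      proof (cases rule: degree_zero_legs)
        case 1
        show ?thesis
        \<comment> \<open>If b has degree one, the commutator of b and c lies in K, where f
          vanishes; so both terms have the same coefficient, and the right legs commute up to
          \<open>W (Suc N)\<close> by induction. If b has higher degree, its right leg has dropped
          by two steps.\<close>
        proof (cases "b \<in> W (Suc 1)")
          case True
          have "c * b - b * c \<in> W 1" by (rule 1[OF True])
          then have "f (c * b) = f (b * c)"
            using perpD[OF f(2), of "c * b - b * c"] linmap_diff[OF f(1), of "c * b" "b * c"] by simp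
          moreover have "hit (cf b) x' * hit (cf c) y' - hit (cf c) y' * hit (cf b) x' \<in> W (m' - 1 + n')"
            using mn N by (intro less.hyps xb yc) auto
          ultimately show ?thesis using sub(2) k by (simp add: scale_right_diff_distrib[symmetric])
        next
          case False
          then have "hit (cf b) x' \<in> W (Suc m' - 2)"
            using hit_W[OF A_W[OF x] lc, of 2] cf_perp_W by (simp add: numeral_2_eq_2)
          then have "hit (cf b) x' \<in> W (m' - 1)" by simp
          then show ?thesis
            using W_mult[OF _ A_W[OF yc], of _ "m' - 1"] W_mult[OF A_W[OF yc], of _ "m' - 1"]
            unfolding k by (intro sub)
        qed
      next
        case 2
        have "hit (cf c) y' \<in> W n'" by (rule 2[OF y])
        then show ?thesis
          using W_mult[OF A_W[OF xb], of _ n'] W_mult[OF _ A_W[OF xb], of _ n']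
          unfolding k by (intro sub)
      qed
    qed
    show ?thesis unfolding N wedge_step
    proof (intro allI impI)
      fix f assume f: "functional f \<and> perp K f"
      have "hit f (x * y - y * x) = (\<Sum>b\<in>legs B x. \<Sum>c\<in>legs B y.
          scale (f (b * c)) (hit (cf b) x * hit (cf c) y) - scale (f (c * b)) (hit (cf c) y * hit (cf b) x))"
        using f by (simp add: linmap_diff[OF linmap_hit] hit_mult[OF B_basis] sum_subtractf
            sum.swap[of _ "legs B y" "legs B x"])
      also have "\<dots> \<in> W (Suc N)"
      proof (intro subspace_sum subspace_W)
        fix b c
        have p: "perp (W 1) (cf b)" if "b \<notin> K" for b using cf_perp_W[of b 1] that by simp
        consider "b \<in> K" "c \<in> K" | "b \<notin> K" "c \<notin> K" | "b \<notin> K" "c \<in> K" | "b \<in> K" "c \<notin> K" by blast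
        then show "scale (f (b * c)) (hit (cf b) x * hit (cf c) y) - scale (f (c * b)) (hit (cf c) y * hit (cf b) x) \<in> W (Suc N)"
        proof cases
          case 1
          then show ?thesis using f mult_K subspace_0[OF subspace_W] by (simp add: perp_def)
        next
          case 2
          \<comment> \<open>Both right legs have dropped by a step, so each product lies in
            \<open>W (Suc N)\<close> by itself.\<close>
          have "hit (cf b) x \<in> W m" "hit (cf c) y \<in> W n"
            using hit_W[OF A_W[OF x] lc p] hit_W[OF A_W[OF y] lc p] 2 by auto
          then show ?thesis
            using W_mult[of _ m _ n] W_mult[of _ n _ m] N
            by (intro subspace_diff subspace_scale subspace_W) (auto simp: add.commute)
        next
          case bc: 3
          show ?thesis using f by (intro mixed[OF _ _ bc x y N 3]) auto
        next
          case bc: 4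
          have "scale (f (c * b)) (hit (cf c) y * hit (cf b) x) - scale (f (b * c)) (hit (cf b) x * hit (cf c) y) \<in> W (Suc N)"
            using f by (intro mixed[OF _ _ bc(2,1) y x _ 3(2,1)]) (auto simp: N add.commute)
          then show ?thesis using subspace_neg[OF subspace_W] by fastforce
        qed
      qed
      finally show "hit f (x * y - y * x) \<in> W (Suc N)" .
    qed
  qed
qed

text \<open>The Leibniz rule for classes of degree m + n - d: \<open>W (m + n - d)\<close> is the
  step just below that degree. For m + n \<le> d this step is {0} and the rule holds
  exactly.\<close>

definition is_derivation :: "nat \<Rightarrow> ('h \<Rightarrow> 'k) \<Rightarrow> bool" where
  "is_derivation d \<psi> \<longleftrightarrow> (\<forall>m n. \<forall>x\<in>A m. \<forall>y\<in>A n. hit \<psi> (x * y) - (hit \<psi> x * y + x * hit \<psi> y) \<in> W (m + n - d))"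

lemma zero_notin_B: "0 \<notin> B"
  using B_basis(1) dependent_zero by blast

lemma degree_exists:
  assumes "b \<in> B" "b \<in> W (Suc m)"
  obtains p where "p \<le> m" "b \<in> W (Suc p)" "b \<notin> W p"
proof -
  define p where "p = (LEAST p. b \<in> W (Suc p))"
  have "b \<in> W (Suc p)" unfolding p_def using assms(2) by (rule LeastI)
  moreover have "b \<notin> W p"
  proof (cases p)
    case 0
    then show ?thesis using zero_notin_B assms by auto
  next
    case (Suc q)
    then show ?thesis using not_less_Least[of q "\<lambda>p. b \<in> W (Suc p)"] by (auto simp: p_def)
  qed
  moreover have "p \<le> m" unfolding p_def using assms(2) by (rule Least_le)
  ultimately show ?thesis using that by blast
qed

text \<open>Common frame of both cases. \<open>rel p b\<close> marks the left legs of degree p that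
  can occur in \<Delta> of a coinvariant to leading order: coinvariant legs in the cocentral case,
  all legs in the central one. \<open>R1\<close> discards the other legs; \<open>R2\<close> and
  \<open>R3\<close> give \<open>\<psi>\<close> on products of two marked legs, either both of
  positive degree or one of degree zero.\<close>

lemma derivation_criterion:
  assumes \<psi>: "functional \<psi>" "perp (W d) \<psi>" and d: "d \<ge> 1"
    and R1: "\<And>p b n x. b \<in> W (Suc p) \<Longrightarrow> \<not> rel p b \<Longrightarrow> x \<in> A n \<Longrightarrow> p \<le> n \<Longrightarrow> hit (cf b) x \<in> W (n - p)"
    and R2: "\<And>p q b c. rel p b \<Longrightarrow> rel q c \<Longrightarrow> b \<in> W (Suc p) \<Longrightarrow> c \<in> W (Suc q) \<Longrightarrow> p \<ge> 1 \<Longrightarrow> q \<ge> 1 \<Longrightarrow>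
       p + q = d \<Longrightarrow> \<psi> (b * c) = 0"
    and R3: "\<And>b k. rel d b \<Longrightarrow> rel 0 k \<Longrightarrow> b \<in> W (Suc d) \<Longrightarrow> k \<in> K \<Longrightarrow> \<psi> (b * k) = counit k * \<psi> b \<and> \<psi> (k * b) = counit k * \<psi> b"
  shows "is_derivation d \<psi>"
  unfolding is_derivation_def
proof (intro allI ballI)
  fix m n x y assume x: "x \<in> A m" and y: "y \<in> A n"
  let ?x = "\<lambda>b. hit (cf b) x" and ?y = "\<lambda>c. hit (cf c) y"
  \<comment> \<open>Writing x and y through the counit puts all three terms of the Leibniz rule over
    the same pairs of legs, so that only scalar coefficients have to be compared.\<close>
  have xe: "x = (\<Sum>b\<in>legs B x. scale (counit b) (?x b))" and ye: "y = (\<Sum>c\<in>legs B y. scale (counit c) (?y c))"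
    using hit_expand[OF B_basis linmap_counit, of x] hit_expand[OF B_basis linmap_counit, of y] by (simp_all add: hit_counit)
  have "hit \<psi> x * y = (\<Sum>b\<in>legs B x. scale (\<psi> b) (?x b)) * (\<Sum>c\<in>legs B y. scale (counit c) (?y c))"
    using hit_expand[OF B_basis \<psi>(1), of x] ye by simp
  moreover have "x * hit \<psi> y = (\<Sum>b\<in>legs B x. scale (counit b) (?x b)) * (\<Sum>c\<in>legs B y. scale (\<psi> c) (?y c))"
    using hit_expand[OF B_basis \<psi>(1), of y] xe by simp
  ultimately have "hit \<psi> (x * y) - (hit \<psi> x * y + x * hit \<psi> y) = (\<Sum>b\<in>legs B x. \<Sum>c\<in>legs B y.
      scale (\<psi> (b * c) - (\<psi> b * counit c + counit b * \<psi> c)) (?x b * ?y c))"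
    unfolding hit_mult[OF B_basis \<psi>(1)]
    by (simp add: sum_product scale_mult_left scale_mult_right scale_left_diff_distrib scale_left_distrib
        sum_subtractf sum.distrib mult.commute)
  also have "\<dots> \<in> W (m + n - d)"
  proof (intro subspace_sum subspace_W)
    fix b c assume "b \<in> legs B x" "c \<in> legs B y"
    then have bc: "b \<in> B" "c \<in> B" using legs_subset by auto
    have \<psi>0: "\<psi> z = 0" if "z \<in> W d" for z using that \<psi> by (simp add: perp_def)
    note zero = subspace_0[OF subspace_W]
    show "scale (\<psi> (b * c) - (\<psi> b * counit c + counit b * \<psi> c)) (?x b * ?y c) \<in> W (m + n - d)"
    proof (cases "b \<in> W (Suc m) \<and> c \<in> W (Suc n)")
      case False
      then have "?x b * ?y c = 0" using hit_cf_zero[OF A_W[OF x]] hit_cf_zero[OF A_W[OF y]] by auto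
      then show ?thesis using zero by simp
    next
      case True
      obtain p where p: "p \<le> m" "b \<in> W (Suc p)" "b \<notin> W p" using degree_exists[OF bc(1)] True by blast
      obtain q where q: "q \<le> n" "c \<in> W (Suc q)" "c \<notin> W q" using degree_exists[OF bc(2)] True by blast
      have xb: "?x b \<in> W (Suc (m - p))" and yc: "?y c \<in> W (Suc (n - q))"
        using hit_W[OF A_W[OF x] lc cf_perp_W[OF p(3)]] hit_W[OF A_W[OF y] lc cf_perp_W[OF q(3)]] p(1) q(1)
        by (simp_all add: Suc_diff_le)
      have bcW: "b * c \<in> W (Suc (p + q))" using p q by (intro W_mult_Suc)
      have Wd: "z \<in> W d" if "z \<in> W (Suc r)" "r < d" for z r
        using that W_mono[of "Suc r" d] by auto
      \<comment> \<open>For p + q > d the right legs are too low, for p + q < d the coefficient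
        vanishes; the rule is decided by the pairs with p + q = d.\<close>
      consider "p + q > d" | "p + q < d" | "p + q = d" "\<not> rel p b" | "p + q = d" "\<not> rel q c"
        | "p + q = d" "rel p b" "rel q c" by linarith
      then show ?thesis
      proof cases
        case 1
        have "?x b * ?y c \<in> W (Suc (m - p + (n - q)))" using xb yc by (rule W_mult_Suc)
        moreover have "Suc (m - p + (n - q)) \<le> m + n - d" using 1 p q by linarith
        ultimately show ?thesis using W_mono by (blast intro: subspace_scale[OF subspace_W])
      next
        case 2
        then have "\<psi> (b * c) = 0" "\<psi> b = 0" "\<psi> c = 0"
          using \<psi>0 Wd[OF bcW] Wd[OF p(2)] Wd[OF q(2)] by auto
        then show ?thesis using zero by simp
      next
        case 3
        have "?x b \<in> W (m - p)" by (rule R1[OF p(2) 3(2) x p(1)])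
        then have "?x b * ?y c \<in> W (m - p + (n - q))" using yc by (rule W_mult_right)
        moreover have "m - p + (n - q) = m + n - d" using 3 p q by linarith
        ultimately show ?thesis by (auto intro: subspace_scale[OF subspace_W])
      next
        case 4
        have "?y c \<in> W (n - q)" by (rule R1[OF q(2) 4(2) y q(1)])
        with xb have "?x b * ?y c \<in> W (m - p + (n - q))" by (rule W_mult_left)
        moreover have "m - p + (n - q) = m + n - d" using 4 p q by linarith
        ultimately show ?thesis by (auto intro: subspace_scale[OF subspace_W])
      next
        case 5
        consider "p \<ge> 1" "q \<ge> 1" | "p = 0" "q = d" | "q = 0" "p = d" using 5 by linarith
        then have "\<psi> (b * c) - (\<psi> b * counit c + counit b * \<psi> c) = 0"
        proof cases
          case 1
          then have "\<psi> b = 0" "\<psi> c = 0" using \<psi>0 Wd[OF p(2)] Wd[OF q(2)] 5 by auto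
          then show ?thesis using R2[OF 5(2,3) p(2) q(2) 1 5(1)] by simp
        next
          case 2
          then have "\<psi> b = 0" using \<psi>0 Wd[OF p(2)] d by auto
          then show ?thesis using R3[of c b] 5 p q 2 by simp
        next
          case 3
          then have "\<psi> c = 0" using \<psi>0 Wd[OF q(2)] d by auto
          then show ?thesis using R3[of b c] 5 p q 3 by simp
        qed
        then show ?thesis using zero by simp
      qed
    qed
  qed
  finally show "hit \<psi> (x * y) - (hit \<psi> x * y + x * hit \<psi> y) \<in> W (m + n - d)" .
qed

text \<open>In the cocentral case left legs are coinvariant as well. After f has taken the first
  leg, what remains is a coinvariant with trivial coaction by \<open>cocentral_hit\<close>; hence
  \<open>tih g x\<close> lies in \<open>A p\<close>, and the coordinate of a b outside
  \<open>A p\<close> kills it.\<close>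

lemma cocentral_legs:
  assumes co: cocentral and b: "b \<in> W (Suc p)" "b \<notin> A p" and x: "x \<in> A n" and p: "p \<le> n"
  shows "hit (cf b) x \<in> W (n - p)"
proof (rule in_subspace_test[OF subspace_W])
  fix g assume g: "functional g" "\<And>u. u \<in> W (n - p) \<Longrightarrow> g u = 0"
  then have pg: "perp (W (n - p)) g" by (simp add: perp_def)
  have "tih g x \<in> A p"
  proof (rule A_I)
    show "tih g x \<in> W (Suc p)"
      using tih_W[OF A_W[OF x] g(1) pg] p by (simp add: Suc_diff_le)
    fix f assume f: "functional f" "perp (W p) f"
    let ?y = "hit f x"
    have y: "?y \<in> A (n - p)" by (rule A_hit[OF x f])
    have "hit f (tih g x) = scale (g ?y) 1"
    proof (rule eq_test)
      fix h assume h: "functional h"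
      have "h (hit f (tih g x)) = conv (conv f h) g x"
        using f g h by (simp add: functional_hit functional_tih linmap_conv)
      also have "\<dots> = g (hit h ?y)"
        using f g h by (simp add: functional_hit conv_assoc hit_hit linmap_conv)
      also have "\<dots> = h 1 * g ?y"
        using g(2)[OF cocentral_hit[OF co y h]] by (simp add: linmap_diff[OF g(1)] linmap_scale[OF g(1)])
      finally show "h (hit f (tih g x)) = h (scale (g ?y) 1)"
        by (simp add: linmap_scale[OF h])
    qed
    then show "\<exists>c. hit f (tih g x) = scale c 1" by blast
  qed
  then have "cf b (tih g x) = 0" using cf_perp_A[OF b(2)] by (simp add: perp_def)
  then show "g (hit (cf b) x) = 0"
    using functional_hit[OF g(1), of "cf b" x] functional_tih[OF lc[of b], of g x] by simp
qed

text \<open>By \<open>cocentral_legs\<close> only coinvariant left legs matter. On products of those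
  of positive degree \<open>\<phi>\<close> vanishes, and those in \<open>A 0\<close> are
  scalars.\<close>

lemma cocentral_derivation:
  assumes cocentral and \<phi>: "functional \<phi>" "perp (W d) \<phi>" and d: "d \<ge> 1"
    and dec: "\<And>p q u v. u \<in> A p \<Longrightarrow> v \<in> A q \<Longrightarrow> p \<ge> 1 \<Longrightarrow> q \<ge> 1 \<Longrightarrow> p + q = d \<Longrightarrow> \<phi> (u * v) = 0"
  shows "is_derivation d \<phi>"
proof (rule derivation_criterion[OF \<phi> d, where rel = "\<lambda>p b. b \<in> A p"])
  show "\<phi> (b * k) = counit k * \<phi> b \<and> \<phi> (k * b) = counit k * \<phi> b" if "k \<in> A 0" for b k
    by (subst (1 3) A_0[OF that]) (simp add: scale_mult_left scale_mult_right linmap_scale[OF \<phi>(1)])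
qed (use dec cocentral_legs[OF assms(1)] in auto)

section \<open>The retraction onto the coinvariants\<close>

lemma sw_W_zero:
  assumes "x \<in> W d" "vector_space m" "bilin scale m \<beta>" "\<And>u v. u \<in> W d \<Longrightarrow> \<beta> u v = 0"
  shows "sw m \<beta> x = 0"
  unfolding sw_expand[OF assms(2,3) B_basis]
proof (intro sum.neutral ballI)
  show "\<beta> b (hit (cf b) x) = 0" for b
    using assms(4) hit_cf_zero[OF assms(1), of b] linmap_0[OF bilinD(1)[OF assms(3)]]
    by (cases "b \<in> W d") auto
qed

text \<open>Only the part of \<Delta>(x) with left leg of degree d counts for such forms, and its
  right leg has degree zero, hence lies in K.\<close>

lemma sw_W_cong:
  assumes x: "x \<in> W (Suc d)" and m: "vector_space m" and \<beta>: "bilin scale m \<beta>" and \<gamma>: "bilin scale m \<gamma>"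
    and 1: "\<And>u v. u \<in> W d \<Longrightarrow> \<beta> u v = 0" "\<And>u v. u \<in> W d \<Longrightarrow> \<gamma> u v = 0"
    and 2: "\<And>u k. u \<in> W (Suc d) \<Longrightarrow> k \<in> K \<Longrightarrow> \<beta> u k = \<gamma> u k"
  shows "sw m \<beta> x = sw m \<gamma> x"
  unfolding sw_expand[OF m \<beta> B_basis] sw_expand[OF m \<gamma> B_basis]
proof (intro sum.cong refl)
  fix b
  consider "b \<in> W d" | "b \<notin> W d" "b \<in> W (Suc d)" | "b \<notin> W (Suc d)" by blast
  then show "\<beta> b (hit (cf b) x) = \<gamma> b (hit (cf b) x)"
  proof cases
    case 2
    have "hit (cf b) x \<in> K" using hit_W[OF x lc cf_perp_W[OF 2(1)]] by simp
    then show ?thesis using assms(7) 2 by blast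
  next
    case 3
    then show ?thesis
      using hit_cf_zero[OF x] linmap_0[OF bilinD(1)[OF \<beta>]] linmap_0[OF bilinD(1)[OF \<gamma>]] by simp
  qed (use 1 in auto)
qed

text \<open>For a coinvariant x the part of \<Delta>(x) with left leg of degree d is x \<otimes> 1,
  and the form vanishes on the rest.\<close>

lemma sw_A:
  assumes x: "x \<in> A d" and m: "vector_space m" and \<beta>: "bilin scale m \<beta>"
    and 1: "\<And>u v. u \<in> W d \<Longrightarrow> \<beta> u v = 0"
  shows "sw m \<beta> x = \<beta> x 1"
proof -
  interpret m: vector_space m by fact
  have "\<beta> x 1 = sw m (\<lambda>a b. m (counit b) (\<beta> a 1)) x"
    by (rule sw_counit(2)[OF bilinD(2)[OF \<beta>], symmetric])
  also have "\<dots> = (\<Sum>b\<in>legs B x. m (counit (hit (cf b) x)) (\<beta> b 1))"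
    by (intro sw_expand[OF m _ B_basis] bilinI linmap_scale_by linmap_fun_scale m linmap_counit bilinD[OF \<beta>])
  also have "\<dots> = (\<Sum>b\<in>legs B x. \<beta> b (hit (cf b) x))"
  proof (intro sum.cong refl)
    fix b
    consider "b \<in> W d" | "b \<notin> W d" by blast
    then show "m (counit (hit (cf b) x)) (\<beta> b 1) = \<beta> b (hit (cf b) x)"
    proof cases
      case 2
      have h: "hit (cf b) x = scale (cf b x) 1" by (rule A_hit_scalar[OF x lc cf_perp_W[OF 2]])
      show ?thesis unfolding h linmap_scale[OF bilinD(1)[OF \<beta>]] linmap_scale[OF linmap_counit] by (simp add: counit_one)
    qed (use 1 in auto)
  qed
  finally show ?thesis by (simp add: sw_expand[OF m \<beta> B_basis])
qed

text \<open>Any linear retraction of H onto K will do, with no compatibility with product or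
  coproduct: it is applied to right legs, and modulo lower terms only its values on K enter.\<close>

definition proj :: "'h \<Rightarrow> 'h" where
  "proj = (SOME f. linmap scale scale f \<and> range f \<subseteq> K \<and> (\<forall>k\<in>K. f k = k))"

lemma proj: "linmap scale scale proj" "proj x \<in> K" "k \<in> K \<Longrightarrow> proj k = k"
proof -
  interpret vv: vector_space_pair scale scale ..
  obtain f where f: "Vector_Spaces.linear scale scale f" "\<forall>b\<in>B. f b = (if b \<in> K then b else 0)"
    using vv.linear_independent_extend[OF B_basis(1), of "\<lambda>b. if b \<in> K then b else 0"] by blast
  have lf: "linmap scale scale f" using f(1) by (simp add: linmap_def Vector_Spaces.linear_iff)
  have "f x \<in> K" if "x \<in> span B" for x
    using that
  proof (induction rule: span_induct_alt)
    case (step c b y)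
    then show ?case using f(2) subspace_K
      by (auto simp: linmap_add[OF lf] linmap_scale[OF lf] intro!: subspace_add subspace_scale subspace_0)
  qed (use subspace_K in \<open>simp add: linmap_0[OF lf] subspace_0\<close>)
  then have "range f \<subseteq> K" using B_basis by auto
  moreover have "f x = x" if "x \<in> span (B \<inter> W 1)" for x
    using that
  proof (induction rule: span_induct_alt)
    case (step c b y)
    then show ?case using f(2) by (simp add: linmap_add[OF lf] linmap_scale[OF lf])
  qed (simp add: linmap_0[OF lf])
  moreover have "span (B \<inter> W 1) = K" using B W_1 unfolding adapted_def One_nat_def by metis
  ultimately have "range f \<subseteq> K" "\<forall>k\<in>K. f k = k" by auto
  then have "\<exists>f. linmap scale scale f \<and> range f \<subseteq> K \<and> (\<forall>k\<in>K. f k = k)" using lf by blast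
  then have "linmap scale scale proj \<and> range proj \<subseteq> K \<and> (\<forall>k\<in>K. proj k = k)"
    unfolding proj_def by (rule someI_ex)
  then show "linmap scale scale proj" "proj x \<in> K" "k \<in> K \<Longrightarrow> proj k = k" by auto
qed

abbreviation Sp :: "'h \<Rightarrow> 'h" where "Sp x \<equiv> antipode (proj x)"

lemma Sp: "linmap scale scale (\<lambda>x. Sp x)" "Sp x \<in> K" "k \<in> K \<Longrightarrow> Sp k = antipode k"
  using proj linmap_comp[OF linmap_antipode proj(1)] antipode_K by auto

lemma W_K_right: "u \<in> W d \<Longrightarrow> k \<in> K \<Longrightarrow> u * k \<in> W d"
  using W_mult_right[of u d k 0] by simp

text \<open>On the associated graded algebra this is \<open>a \<mapsto> a\<^sub>1 S(\<pi>(a\<^sub>2))\<close>.\<close>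

definition retr :: "'h \<Rightarrow> 'h" where
  "retr x = sw scale (\<lambda>a b. a * Sp b) x"

lemmas mult_lin = linmap_mult_left linmap_mult_right linmap_id linmap_comp[OF Sp(1)] linmap_comp[OF proj(1)]
  linmap_comp[OF linmap_antipode]

lemma linmap_retr: "linmap scale scale (\<lambda>x. retr x)"
  unfolding retr_def
  by (intro linmap_sw bilinI vector_space_axioms mult_lin Sp(1))

lemma functional_retr: "linmap scale m f \<Longrightarrow> f (retr x) = sw m (\<lambda>a b. f (a * Sp b)) x"
  unfolding retr_def by (rule linmap_sw_out)

lemma retr_W:
  assumes "x \<in> W d"
  shows "retr x \<in> W d"
proof (rule in_subspace_test[OF subspace_W])
  fix f assume f: "functional f" "\<And>u. u \<in> W d \<Longrightarrow> f u = 0"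
  show "f (retr x) = 0"
    unfolding functional_retr[OF f(1)]
    by (intro sw_W_zero[OF assms] vector_space_mult bilinI linmap_comp[OF f(1)] mult_lin Sp(1) f(2) W_K_right Sp(2))
qed

text \<open>For coinvariant a the sum a_1 k_1 S(a_2 k_2) has leading part a k_1 S(k_2), which the
  antipode collapses. So the retraction applies the counit to the factor in K and fixes
  coinvariants.\<close>

lemma retr_A_K:
  assumes a: "a \<in> A d" and k: "k \<in> K"
  shows "retr (a * k) - scale (counit k) a \<in> W d"
proof (rule in_subspace_test[OF subspace_W])
  fix f assume f: "functional f" "\<And>u. u \<in> W d \<Longrightarrow> f u = 0"
  note L = linmap_comp[OF f(1)] mult_lin Sp(1) vector_space_mult bilinI linmap_sw_param
  have "f (retr (a * k)) = sw (*) (\<lambda>p q. f (p * Sp q)) (a * k)"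
    by (rule functional_retr[OF f(1)])
  also have "\<dots> = sw (*) (\<lambda>u v. sw (*) (\<lambda>y z. f (u * y * Sp (v * z))) k) a"
    by (intro sw_mult L)
  also have "\<dots> = sw (*) (\<lambda>y z. f (a * y * Sp (1 * z))) k"
  proof (rule sw_A[OF a])
    show "bilin scale (*) (\<lambda>u v. sw (*) (\<lambda>y z. f (u * y * Sp (v * z))) k)"
      by (intro L)
    show "sw (*) (\<lambda>y z. f (u * y * Sp (v * z))) k = 0" if "u \<in> W d" for u v
      by (rule sw_K_zero[OF k]) (intro L f(2) W_K_right Sp(2) that | assumption)+
  qed (rule vector_space_mult)
  also have "\<dots> = sw (*) (\<lambda>y z. f (a * (y * antipode z))) k"
    by (rule sw_K_cong[OF k]) (intro L linmap_antipode | simp add: Sp(3) mult.assoc)+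
  also have "\<dots> = counit k * f (a * 1)"
    by (rule sw_antipode_collapse(2)) (intro L)
  finally show "f (retr (a * k) - scale (counit k) a) = 0"
    by (simp add: linmap_diff[OF f(1)] linmap_scale[OF f(1)])
qed

lemma retr_A: "a \<in> A d \<Longrightarrow> retr a - a \<in> W d"
  using retr_A_K[OF _ one_K] by (simp add: counit_one)

text \<open>Since S reverses the coproduct, x_1 S(x_2) has coproduct x_1 S(x_4) \<otimes> x_2
  S(x_3), and the right factor collapses to 1.\<close>

lemma retr_in_A:
  assumes x: "x \<in> W (Suc d)"
  shows "retr x \<in> A d"
proof (rule A_I)
  show "retr x \<in> W (Suc d)" by (rule retr_W[OF x])
  fix f assume f: "functional f" "perp (W d) f"
  then have f0: "f u = 0" if "u \<in> W d" for u using that by (simp add: perp_def)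
  have "hit f (retr x) = scale (f (retr x)) 1"
  proof (rule eq_test)
    fix g assume g: "functional g"
    note L = linmap_comp[OF f(1)] linmap_comp[OF g] mult_lin Sp(1) vector_space_mult bilinI linmap_sw_param
      linmap_const_times linmap_times_const linmap_comp[OF linmap_conv[OF f(1) g]]
    \<comment> \<open>The form f(u S r_2) g(v S r_1); with \<open>proj\<close> inside, it is defined
      and linear on all of H.\<close>
    define T where "T u v r = sw (*) (\<lambda>y z. f (u * Sp z) * g (v * Sp y)) r" for u v r
    have bT: "bilin scale (*) (\<lambda>y z. f (u * Sp z) * g (v * Sp y))" for u v
      by (intro L)
    have lT: "functional (\<lambda>u. T u v r)" "functional (\<lambda>v. T u v r)" "functional (\<lambda>r. T u v r)" for u v r
      unfolding T_def by (intro L linmap_sw[OF vector_space_mult bT])+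
    have lT': "linmap s (*) (\<lambda>x. T u v (h x))" if "linmap s scale h" for u v s h
      by (rule linmap_comp[OF lT(3) that])
    have "g (hit f (retr x)) = conv f g (retr x)" by (rule functional_hit[OF g])
    also have "\<dots> = sw (*) (\<lambda>b r. conv f g (b * Sp r)) x"
      by (rule functional_retr[OF linmap_conv[OF f(1) g]])
    also have "\<dots> = sw (*) (\<lambda>b r. sw (*) (\<lambda>u v. T u v r) b) x"
    proof (rule sw_W_cong[OF x])
      have e: "conv f g (b * antipode k) = sw (*) (\<lambda>u v. sw (*) (\<lambda>y z. f (u * antipode z) * g (v * antipode y)) k) b" for b k
      proof -
        have "conv f g (b * antipode k) = sw (*) (\<lambda>u v. sw (*) (\<lambda>y z. f (u * y) * g (v * z)) (antipode k)) b"
          unfolding conv_def by (rule sw_mult) (intro vector_space_mult bilin_functionals f g)+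
        also have "\<dots> = sw (*) (\<lambda>u v. sw (*) (\<lambda>y z. f (u * antipode z) * g (v * antipode y)) k) b"
          by (rule sw_cong, rule sw_antipode) (intro L)+
        finally show ?thesis .
      qed
      have eK: "sw (*) (\<lambda>y z. f (u * antipode z) * g (v * antipode y)) k = T u v k" if "k \<in> K" for u v k
        unfolding T_def
        by (rule sw_K_cong[OF that]) (intro L linmap_antipode | simp add: Sp(3))+
      show "conv f g (b * Sp r) = 0" if "b \<in> W d" for b r
        unfolding e eK[OF proj(2)]
      proof (rule sw_W_zero[OF that])
        show "T u v (proj r) = 0" if "u \<in> W d" for u v
          unfolding T_def
          by (rule sw_K_zero[OF proj(2)[of r]]) (intro L | simp add: f0 W_K_right Sp(2) that)+
      qed (intro vector_space_mult bilinI lT)+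
      show "sw (*) (\<lambda>u v. T u v r) b = 0" if "b \<in> W d" for b r
      proof (rule sw_W_zero[OF that])
        show "T u v r = 0" if "u \<in> W d" for u v
          unfolding T_def using f0[OF W_K_right[OF that Sp(2)]] by (simp add: sw_def lin_ext_def)
      qed (intro vector_space_mult bilinI lT)+
      show "conv f g (b * Sp k) = sw (*) (\<lambda>u v. T u v k) b" if "k \<in> K" for b k
        using that by (simp add: e eK proj(3))
    qed (intro L linmap_sw lT)+
    also have "\<dots> = sw (*) (\<lambda>u s. sw (*) (\<lambda>v r. T u v r) s) x"
      by (rule sw_coassoc[OF vector_space_mult]) (auto simp: trilin_def lT)
    also have "\<dots> = sw (*) (\<lambda>u s. f (u * Sp s) * g 1) x"
    proof (rule sw_W_cong[OF x])
      show "sw (*) (\<lambda>v r. T u v r) s = 0" if "u \<in> W d" for u s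
        unfolding T_def using f0[OF W_K_right[OF that Sp(2)]] by (simp add: sw_def lin_ext_def)
      show "f (u * Sp s) * g 1 = 0" if "u \<in> W d" for u s
        using f0[OF W_K_right[OF that Sp(2)]] by simp
      show "sw (*) (\<lambda>v r. T u v r) s = f (u * Sp s) * g 1" if s: "s \<in> K" for u s
      proof -
        \<comment> \<open>Coassociativity inside s brings v next to y, so that this inner pair
          collapses first.\<close>
        define R where "R w z = sw (*) (\<lambda>v y. f (u * Sp z) * g (v * Sp y)) w" for w z
        have bR: "bilin scale (*) (\<lambda>v y. f (u * Sp z) * g (v * Sp y))" for z by (intro L)
        have lR: "functional (\<lambda>w. R w z)" "functional (\<lambda>z. R w z)" for w z
          unfolding R_def by (intro L linmap_sw[OF vector_space_mult bR])+
        have "sw (*) (\<lambda>v r. T u v r) s = sw (*) (\<lambda>w z. R w z) s"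
          unfolding T_def R_def
          by (rule sw_coassoc[OF vector_space_mult, symmetric]) (auto simp: trilin_def intro!: L)
        also have "\<dots> = sw (*) (\<lambda>w z. counit w * (f (u * Sp z) * g 1)) s"
        proof (rule sw_K_cong[OF s])
          fix w z assume w: "w \<in> K"
          have "R w z = sw (*) (\<lambda>v y. f (u * Sp z) * g (v * antipode y)) w"
            unfolding R_def by (rule sw_K_cong[OF w]) (intro L linmap_antipode | simp add: Sp(3))+
          also have "\<dots> = counit w * (f (u * Sp z) * g 1)"
            by (rule sw_antipode_collapse(2)) (intro L g)
          finally show "R w z = counit w * (f (u * Sp z) * g 1)" .
        qed (intro L lR linmap_counit)+
        also have "\<dots> = f (u * Sp s) * g 1"
          by (rule sw_counit(1)) (intro L)
        finally show ?thesis .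
      qed
    qed (intro L linmap_sw lT)+
    also have "\<dots> = f (retr x) * g 1"
      unfolding functional_retr[OF f(1)]
      using linmap_sw_out[OF linmap_times_const[OF linmap_id], of "\<lambda>u s. f (u * Sp s)" x "g 1"] by simp
    finally show "g (hit f (retr x)) = g (scale (f (retr x)) 1)" by (simp add: linmap_scale[OF g])
  qed
  then show "\<exists>c. hit f (retr x) = scale c 1" by blast
qed

text \<open>The identity x = x_1 S(\<pi>(x_2)) \<pi>(x_3) of Hopf modules: the graded algebra is the
  product of its coinvariants and K.\<close>

lemma W_decomp:
  assumes x: "x \<in> W (Suc d)"
  shows "x \<in> span ({a * k | a k. a \<in> A d \<and> k \<in> K} \<union> W d)"
proof -
  define y where "y = sw scale (\<lambda>b r. retr b * proj r) x"
  have y: "y = (\<Sum>b\<in>legs B x. retr b * proj (hit (cf b) x))"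
    unfolding y_def by (intro sw_expand[OF _ _ B_basis] vector_space_axioms bilinI mult_lin proj(1) linmap_retr linmap_mult_left[OF linmap_retr])
  have "retr b * proj (hit (cf b) x) \<in> span ({a * k | a k. a \<in> A d \<and> k \<in> K} \<union> W d)" for b
  proof -
    consider "b \<in> W d" | "b \<in> W (Suc d)" | "b \<notin> W (Suc d)" by blast
    then show ?thesis
    proof cases
      case 1
      then have "retr b * proj (hit (cf b) x) \<in> W d" by (intro W_K_right retr_W proj)
      then show ?thesis by (intro span_base) auto
    next
      case 2
      then show ?thesis using retr_in_A[OF 2] proj(2) by (intro span_base UnI1) blast
    next
      case 3
      then show ?thesis using hit_cf_zero[OF x] by (simp add: linmap_0[OF proj(1)] span_zero)
    qed
  qed
  then have "y \<in> span ({a * k | a k. a \<in> A d \<and> k \<in> K} \<union> W d)"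
    unfolding y by (intro span_sum)
  moreover have "x - y \<in> W d"
  proof (rule in_subspace_test[OF subspace_W])
    fix f assume f: "functional f" "\<And>u. u \<in> W d \<Longrightarrow> f u = 0"
    note L = linmap_comp[OF f(1)] mult_lin Sp(1) proj(1) vector_space_mult bilinI linmap_sw_param
      linmap_const_times linmap_times_const linmap_comp[OF linmap_retr]
    have "f y = sw (*) (\<lambda>b r. f (retr b * proj r)) x"
      unfolding y_def by (rule linmap_sw_out[OF f(1)])
    also have "\<dots> = sw (*) (\<lambda>b r. sw (*) (\<lambda>u v. f (u * Sp v * proj r)) b) x"
    proof (rule sw_cong)
      have "functional (\<lambda>z. f (z * proj r))" for r by (intro L)
      then show "f (retr b * proj r) = sw (*) (\<lambda>u v. f (u * Sp v * proj r)) b" for b r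
        by (rule functional_retr)
    qed
    also have "\<dots> = sw (*) (\<lambda>u s. sw (*) (\<lambda>v r. f (u * Sp v * proj r)) s) x"
      by (rule sw_coassoc[OF vector_space_mult]) (auto simp: trilin_def intro!: L)
    also have "\<dots> = sw (*) (\<lambda>u s. counit s * f u) x"
    proof (rule sw_W_cong[OF x])
      have "u * Sp v * proj r \<in> W d" if "u \<in> W d" for u v r
        using that Sp(2) proj(2) by (intro W_K_right)
      then show "sw (*) (\<lambda>v r. f (u * Sp v * proj r)) s = 0" if "u \<in> W d" for u s
        using that f(2) by (simp add: sw_def lin_ext_def)
      show "sw (*) (\<lambda>v r. f (u * Sp v * proj r)) s = counit s * f u" if s: "s \<in> K" for u s
      proof -
        have "sw (*) (\<lambda>v r. f (u * Sp v * proj r)) s = sw (*) (\<lambda>v r. f (u * (antipode v * r))) s"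
          by (rule sw_K_cong[OF s]) (intro L linmap_antipode | simp add: Sp(3) proj(3) mult.assoc)+
        also have "\<dots> = counit s * f (u * 1)"
          by (rule sw_antipode_collapse(1)) (intro L)
        finally show ?thesis by simp
      qed
      have "bilin scale (*) (\<lambda>v r. f (u * Sp v * proj r))" for u by (intro L)
      then show "bilin scale (*) (\<lambda>u s. sw (*) (\<lambda>v r. f (u * Sp v * proj r)) s)"
        by (intro bilinI linmap_sw linmap_sw_param L)
    qed (use f in \<open>auto intro!: L linmap_counit\<close>)
    also have "\<dots> = f x" by (rule sw_counit(2)[OF f(1)])
    finally show "f (x - y) = 0" by (simp add: linmap_diff[OF f(1)])
  qed
  then have "x - y \<in> span ({a * k | a k. a \<in> A d \<and> k \<in> K} \<union> W d)" by (intro span_base) auto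
  ultimately have "y + (x - y) \<in> span ({a * k | a k. a \<in> A d \<and> k \<in> K} \<union> W d)" by (rule span_add)
  then show ?thesis by simp
qed

lemma W_decomp_induct [consumes 1, case_names zero add AK W]:
  assumes "x \<in> W (Suc d)" "P 0" "\<And>c x y. P x \<Longrightarrow> P y \<Longrightarrow> P (scale c x + y)"
    "\<And>a k. a \<in> A d \<Longrightarrow> k \<in> K \<Longrightarrow> P (a * k)" "\<And>x. x \<in> W d \<Longrightarrow> P x"
  shows "P x"
  using W_decomp[OF assms(1)]
proof (induction rule: span_induct_alt)
  case base
  then show ?case by (rule assms(2))
next
  case (step c x y)
  then show ?case using assms(4,5) by (intro assms(3)) auto
qed

text \<open>Left legs are now arbitrary and are written as ak with a coinvariant and k in K.
  Centrality collects the factors from K at the right end of a product, and the retraction replaces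
  them by their counits, which leaves \<open>\<phi>\<close> on products of coinvariants.\<close>

lemma central_derivation:
  assumes c: central and \<phi>: "functional \<phi>" "perp (W d) \<phi>" and d: "d \<ge> 1"
    and dec: "\<And>p q u v. u \<in> A p \<Longrightarrow> v \<in> A q \<Longrightarrow> p \<ge> 1 \<Longrightarrow> q \<ge> 1 \<Longrightarrow> p + q = d \<Longrightarrow> \<phi> (u * v) = 0"
  shows "is_derivation d (\<lambda>x. \<phi> (retr x))"
proof -
  define \<psi> where "\<psi> x = \<phi> (retr x)" for x
  have l: "functional \<psi>" unfolding \<psi>_def by (rule linmap_comp[OF \<phi>(1) linmap_retr])
  have \<psi>0: "\<psi> z = 0" if "z \<in> W d" for z
    using retr_W[OF that] \<phi>(2) by (simp add: \<psi>_def perp_def)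
  have ak: "\<psi> (a * k) = counit k * \<phi> a" if "a \<in> A d" "k \<in> K" for a k
    using perpD[OF \<phi>(2) retr_A_K[OF that]] by (simp add: \<psi>_def linmap_diff[OF \<phi>(1)] linmap_scale[OF \<phi>(1)])
  have "is_derivation d \<psi>"
  proof (rule derivation_criterion[OF l _ d, where rel = "\<lambda>p b. True"])
    show "perp (W d) \<psi>" using \<psi>0 by (simp add: perp_def)
    show "\<psi> (u * v) = 0" if u: "u \<in> W (Suc p)" and v: "v \<in> W (Suc q)" and pq: "p \<ge> 1" "q \<ge> 1" "p + q = d" for p q u v
      using u
    proof (induction rule: W_decomp_induct)
      case (add e x y)
      then show ?case by (simp add: distrib_right scale_mult_left linmap_add[OF l] linmap_scale[OF l])
    next
      case a: (AK a k)
      have akW: "a * k \<in> W (Suc p)" using A_W[OF a(1)] a(2) by (rule W_K_right)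
      show ?case using v
      proof (induction rule: W_decomp_induct)
        case (add e x y)
        then show ?case by (simp add: distrib_left scale_mult_right linmap_add[OF l] linmap_scale[OF l])
      next
        case b: (AK b j)
        \<comment> \<open>Moving k past b changes the product only inside \<open>W d\<close>, where
          \<open>\<psi>\<close> vanishes.\<close>
        have "k * b - b * k \<in> W q" using c a b A_W by (auto simp: central_def)
        then have "a * ((k * b - b * k) * j) \<in> W (p + q)"
          by (intro W_mult_left A_W a W_K_right b)
        then have "\<psi> (a * ((k * b - b * k) * j)) = 0" using \<psi>0 pq by simp
        moreover have "a * ((k * b - b * k) * j) = a * k * (b * j) - a * b * (k * j)"
          by (simp add: algebra_simps)
        moreover have "\<psi> (a * b * (k * j)) = counit (k * j) * \<phi> (a * b)"
          using ak[OF _ mult_K[OF a(2) b(2)]] A_mult[OF a(1) b(1)] pq by simp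
        ultimately show ?case using dec[OF a(1) b(1) pq] by (simp add: linmap_diff[OF l])
      next
        case (W x)
        then show ?case using W_mult_left[OF akW W] pq by (intro \<psi>0) simp
      qed (simp add: linmap_0[OF l])
    next
      case (W x)
      then show ?case using W_mult_right[OF W v] pq by (intro \<psi>0) simp
    qed (simp add: linmap_0[OF l])
    show "\<psi> (b * k) = counit k * \<psi> b \<and> \<psi> (k * b) = counit k * \<psi> b" if b: "b \<in> W (Suc d)" and k: "k \<in> K" for b k
    proof -
      have "\<psi> (b * k) = counit k * \<psi> b"
        using b
      proof (induction rule: W_decomp_induct)
        case (add e x y)
        then show ?case
          by (simp add: distrib_right scale_mult_left linmap_add[OF l] linmap_scale[OF l] algebra_simps)
      next
        case (AK a j)
        then show ?case using ak[OF AK] ak[OF AK(1) mult_K[OF AK(2) k]]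
          by (simp add: mult.assoc counit_mult mult_ac)
      next
        case (W x)
        then show ?case using \<psi>0 W_K_right[OF W k] by simp
      qed (simp add: linmap_0[OF l])
      moreover have "\<psi> (k * b - b * k) = 0" using c b k by (intro \<psi>0) (auto simp: central_def)
      ultimately show ?thesis by (simp add: linmap_diff[OF l])
    qed
  qed auto
  then show ?thesis by (simp add: \<psi>_def[abs_def])
qed

text \<open>In the central case \<open>\<phi>\<close> is composed with the retraction, which does
  not change its values on \<open>A d\<close>.\<close>

lemma derivation_exists:
  assumes cc: "central \<or> cocentral" and \<phi>: "functional \<phi>" "perp (W d) \<phi>" and d: "d \<ge> 1"
    and dec: "\<And>p q u v. u \<in> A p \<Longrightarrow> v \<in> A q \<Longrightarrow> p \<ge> 1 \<Longrightarrow> q \<ge> 1 \<Longrightarrow> p + q = d \<Longrightarrow> \<phi> (u * v) = 0"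
  obtains \<psi> where "functional \<psi>" "perp (W d) \<psi>" "\<And>x. x \<in> A d \<Longrightarrow> \<psi> x = \<phi> x" "is_derivation d \<psi>"
proof (cases central)
  case True
  have "perp (W d) (\<lambda>x. \<phi> (retr x))" using \<phi>(2) retr_W by (auto simp: perp_def)
  moreover have "\<phi> (retr x) = \<phi> x" if "x \<in> A d" for x
    using perpD[OF \<phi>(2) retr_A[OF that]] by (simp add: linmap_diff[OF \<phi>(1)])
  ultimately show ?thesis
    using that[of "\<lambda>x. \<phi> (retr x)"] linmap_comp[OF \<phi>(1) linmap_retr] central_derivation[OF True \<phi> d dec] by auto
next
  case False
  then show ?thesis using that[of \<phi>] \<phi> cocentral_derivation[OF _ \<phi> d dec] cc by auto
qed

end

section \<open>Free generation\<close>

locale hopf_pbw = hopf_pair_basis scale comult counit antipode K B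
  for scale :: "'k::field_char_0 \<Rightarrow> 'h::ring_1 \<Rightarrow> 'h" and comult counit antipode K B +
  assumes cc: "central \<or> cocentral"
begin

section \<open>Generators modulo decomposables\<close>

definition dec :: "nat \<Rightarrow> 'h set" where
  "dec d = span (W d \<union> {u * v | u v. \<exists>p q. u \<in> A p \<and> v \<in> A q \<and> p \<ge> 1 \<and> q \<ge> 1 \<and> p + q = d})"

lemma dec_A: "dec d \<subseteq> A d"
  unfolding dec_def by (rule span_minimal) (use W_A A_mult subspace_A in auto)

lemma subspace_dec: "subspace (dec d)"
  by (simp add: dec_def)

lemma W_dec: "W d \<subseteq> dec d"
  unfolding dec_def by (auto intro: span_base)

text \<open>X is a basis of \<open>A d\<close> modulo decomposables. Independence is recorded by
  dual functionals, the form from which derivations are built.\<close>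

definition gens_spec :: "nat \<Rightarrow> 'h set \<Rightarrow> bool" where
  "gens_spec d X \<longleftrightarrow> X \<subseteq> A d \<and> A d \<subseteq> span (X \<union> dec d) \<and>
     (\<forall>x\<in>X. \<exists>f. functional f \<and> perp (dec d) f \<and> f x = 1 \<and> (\<forall>y\<in>X. y \<noteq> x \<longrightarrow> f y = 0))"

text \<open>No generators in degree zero, since \<open>A 0\<close> consists of scalars.\<close>

definition gens :: "nat \<Rightarrow> 'h set" where
  "gens d = (if d = 0 then {} else SOME X. gens_spec d X)"

lemma gens_spec: "d \<ge> 1 \<Longrightarrow> gens_spec d (gens d)"
proof -
  obtain C where C: "independent C" "span C = UNIV" "span (C \<inter> dec d) = dec d" "span (C \<inter> A d) = A d"
  proof -
    define G where "G n = (if n = 0 then dec d else A d)" for n :: nat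
    obtain C where "independent C" "span C = UNIV" "\<And>n. span (C \<inter> G n) = G n"
      by (rule adapted_basis[of G]) (use subspace_dec subspace_A dec_A in \<open>auto simp: G_def\<close>)
    from this(1,2) this(3)[of 0] this(3)[of 1] show ?thesis by (intro that[of C]) (simp_all add: G_def)
  qed
  define X where "X = C \<inter> A d - dec d"
  have "C \<inter> A d \<subseteq> span (X \<union> dec d)"
    by (auto simp: X_def intro: span_base)
  then have "A d \<subseteq> span (X \<union> dec d)"
    using span_minimal[of "C \<inter> A d" "span (X \<union> dec d)"] C(4) by auto
  moreover have "\<exists>f. functional f \<and> perp (dec d) f \<and> f x = 1 \<and> (\<forall>y\<in>X. y \<noteq> x \<longrightarrow> f y = 0)" if "x \<in> X" for x
  proof (intro exI conjI)
    show "functional (coord C x)" by (rule linmap_representation[OF C(1,2)])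
    show "perp (dec d) (coord C x)"
      using representation_adapted_zero[OF C(1,3)] that by (auto simp: X_def perp_def)
  qed (use that representation_basis[OF C(1)] in \<open>auto simp: X_def\<close>)
  ultimately have "gens_spec d X" by (auto simp: gens_spec_def X_def)
  then have "gens_spec d (SOME X. gens_spec d X)" by (rule someI)
  then show "gens_spec d (gens d)" if "d \<ge> 1" using that by (simp add: gens_def)
qed

text \<open>The degree is carried along with the element, so that weights can be read off
  words.\<close>

definition letters :: "(nat \<times> 'h) set" where
  "letters = {(d, x). x \<in> gens d}"

lemma lettersD: "v \<in> letters \<Longrightarrow> fst v \<ge> 1 \<and> snd v \<in> gens (fst v) \<and> snd v \<in> A (fst v)"
  using gens_spec[of "fst v"] by (cases "fst v = 0") (auto simp: letters_def gens_def gens_spec_def)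

definition wt :: "(nat \<times> 'h) list \<Rightarrow> nat" where "wt w = sum_list (map fst w)"

definition pr :: "(nat \<times> 'h) list \<Rightarrow> 'h" where "pr w = prod_list (map snd w)"

lemma wt_simps [simp]: "wt [] = 0" "wt (v # w) = fst v + wt w" "wt (u @ w) = wt u + wt w"
  and pr_simps [simp]: "pr [] = 1" "pr (v # w) = snd v * pr w" "pr (u @ w) = pr u * pr w"
  by (simp_all add: wt_def pr_def)

lemma pr_A: "set w \<subseteq> letters \<Longrightarrow> pr w \<in> A (wt w)"
  by (induction w) (auto intro: one_A A_mult dest: lettersD)

lemma pr_W: "set w \<subseteq> letters \<Longrightarrow> pr w \<in> W (Suc (wt w))"
  by (rule A_W[OF pr_A])

lemma letter_W: "v \<in> letters \<Longrightarrow> snd v \<in> W (Suc (fst v))"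
  using lettersD A_W by blast

lemma wt_mset: "mset w = mset w' \<Longrightarrow> wt w = wt w'"
  unfolding wt_def by (metis mset_map sum_mset_sum_list)

lemma wt_remove1: "v \<in> set w \<Longrightarrow> wt w = fst v + wt (remove1 v w)"
  using wt_mset[of w "v # remove1 v w"] by simp

lemma pr_extract:
  assumes "set w \<subseteq> letters" "v \<in> set w"
  shows "pr w - snd v * pr (remove1 v w) \<in> W (wt w)"
  using assms
proof (induction w)
  case (Cons u w)
  show ?case
  proof (cases "u = v")
    case True
    then show ?thesis using subspace_0[OF subspace_W] by simp
  next
    case False
    let ?w = "remove1 v w"
    have v: "v \<in> set w" "v \<in> letters" "u \<in> letters" using Cons.prems False by auto
    have sub: "set ?w \<subseteq> letters" using Cons.prems set_remove1_subset by fastforce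
    have "snd u * (pr w - snd v * pr ?w) \<in> W (fst u + wt w)"
      using v Cons by (intro W_mult_left letter_W) auto
    moreover have "(snd u * snd v - snd v * snd u) * pr ?w \<in> W (fst u + fst v + wt ?w)"
      using v by (intro W_mult_right A_commute[OF cc] pr_W sub) (auto dest: lettersD)
    ultimately have "snd u * (pr w - snd v * pr ?w) + (snd u * snd v - snd v * snd u) * pr ?w \<in> W (wt (u # w))"
      using subspace_add[OF subspace_W] wt_remove1[OF v(1)] by (simp add: add.assoc)
    then show ?thesis using False by (simp add: algebra_simps)
  qed
qed simp

text \<open>Induction on the degree: modulo the span of \<open>gens n\<close> a coinvariant is
  decomposable, and its factors have degree smaller than n. The two nested inductions expand first
  the left factor, then the right one.\<close>

lemma pr_generate:
  "x \<in> A n \<Longrightarrow> x \<in> span ({pr w | w. set w \<subseteq> letters \<and> wt w = n} \<union> W n)"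
proof (induction n arbitrary: x rule: less_induct)
  case (less n)
  let ?T = "\<lambda>n. span ({pr w | w. set w \<subseteq> letters \<and> wt w = n} \<union> W n)"
  show ?case
  proof (cases "n = 0")
    case True
    have "pr [] \<in> ?T 0" by (intro span_base UnI1 CollectI exI[of _ "[]"]) simp
    then have "scale (counit x) (pr []) \<in> ?T 0" by (rule span_scale)
    then show ?thesis using A_0[of x] less.prems True by simp
  next
    case False
    have "dec n \<subseteq> ?T n"
      unfolding dec_def
    proof (rule span_minimal)
      have "u * v \<in> ?T n" if u: "u \<in> A p" and v: "v \<in> A q" and pq: "p \<ge> 1" "q \<ge> 1" "p + q = n" for u v p q
      proof -
        have "u \<in> ?T p" using u pq by (intro less.IH) auto
        then show ?thesis
        proof (induction rule: span_induct_alt)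
          case (step c u u')
          have "u * v \<in> ?T n"
          proof (cases "u \<in> W p")
            case True
            then have "u * v \<in> W (p + q)" by (rule W_mult_right[OF _ A_W[OF v]])
            then show ?thesis using pq by (auto intro: span_base)
          next
            case False
            then obtain w where w: "u = pr w" "set w \<subseteq> letters" "wt w = p" using step.hyps by auto
            have "v \<in> ?T q" using v pq by (intro less.IH) auto
            then show ?thesis
            proof (induction rule: span_induct_alt)
              case (step c v v')
              have "u * v \<in> ?T n"
              proof (cases "v \<in> W q")
                case True
                then have "u * v \<in> W (p + q)" using W_mult_left[OF pr_W[OF w(2)]] w by blast
                then show ?thesis using pq by (auto intro: span_base)
              next
                case False
                then obtain w' where "v = pr w'" "set w' \<subseteq> letters" "wt w' = q" using step.hyps by auto
                then show ?thesis using w pq by (intro span_base UnI1 CollectI exI[of _ "w @ w'"]) auto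
              qed
              then have "scale c (u * v) + u * v' \<in> ?T n" using step.IH by (intro span_add span_scale)
              then show ?case by (simp add: distrib_left scale_mult_right)
            qed (simp add: span_zero)
          qed
          then have "scale c (u * v) + u' * v \<in> ?T n" using step.IH by (intro span_add span_scale)
          then show ?case by (simp add: distrib_right scale_mult_left)
        qed (simp add: span_zero)
      qed
      then show "W n \<union> {u * v | u v. \<exists>p q. u \<in> A p \<and> v \<in> A q \<and> p \<ge> 1 \<and> q \<ge> 1 \<and> p + q = n} \<subseteq> ?T n"
        by (auto intro: span_base)
    qed simp
    moreover have "gens n \<subseteq> ?T n"
    proof
      fix y assume "y \<in> gens n"
      then show "y \<in> ?T n"
        by (intro span_base UnI1 CollectI exI[of _ "[(n, y)]"]) (auto simp: letters_def)
    qed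
    ultimately have "span (gens n \<union> dec n) \<subseteq> ?T n" by (intro span_minimal) auto
    then show ?thesis using gens_spec[of n] False less.prems by (auto simp: gens_spec_def)
  qed
qed

text \<open>Partial differentiation by the letter v. The degree of v bounds the degrees of all
  letters, so the derivation sends a letter to a scalar: 0 in smaller degree, the dual value in
  degree \<open>fst v\<close>. The Leibniz rule then counts the occurrences of v.\<close>

lemma hit_pr:
  assumes v: "v \<in> letters" and \<psi>: "functional \<psi>" "perp (W (fst v)) \<psi>" "is_derivation (fst v) \<psi>"
    and dual: "\<psi> (snd v) = 1" "\<And>y. y \<in> gens (fst v) \<Longrightarrow> y \<noteq> snd v \<Longrightarrow> \<psi> y = 0"
  shows "set w \<subseteq> letters \<Longrightarrow> (\<And>u. u \<in> set w \<Longrightarrow> fst u \<le> fst v) \<Longrightarrow>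
    hit \<psi> (pr w) - scale (of_nat (count (mset w) v)) (pr (remove1 v w)) \<in> W (wt w - fst v)"
proof (induction w)
  case Nil
  \<comment> \<open>Constants have derivative 0, since 1 lies in \<open>W (fst v)\<close>, where
    \<open>\<psi>\<close> vanishes.\<close>
  have "1 \<in> W (fst v)" using lettersD[OF v] one_K W_mono[of "Suc 0" "fst v"] by auto
  then show ?case using \<psi> hit_one subspace_0[OF subspace_W] by (simp add: perp_def)
next
  case (Cons u w)
  let ?d = "fst v" and ?c = "of_nat (count (mset w) v) :: 'k"
  have u: "u \<in> letters" "fst u \<le> ?d" and w: "set w \<subseteq> letters" using Cons.prems by auto
  have IH: "hit \<psi> (pr w) - scale ?c (pr (remove1 v w)) \<in> W (wt w - ?d)"
    using Cons by auto
  have hu: "hit \<psi> (snd u) = (if u = v then 1 else 0)"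
  proof (cases "fst u = ?d")
    case True
    then have "hit \<psi> (snd u) = scale (\<psi> (snd u)) 1" using A_hit_scalar[OF _ \<psi>(1,2)] lettersD[OF u(1)] by simp
    moreover have "u = v \<longleftrightarrow> snd u = snd v" using True by (auto simp: prod_eq_iff)
    ultimately show ?thesis using dual lettersD[OF u(1)] True by auto
  next
    case False
    then have "snd u \<in> W ?d" using letter_W[OF u(1)] u(2) W_mono[of "Suc (fst u)" ?d] by auto
    then have "hit \<psi> (snd u) = 0" using hit_W[OF _ \<psi>(1,2), of "snd u" ?d] by simp
    then show ?thesis using False by auto
  qed
  have 1: "hit \<psi> (snd u * pr w) - (hit \<psi> (snd u) * pr w + snd u * hit \<psi> (pr w)) \<in> W (wt (u # w) - ?d)"
    using \<psi>(3) lettersD[OF u(1)] pr_A[OF w] by (simp add: is_derivation_def)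
  have 2: "snd u * (hit \<psi> (pr w) - scale ?c (pr (remove1 v w))) \<in> W (wt (u # w) - ?d)"
  proof (cases "?d \<le> wt w")
    case True
    then show ?thesis using W_mult_left[OF letter_W[OF u(1)] IH] by simp
  next
    case False
    then have "hit \<psi> (pr w) - scale ?c (pr (remove1 v w)) = 0" using IH by simp
    then show ?thesis using subspace_0[OF subspace_W] by simp
  qed
  have 3: "hit \<psi> (snd u) * pr w + snd u * scale ?c (pr (remove1 v w))
      - scale (of_nat (count (mset (u # w)) v)) (pr (remove1 v (u # w))) \<in> W (wt (u # w) - ?d)"
  proof (cases "u = v")
    case True
    have "scale ?c (snd v * pr (remove1 v w) - pr w) \<in> W (wt w)"
    proof (cases "v \<in> set w")
      case True
      then show ?thesis using subspace_neg[OF subspace_W pr_extract[OF w True]] by (intro subspace_scale[OF subspace_W]) simp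
    next
      case False
      then have c: "?c = 0" by simp
      show ?thesis unfolding c using subspace_0[OF subspace_W] by simp
    qed
    then show ?thesis unfolding hu using True
      by (simp add: scale_left_distrib scale_mult_right scale_right_diff_distrib algebra_simps)
  next
    case False
    then show ?thesis using subspace_0[OF subspace_W] by (simp add: hu scale_mult_right)
  qed
  have "(hit \<psi> (snd u * pr w) - (hit \<psi> (snd u) * pr w + snd u * hit \<psi> (pr w)))
    + snd u * (hit \<psi> (pr w) - scale ?c (pr (remove1 v w)))
    + (hit \<psi> (snd u) * pr w + snd u * scale ?c (pr (remove1 v w))
      - scale (of_nat (count (mset (u # w)) v)) (pr (remove1 v (u # w)))) \<in> W (wt (u # w) - ?d)"
    by (intro subspace_add[OF subspace_W] 1 2 3)
  then show ?case by (simp add: right_diff_distrib)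
qed

text \<open>Monomials are compared as multisets because the order of the letters does not matter to
  leading order. An indexed family with distinct multisets is a form of relation that survives
  removing one letter from every word.\<close>

lemma pr_independent:
  assumes "finite I" "\<And>i. i \<in> I \<Longrightarrow> set (\<omega> i) \<subseteq> letters \<and> wt (\<omega> i) = n"
    "inj_on (\<lambda>i. mset (\<omega> i)) I" "(\<Sum>i\<in>I. scale (c i) (pr (\<omega> i))) \<in> W n" "i \<in> I"
  shows "c i = 0"
  using assms
proof (induction n arbitrary: I \<omega> c i rule: less_induct)
  case (less n)
  show ?case
  proof (rule ccontr)
    assume "c i \<noteq> 0"
    define J where "J = {j\<in>I. c j \<noteq> 0}"
    have J: "finite J" "i \<in> J" "J \<subseteq> I" using less.prems \<open>c i \<noteq> 0\<close> by (auto simp: J_def)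
    have sumJ: "(\<Sum>i\<in>I. scale (c i) (pr (\<omega> i))) = (\<Sum>i\<in>J. scale (c i) (pr (\<omega> i)))"
      using less.prems by (intro sum.mono_neutral_right) (auto simp: J_def)
    have wJ: "set (\<omega> j) \<subseteq> letters" "wt (\<omega> j) = n" if "j \<in> J" for j
      using less.prems(2) J that by auto
    define V where "V = (\<Union>j\<in>J. set (\<omega> j))"
    have V: "finite V" "V \<subseteq> letters" using J wJ by (auto simp: V_def)
    show False
    \<comment> \<open>Without letters only the empty word is left, and the relation is a scalar
      multiple of 1.\<close>
    proof (cases "V = {}")
      case True
      then have e: "\<omega> j = []" if "j \<in> J" for j using that by (auto simp: V_def)
      have "J = {i}"
      proof -
        have "j = i" if j: "j \<in> J" for j
        proof (rule inj_onD[OF less.prems(3)])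
          show "mset (\<omega> j) = mset (\<omega> i)" by (simp only: e[OF j] e[OF J(2)])
        qed (use j J in blast)+
        then show ?thesis using J by blast
      qed
      moreover have "n = 0" using e[OF J(2)] wJ(2)[OF J(2)] by simp
      ultimately have "scale (c i) 1 = 0" using less.prems(4) e[OF J(2)] sumJ by simp
      then show False using \<open>c i \<noteq> 0\<close> by simp
    next
      case False
      \<comment> \<open>A letter of maximal degree, as \<open>hit_pr\<close> demands.\<close>
      define d where "d = Max (fst ` V)"
      have "d \<in> fst ` V" unfolding d_def using V False by (intro Max_in) auto
      then obtain v where v: "v \<in> V" "fst v = d" by auto
      have max: "fst u \<le> fst v" if "u \<in> V" for u
        unfolding v(2) d_def using V that by (intro Max_ge) auto
      have vl: "v \<in> letters" "d \<ge> 1" "snd v \<in> gens d" using v V lettersD[of v] by auto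
      obtain \<phi> where \<phi>: "functional \<phi>" "perp (dec d) \<phi>" "\<phi> (snd v) = 1" "\<And>y. y \<in> gens d \<Longrightarrow> y \<noteq> snd v \<Longrightarrow> \<phi> y = 0"
        using gens_spec[OF vl(2)] vl(3) unfolding gens_spec_def by blast
      have \<phi>W: "perp (W d) \<phi>" using \<phi>(2) W_dec by (rule perp_mono)
      have \<phi>dec: "\<phi> (x * y) = 0" if "x \<in> A p" "y \<in> A q" "p \<ge> 1" "q \<ge> 1" "p + q = d" for x y p q
      proof -
        have "x * y \<in> dec d" unfolding dec_def using that by (intro span_base) blast
        then show ?thesis using \<phi>(2) by (simp add: perp_def)
      qed
      obtain \<psi> where \<psi>: "functional \<psi>" "perp (W d) \<psi>" "\<And>x. x \<in> A d \<Longrightarrow> \<psi> x = \<phi> x" "is_derivation d \<psi>"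
        by (rule derivation_exists[OF cc \<phi>(1) \<phi>W vl(2)]) (assumption | rule \<phi>dec that)+
      have gA: "y \<in> A d" if "y \<in> gens d" for y
        using gens_spec[OF vl(2)] that by (auto simp: gens_spec_def)
      have D: "hit \<psi> (pr (\<omega> j)) - scale (of_nat (count (mset (\<omega> j)) v)) (pr (remove1 v (\<omega> j))) \<in> W (n - d)"
        if j: "j \<in> J" for j
      proof -
        have "fst u \<le> fst v" if "u \<in> set (\<omega> j)" for u using that j by (intro max) (auto simp: V_def)
        then show ?thesis
          using hit_pr[OF vl(1), of \<psi> "\<omega> j"] \<psi> \<phi> gA wJ[OF j] vl(3) v(2) by simp
      qed
      let ?c = "\<lambda>j. c j * of_nat (count (mset (\<omega> j)) v)"
      have "(\<Sum>j\<in>J. scale (c j) (hit \<psi> (pr (\<omega> j)) - scale (of_nat (count (mset (\<omega> j)) v)) (pr (remove1 v (\<omega> j))))) \<in> W (n - d)"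
        by (intro subspace_sum subspace_scale subspace_W D)
      moreover have "hit \<psi> (\<Sum>j\<in>J. scale (c j) (pr (\<omega> j))) \<in> W (n - d)"
        using less.prems(4) sumJ by (intro hit_W \<psi>) simp
      then have "(\<Sum>j\<in>J. scale (c j) (hit \<psi> (pr (\<omega> j)))) \<in> W (n - d)"
        by (simp add: linmap_sum[OF linmap_hit[OF \<psi>(1)]] linmap_scale[OF linmap_hit[OF \<psi>(1)]])
      ultimately have "(\<Sum>j\<in>J. scale (c j) (hit \<psi> (pr (\<omega> j)))) -
          (\<Sum>j\<in>J. scale (c j) (hit \<psi> (pr (\<omega> j)) - scale (of_nat (count (mset (\<omega> j)) v)) (pr (remove1 v (\<omega> j))))) \<in> W (n - d)"
        by (intro subspace_diff[OF subspace_W])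
      then have "(\<Sum>j\<in>J. scale (?c j) (pr (remove1 v (\<omega> j)))) \<in> W (n - d)"
        by (simp add: sum_subtractf[symmetric] scale_right_diff_distrib)
      \<comment> \<open>Words without v drop out; the others lose one v, so the weight falls by d
        \<ge> 1.\<close>
      moreover define J' where "J' = {j\<in>J. v \<in> set (\<omega> j)}"
      have "(\<Sum>j\<in>J. scale (?c j) (pr (remove1 v (\<omega> j)))) = (\<Sum>j\<in>J'. scale (?c j) (pr (remove1 v (\<omega> j))))"
        using J by (intro sum.mono_neutral_right) (auto simp: J'_def count_eq_zero_iff)
      ultimately have rel: "(\<Sum>j\<in>J'. scale (?c j) (pr (remove1 v (\<omega> j)))) \<in> W (n - d)" by simp
      obtain j where j: "j \<in> J'" using v by (auto simp: V_def J'_def)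
      have "?c j = 0"
      proof (rule less.IH[OF _ _ _ _ rel j])
        have "wt (\<omega> j) = d + wt (remove1 v (\<omega> j))" using wt_remove1[of v "\<omega> j"] j v by (simp add: J'_def)
        then show "n - d < n" using wJ(2)[of j] j vl by (auto simp: J'_def)
        show "finite J'" using J by (simp add: J'_def)
        show "set (remove1 v (\<omega> i)) \<subseteq> letters \<and> wt (remove1 v (\<omega> i)) = n - d" if "i \<in> J'" for i
          using wJ[of i] that wt_remove1[of v "\<omega> i"] v(2) set_remove1_subset[of v "\<omega> i"] by (auto simp: J'_def)
        show "inj_on (\<lambda>i. mset (remove1 v (\<omega> i))) J'"
        proof (rule inj_onI)
          fix a b assume ab: "a \<in> J'" "b \<in> J'" "mset (remove1 v (\<omega> a)) = mset (remove1 v (\<omega> b))"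
          then have "mset (\<omega> a) = mset (\<omega> b)"
            by (metis (no_types, lifting) J'_def insert_DiffM mem_Collect_eq mset_remove1 set_mset_mset)
          then show "a = b" using inj_onD[OF less.prems(3), of a b] ab J by (auto simp: J'_def)
        qed
      qed
      \<comment> \<open>The coefficient is c j times a positive number of occurrences, which is
        nonzero in characteristic zero.\<close>
      then show False using j by (auto simp: J'_def J_def count_eq_zero_iff)
    qed
  qed
qed

end

section \<open>The associated graded algebra and its coinvariants\<close>

lemma free_span_words_graded:
  "free.span {word [Poly_Mapping.single i y, Poly_Mapping.single j z] | i j y z. P i j y z}
    = {t :: (nat \<Rightarrow>\<^sub>0 'h::zero) list \<Rightarrow>\<^sub>0 'k::field. \<forall>w\<in>keys t.
        \<exists>i j y z. w = [Poly_Mapping.single i y, Poly_Mapping.single j z] \<and> P i j y z}"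
proof -
  have "{word [Poly_Mapping.single i y, Poly_Mapping.single j z] | i j y z. P i j y z}
    = {word w :: (nat \<Rightarrow>\<^sub>0 'h) list \<Rightarrow>\<^sub>0 'k | w. \<exists>i j y z. w = [Poly_Mapping.single i y, Poly_Mapping.single j z] \<and> P i j y z}"
    by blast
  then show ?thesis
    using free_span_words[of "\<lambda>w. \<exists>i j y z. w = [Poly_Mapping.single i y, Poly_Mapping.single j z] \<and> P i j y z"]
    by (simp only:)
qed

lemma ungrade_single [simp]: "ungrade (Poly_Mapping.single i y) = y"
  by (cases "y = 0") (auto simp: ungrade_def)

lemma mult_sum_single:
  "a * b = (\<Sum>i\<in>keys a. \<Sum>j\<in>keys b.
      Poly_Mapping.single (i + j) (Poly_Mapping.lookup a i * Poly_Mapping.lookup b j))"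
  for a b :: "nat \<Rightarrow>\<^sub>0 'h::ring_1"
proof -
  have "a * b = (\<Sum>i\<in>keys a. Poly_Mapping.single i (Poly_Mapping.lookup a i)) *
      (\<Sum>j\<in>keys b. Poly_Mapping.single j (Poly_Mapping.lookup b j))"
    using poly_mapping_sum_single[of "keys a" a] poly_mapping_sum_single[of "keys b" b] by simp
  then show ?thesis by (simp add: sum_product mult_single)
qed

context hopf_pair_basis
begin

section \<open>The graded algebra as a quotient space\<close>

abbreviation ps :: "'k \<Rightarrow> (nat \<Rightarrow>\<^sub>0 'h) \<Rightarrow> nat \<Rightarrow>\<^sub>0 'h" where "ps c \<equiv> Poly_Mapping.map (scale c)"
abbreviation G where "G \<equiv> gr scale comult K"
abbreviation R where "R \<equiv> coinv scale comult K"
abbreviation lu :: "(nat \<Rightarrow>\<^sub>0 'h) \<Rightarrow> nat \<Rightarrow> 'h" where "lu \<equiv> Poly_Mapping.lookup"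
abbreviation sg :: "nat \<Rightarrow> 'h \<Rightarrow> nat \<Rightarrow>\<^sub>0 'h" where "sg \<equiv> Poly_Mapping.single"

lemma lookup_ps [simp]: "lu (ps c a) n = scale c (lu a n)"
  by (simp add: lookup_map_zero)

lemma vector_space_ps: "vector_space ps"
  by unfold_locales (auto intro!: poly_mapping_eqI simp: lookup_add scale_right_distrib scale_left_distrib)

lemma scl_G [simp]: "scl G = ps" and car_G: "a \<in> car G \<longleftrightarrow> (\<forall>n. lu a n \<in> W (Suc n))"
  and nul_G: "a \<in> nul G \<longleftrightarrow> (\<forall>n. lu a n \<in> W n)"
  by (simp_all add: gr_def)

lemma subspace_G: "module.subspace ps (car G)" "module.subspace ps (nul G)"
proof -
  interpret p: vector_space ps by (rule vector_space_ps)
  note s = subspace_add[OF subspace_W] subspace_0[OF subspace_W] subspace_scale[OF subspace_W]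
  show "p.subspace (car G)" "p.subspace (nul G)"
    by (auto intro!: p.subspaceI simp: car_G nul_G lookup_add s)
qed

lemma nul_car_G: "nul G \<subseteq> car G"
  unfolding subset_iff car_G nul_G using subsetD[OF W_Suc] by blast

lemma kspace_G: "kspace G"
  using subspace_G vector_space_ps nul_car_G by (simp add: kspace_def)

lemma lookup_sg: "lu (sg n x) m = (if m = n then x else 0)"
  by (simp add: lookup_single when_def)

lemma sg_car [simp]: "sg n x \<in> car G \<longleftrightarrow> x \<in> W (Suc n)"
  and sg_nul [simp]: "sg n x \<in> nul G \<longleftrightarrow> x \<in> W n"
  using subspace_0[OF subspace_W] by (auto simp: car_G nul_G lookup_sg)

lemma linmap_sg: "linmap scale ps (sg n)"
  by (intro linmapI poly_mapping_eqI) (auto simp: lookup_sg lookup_add)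

lemma linmap_lu: "linmap ps scale (\<lambda>a. lu a n)"
  by (auto simp: linmap_def lookup_add)

text \<open>A scalar c acts as multiplication by the central element c 1 of degree zero.\<close>

lemma ps_mult: "ps c a * b = ps c (a * b)" "a * ps c b = ps c (a * b)"
proof -
  have 1: "ps c a = sg 0 (scale c 1) * a" for a
  proof (rule poly_mapping_eqI)
    show "lu (ps c a) k = lu (sg 0 (scale c 1) * a) k" for k
      by (cases "a = 0"; cases "scale c 1 = 0"; cases "c = 0")
        (auto simp: mult_sum_single[of _ a] lookup_sum lookup_sg sum.delta scale_mult_left in_keys_iff)
  qed
  have 2: "a * sg 0 (scale c 1) = sg 0 (scale c 1) * a" for a
    unfolding mult_sum_single[of a] mult_sum_single[of _ a]
    by (subst sum.swap) (simp add: scale_mult_left scale_mult_right lookup_sg)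
  show "ps c a * b = ps c (a * b)" by (simp add: 1 mult.assoc)
  show "a * ps c b = ps c (a * b)" by (simp add: 1 2 flip: mult.assoc)
qed

lemma linmap_ps_mult: "linmap ps ps (\<lambda>x. x * c)" "linmap ps ps (\<lambda>x. c * x)"
  by (auto simp: linmap_def ps_mult algebra_simps)

lemma G_sum_closed:
  "(\<And>i. i \<in> I \<Longrightarrow> f i \<in> nul G) \<Longrightarrow> sum f I \<in> nul G"
  "(\<And>i. i \<in> I \<Longrightarrow> f i \<in> car G) \<Longrightarrow> sum f I \<in> car G"
  using module.subspace_sum[OF _ subspace_G(2), of I f] module.subspace_sum[OF _ subspace_G(1), of I f] vector_space_ps
  by (simp_all add: module_iff_vector_space)

lemma car_GD: "a \<in> car G \<Longrightarrow> lu a n \<in> W (Suc n)" and nul_GD: "a \<in> nul G \<Longrightarrow> lu a n \<in> W n"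
  by (simp_all add: car_G nul_G)

lemma mult_car_G: "a \<in> car G \<Longrightarrow> b \<in> car G \<Longrightarrow> a * b \<in> car G"
  unfolding mult_sum_single[of a b]
  by (intro G_sum_closed, subst sg_car) (intro W_mult_Suc car_GD)

lemma mult_nul_G: "a \<in> nul G \<Longrightarrow> b \<in> car G \<Longrightarrow> a * b \<in> nul G" "b \<in> car G \<Longrightarrow> a \<in> nul G \<Longrightarrow> b * a \<in> nul G"
  unfolding mult_sum_single
  by (intro G_sum_closed, subst sg_nul, intro W_mult_left W_mult_right car_GD nul_GD; assumption)+

definition gfun :: "((nat \<Rightarrow>\<^sub>0 'h) \<Rightarrow> 'k) \<Rightarrow> bool" where
  "gfun f \<longleftrightarrow> linmap ps (*) f \<and> (\<forall>a\<in>nul G. f a = 0)"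

abbreviation comp_at :: "((nat \<Rightarrow>\<^sub>0 'h) \<Rightarrow> 'k) \<Rightarrow> nat \<Rightarrow> 'h \<Rightarrow> 'k" where
  "comp_at f n \<equiv> \<lambda>x. f (sg n x)"

lemma gfun_at: "gfun f \<Longrightarrow> functional (comp_at f n)" "gfun f \<Longrightarrow> perp (W n) (comp_at f n)"
  by (auto simp: gfun_def perp_def intro: linmap_comp[OF _ linmap_sg])

lemma gfun_lookup: "functional f \<Longrightarrow> perp (W n) f \<Longrightarrow> gfun (\<lambda>a. f (lu a n))"
  by (auto simp: gfun_def perp_def nul_G intro: linmap_comp[OF _ linmap_lu])

lemma gfun_sum: "gfun f \<Longrightarrow> f a = (\<Sum>n\<in>keys a. f (sg n (lu a n)))"
  unfolding gfun_def using poly_mapping_sum_single[of "keys a" a] linmap_sum[of ps "(*)" f]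
  by (metis finite_keys order_refl)

lemma conv_zero: "conv (\<lambda>x. 0) g x = 0" "conv f (\<lambda>x. 0) x = 0"
  by (simp_all add: conv_def sw_def lin_ext_def)

text \<open>A witness for the choice in \<open>gr_comult_at\<close>: expand \<Delta>(x) in the
  adapted basis and place each b in its exact degree; its right leg then lies in the complementary
  step.\<close>

lemma gr_comult_at_spec:
  assumes x: "x \<in> W (Suc n)"
  defines "t \<equiv> gr_comult_at scale comult K n x"
  shows "t \<in> free.span {word [sg i y, sg j z] | i j y z. i + j = n \<and> y \<in> W (Suc i) \<and> z \<in> W (Suc j)}"
    "keq H2 (tmap2 ungrade ungrade t) (comult x)"
proof -
  let ?T = "free.span {word [sg i y, sg j z] :: (nat \<Rightarrow>\<^sub>0 'h) list \<Rightarrow>\<^sub>0 'k | i j y z. i + j = n \<and> y \<in> W (Suc i) \<and> z \<in> W (Suc j)}"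
  have "\<exists>p. p \<le> n \<and> b \<in> W (Suc p) \<and> b \<notin> W p" if "b \<in> legs B x \<inter> W (Suc n)" for b
  proof -
    have "b \<in> B" "b \<in> W (Suc n)" using legs_subset that by auto
    then obtain p where "p \<le> n" "b \<in> W (Suc p)" "b \<notin> W p" by (rule degree_exists)
    then show ?thesis by blast
  qed
  then obtain dg where dg: "\<And>b. b \<in> legs B x \<inter> W (Suc n) \<Longrightarrow> dg b \<le> n \<and> b \<in> W (Suc (dg b)) \<and> b \<notin> W (dg b)"
    by metis
  let ?x = "\<lambda>b. hit (cf b) x"
  let ?s = "(\<Sum>b\<in>legs B x \<inter> W (Suc n). word [sg (dg b) b, sg (n - dg b) (?x b)]) :: (nat \<Rightarrow>\<^sub>0 'h) list \<Rightarrow>\<^sub>0 'k"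
  have 1: "?s \<in> ?T"
  proof (intro free.span_sum free.span_base)
    fix b assume b: "b \<in> legs B x \<inter> W (Suc n)"
    have "dg b + (n - dg b) = n" "b \<in> W (Suc (dg b))" using dg[OF b] by auto
    moreover have "?x b \<in> W (Suc (n - dg b))"
      using hit_W[OF x lc cf_perp_W, of b "dg b"] dg[OF b] by (simp add: Suc_diff_le)
    ultimately show "word [sg (dg b) b, sg (n - dg b) (?x b)] \<in>
        {word [sg i y, sg j z] :: (nat \<Rightarrow>\<^sub>0 'h) list \<Rightarrow>\<^sub>0 'k | i j y z. i + j = n \<and> y \<in> W (Suc i) \<and> z \<in> W (Suc j)}"
      by blast
  qed
  have 2: "tmap2 ungrade ungrade ?s = (\<Sum>b\<in>legs B x \<inter> W (Suc n). word [b, ?x b])"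
    by (simp add: tmap2_def lin_ext_sum[OF vector_space_smul] lin_ext_word[OF vector_space_smul])
  have "keq H2 (\<Sum>b\<in>legs B x \<inter> W (Suc n). word [b, ?x b]) (comult x)"
  proof (rule tpow2_keqI[OF kspace_full[OF vector_space_axioms] _ comult_car])
    show "(\<Sum>b\<in>legs B x \<inter> W (Suc n). word [b, ?x b]) \<in> car H2"
      by (intro free.subspace_sum subspace_car_tpow) simp
    fix f g assume fg: "linmap (scl (full_space scale)) (*) f" "linmap (scl (full_space scale)) (*) g"
    have "evf f g (comult x) = (\<Sum>b\<in>legs B x. f b * g (?x b))"
      using sw_expand[OF vector_space_mult bilin_functionals B_basis, of f g x] fg by (simp add: sw_def)
    also have "\<dots> = (\<Sum>b\<in>legs B x \<inter> W (Suc n). f b * g (?x b))"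
      using hit_cf_zero[OF x] linmap_0[OF fg(2)] by (intro sum.mono_neutral_right finite_legs) auto
    finally show "evf f g (\<Sum>b\<in>legs B x \<inter> W (Suc n). word [b, ?x b]) = evf f g (comult x)"
      by (simp add: lin_ext_sum[OF vector_space_mult] lin_ext_word[OF vector_space_mult] del: One_nat_def)
  qed
  then have "?s \<in> ?T \<and> keq H2 (tmap2 ungrade ungrade ?s) (comult x)" using 1 2 by simp
  then have "t \<in> ?T \<and> keq H2 (tmap2 ungrade ungrade t) (comult x)"
    unfolding t_def gr_comult_at_def by (rule someI)
  then show "t \<in> ?T" "keq H2 (tmap2 ungrade ungrade t) (comult x)" by auto
qed

lemma gr_comult_at_keys:
  assumes "x \<in> W (Suc n)" "w \<in> keys (gr_comult_at scale comult K n x)"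
  obtains i j y z where "w = [sg i y, sg j z]" "i + j = n" "y \<in> W (Suc i)" "z \<in> W (Suc j)"
  using gr_comult_at_spec(1)[OF assms(1)] assms(2) unfolding free_span_words_graded by blast

text \<open>The chosen representative is arbitrary, but its pairings are not: f \<otimes> g picks
  the components in degrees i and n - i. Most later facts on the graded coproduct go through this
  formula.\<close>

lemma gr_comult_at_test:
  assumes x: "x \<in> W (Suc n)" and f: "gfun f" and g: "gfun g"
  shows "ev2 (*) (\<lambda>a b. f a * g b) (gr_comult_at scale comult K n x) = (\<Sum>i\<le>n. conv (comp_at f i) (comp_at g (n - i)) x)"
proof -
  define \<beta> where "\<beta> u v = (\<Sum>i\<le>n. comp_at f i u * comp_at g (n - i) v)" for u v
  have \<beta>: "bilin scale (*) \<beta>"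
    unfolding \<beta>_def
    by (intro bilinI linmap_fun_sum vector_space_mult linmap_times_const linmap_const_times gfun_at f g)
  have "(\<Sum>i\<le>n. conv (comp_at f i) (comp_at g (n - i)) x) = sw (*) \<beta> x"
    by (simp add: conv_def sw_def \<beta>_def lin_ext_fun_sum[OF vector_space_mult])
  also have "\<dots> = ev2 (*) \<beta> (tmap2 ungrade ungrade (gr_comult_at scale comult K n x))"
    unfolding sw_def by (rule ev2_keq[OF vector_space_mult bilin_imp_bilin_on[OF \<beta>] gr_comult_at_spec(2)[OF x], symmetric])
  also have "\<dots> = ev2 (*) (\<lambda>a b. f a * g b) (gr_comult_at scale comult K n x)"
    unfolding ev2_tmap2[OF vector_space_mult]
  proof (rule lin_ext_cong)
    fix w assume "w \<in> keys (gr_comult_at scale comult K n x)"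
    then obtain i j y z where w: "w = [sg i y, sg j z]" "i + j = n" "y \<in> W (Suc i)" "z \<in> W (Suc j)"
      by (rule gr_comult_at_keys[OF x])
    \<comment> \<open>Off the diagonal one of the two legs lies too low in the filtration for its
      functional.\<close>
    have "comp_at f k y * comp_at g (n - k) z = (if k = i then f (sg i y) * g (sg j z) else 0)" if "k \<le> n" for k
    proof -
      consider "k = i" | "k < i" | "k > i" by linarith
      then show ?thesis
      proof cases
        case 2
        then have "Suc j \<le> n - k" using w(2) by linarith
        then have "z \<in> W (n - k)" using w(4) W_mono by blast
        then show ?thesis using 2 gfun_at(2)[OF g] by (simp add: perp_def)
      next
        case 3
        then have "Suc i \<le> k" by linarith
        then have "y \<in> W k" using w(3) W_mono by blast
        then show ?thesis using 3 gfun_at(2)[OF f] by (simp add: perp_def)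
      qed (use w in auto)
    qed
    then have "\<beta> y z = (\<Sum>k\<le>n. if k = i then f (sg i y) * g (sg j z) else 0)"
      unfolding \<beta>_def by (intro sum.cong) auto
    also have "\<dots> = f (sg i y) * g (sg j z)" using w by simp
    finally show "\<beta> (ungrade (w ! 0)) (ungrade (w ! 1)) = f (w ! 0) * g (w ! 1)"
      using w by simp
  qed
  finally show ?thesis by simp
qed

abbreviation gc where "gc \<equiv> gr_comult scale comult K"

lemma gr_comult_test:
  assumes a: "a \<in> car G" and f: "gfun f" and g: "gfun g"
  shows "ev2 (*) (\<lambda>a b. f a * g b) (gc a) =
    (\<Sum>n\<in>keys a. \<Sum>i\<le>n. conv (comp_at f i) (comp_at g (n - i)) (lu a n))"
  unfolding gr_comult_def lin_ext_sum[OF vector_space_mult]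
  using a by (intro sum.cong refl gr_comult_at_test f g) (simp add: car_G)

lemma gr_comult_car:
  assumes a: "a \<in> car G"
  shows "gc a \<in> car (tpow G 2)"
  unfolding gr_comult_def
proof (intro free.subspace_sum subspace_car_tpow)
  fix n
  have "lu a n \<in> W (Suc n)" using a by (simp add: car_G)
  then show "gr_comult_at scale comult K n (lu a n) \<in> car (tpow G 2)"
    unfolding car_tpow
  proof (intro CollectI ballI)
    fix w assume "w \<in> keys (gr_comult_at scale comult K n (lu a n))"
    then obtain i j y z where "w = [sg i y, sg j z]" "i + j = n" "y \<in> W (Suc i)" "z \<in> W (Suc j)"
      by (rule gr_comult_at_keys[OF \<open>lu a n \<in> W (Suc n)\<close>])
    then show "set w \<subseteq> car G \<and> length w = 2" by simp
  qed
qed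

lemma gr_comult_zero_keys:
  assumes "k \<in> K" "w \<in> keys (gc (sg 0 k))"
  obtains y z where "w = [sg 0 y, sg 0 z]" "y \<in> K" "z \<in> K"
proof -
  have "k \<noteq> 0" using assms(2) by (auto simp: gr_comult_def)
  then have "w \<in> keys (gr_comult_at scale comult K 0 k)" using assms(2) by (simp add: gr_comult_def)
  moreover have "k \<in> W (Suc 0)" using assms(1) by simp
  ultimately obtain i j y z where "w = [sg i y, sg j z]" "i + j = 0" "y \<in> W (Suc i)" "z \<in> W (Suc j)"
    by (metis gr_comult_at_keys)
  then show ?thesis using that by simp
qed

lemma gr_comult_zero_test:
  assumes k: "k \<in> K" and m: "vector_space m" and \<beta>: "bilin scale m (\<lambda>y z. \<beta> (sg 0 y) (sg 0 z))"
  shows "ev2 m \<beta> (gc (sg 0 k)) = sw m (\<lambda>y z. \<beta> (sg 0 y) (sg 0 z)) k"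
proof (cases "k = 0")
  case True
  then show ?thesis using linmap_0[OF linmap_sw[OF m \<beta>]] by (simp add: gr_comult_def)
next
  case False
  have k1: "k \<in> W (Suc 0)" using k by simp
  have "sw m (\<lambda>y z. \<beta> (sg 0 y) (sg 0 z)) k = ev2 m (\<lambda>y z. \<beta> (sg 0 y) (sg 0 z)) (tmap2 ungrade ungrade (gr_comult_at scale comult K 0 k))"
    unfolding sw_def by (rule ev2_keq[OF m bilin_imp_bilin_on[OF \<beta>] gr_comult_at_spec(2)[OF k1], symmetric])
  also have "\<dots> = ev2 m \<beta> (gr_comult_at scale comult K 0 k)"
    unfolding ev2_tmap2[OF m, of "\<lambda>y z. \<beta> (sg 0 y) (sg 0 z)"]
    by (rule lin_ext_cong) (auto elim!: gr_comult_at_keys[OF k1])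
  finally show ?thesis using False by (simp add: gr_comult_def)
qed

lemma gr_proj_car: "a \<in> car G \<Longrightarrow> gr_proj a \<in> car G"
  using car_GD[of a 0] by (simp add: gr_proj_def)

lemma one_G: "1 \<in> car G"
proof -
  have "sg 0 1 \<in> car G" using one_K by (subst sg_car) simp
  then show ?thesis by simp
qed

lemma gfun_proj: "gfun g \<Longrightarrow> gfun (\<lambda>a. g (gr_proj a))"
  unfolding gr_proj_def
  by (intro gfun_lookup gfun_at) 

text \<open>Test the defining equation with f concentrated in degree n and g in degree zero. The
  pairing becomes f(x_1)g(x_2) for the component x in degree n, which is the condition defining
  \<open>A n\<close>; conversely, arbitrary pairings split into such ones.\<close>

lemma car_R: "b \<in> car R \<longleftrightarrow> (\<forall>n. lu b n \<in> A n)"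
proof
  assume "b \<in> car R"
  then have b: "b \<in> car G" and eq: "keq (tpow G 2) (tmap2 (\<lambda>x. x) gr_proj (gc b)) (word [b, 1])"
    by (auto simp: coinv_def)
  show "\<forall>n. lu b n \<in> A n"
  proof (intro allI A_I)
    fix n
    show "lu b n \<in> W (Suc n)" using b by (simp add: car_G)
    fix f assume f: "functional f" "perp (W n) f"
    have "hit f (lu b n) = scale (f (lu b n)) 1"
    proof (rule eq_test)
      fix g assume g: "functional g"
      define f' where "f' = (\<lambda>a. f (lu a n))"
      define g' where "g' = (\<lambda>a. g (lu a 0))"
      have f': "gfun f'" and g': "gfun g'"
        unfolding f'_def g'_def using f g by (auto intro: gfun_lookup simp: perp_def linmap_0)
      have fat: "comp_at f' i = (if i = n then f else (\<lambda>x. 0))" and gat: "comp_at g' i = (if i = 0 then g else (\<lambda>x. 0))" for i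
        using linmap_0[OF f(1)] linmap_0[OF g] by (auto simp: f'_def g'_def lookup_sg)
      have "evf f' g' (gc b) = evf f' g' (tmap2 (\<lambda>x. x) gr_proj (gc b))"
        unfolding ev2_tmap2[OF vector_space_mult, of "\<lambda>x y. f' x * g' y"] by (simp add: g'_def gr_proj_def)
      also have "\<dots> = f' b * g' 1"
        using f' g' ev2_keq[OF vector_space_mult bilin_on_functionals eq, of f' g']
        by (simp add: gfun_def lin_ext_word[OF vector_space_mult])
      also have "evf f' g' (gc b) =
          (\<Sum>m\<in>keys b. \<Sum>i\<le>m. if m = n \<and> i = n then conv f g (lu b n) else 0)"
        unfolding gr_comult_test[OF b f' g']
        by (intro sum.cong refl) (auto simp: fat gat conv_zero)
      also have "\<dots> = (\<Sum>m\<in>keys b. if m = n then conv f g (lu b n) else 0)"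
        by (intro sum.cong refl) (auto simp: sum.delta)
      also have "\<dots> = conv f g (lu b n)"
        using linmap_0[OF linmap_conv[OF f(1) g]] by (auto simp: sum.delta in_keys_iff)
      finally show "g (hit f (lu b n)) = g (scale (f (lu b n)) 1)"
        by (simp add: functional_hit[OF g] linmap_scale[OF g] f'_def g'_def lookup_one)
    qed
    then show "\<exists>c. hit f (lu b n) = scale c 1" by blast
  qed
next
  assume A: "\<forall>n. lu b n \<in> A n"
  then have b: "b \<in> car G" using A_W by (simp add: car_G)
  have "keq (tpow G 2) (tmap2 (\<lambda>x. x) gr_proj (gc b)) (word [b, 1])"
  proof (rule tpow2_keqI[OF kspace_G])
    show "tmap2 (\<lambda>x. x) gr_proj (gc b) \<in> car (tpow G 2)"
      by (rule tmap2_car[OF gr_comult_car[OF b]]) (auto simp: gr_proj_car)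
    show "word [b, 1] \<in> car (tpow G 2)" using b one_G by simp
    fix f g assume fg: "linmap (scl G) (*) f" "linmap (scl G) (*) g" "\<And>x. x \<in> nul G \<Longrightarrow> f x = 0" "\<And>x. x \<in> nul G \<Longrightarrow> g x = 0"
    then have f: "gfun f" and g: "gfun g" by (auto simp: gfun_def)
    have gat: "comp_at (\<lambda>a. g (gr_proj a)) i = (if i = 0 then comp_at g 0 else (\<lambda>x. 0))" for i
      using linmap_0[OF fg(2)] by (auto simp: gr_proj_def lookup_sg)
    have "evf f g (tmap2 (\<lambda>x. x) gr_proj (gc b)) =
       (\<Sum>n\<in>keys b. \<Sum>i\<le>n. conv (comp_at f i) (comp_at (\<lambda>a. g (gr_proj a)) (n - i)) (lu b n))"
      unfolding ev2_tmap2[OF vector_space_mult, of "\<lambda>x y. f x * g y"] by (rule gr_comult_test[OF b f gfun_proj[OF g]])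
    also have "\<dots> = (\<Sum>n\<in>keys b. \<Sum>i\<le>n. if i = n then conv (comp_at f n) (comp_at g 0) (lu b n) else 0)"
      by (intro sum.cong refl) (auto simp: gat conv_zero)
    also have "\<dots> = (\<Sum>n\<in>keys b. f (sg n (lu b n)) * g 1)"
    proof (intro sum.cong refl)
      fix n
      have "conv (comp_at f n) (comp_at g 0) (lu b n) = g (sg 0 (scale (f (sg n (lu b n))) 1))"
        using A_hit_scalar[OF A[rule_format] gfun_at[OF f]] by (simp add: functional_hit[OF gfun_at(1)[OF g], symmetric])
      also have "\<dots> = f (sg n (lu b n)) * g 1"
        using linmap_scale[OF gfun_at(1)[OF g], of 0 "f (sg n (lu b n))" 1] by simp
      finally show "(\<Sum>i\<le>n. if i = n then conv (comp_at f n) (comp_at g 0) (lu b n) else 0) = f (sg n (lu b n)) * g 1"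
        by simp
    qed
    also have "\<dots> = f b * g 1"
      by (simp add: gfun_sum[OF f, of b] sum_distrib_right)
    finally show "evf f g (tmap2 (\<lambda>x. x) gr_proj (gc b)) = evf f g (word [b, 1])"
      by (simp add: lin_ext_word[OF vector_space_mult])
  qed
  then show "b \<in> car R" using b by (simp add: coinv_def)
qed

lemma scl_R [simp]: "scl R = ps" and nul_R [simp]: "nul R = nul G"
  by (simp_all add: coinv_def)

lemma car_R_G: "car R \<subseteq> car G"
  using A_W by (auto simp: car_R car_G)

lemma nul_car_R: "nul G \<subseteq> car R"
  unfolding subset_iff car_R nul_G using subsetD[OF W_A] by blast

lemma subspace_R: "module.subspace ps (car R)"
proof -
  interpret p: vector_space ps by (rule vector_space_ps)
  note s = subspace_add[OF subspace_A] subspace_0[OF subspace_A] subspace_scale[OF subspace_A]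
  show ?thesis by (auto intro!: p.subspaceI simp: car_R lookup_add s)
qed

lemma kspace_R: "kspace R"
  using subspace_G(2) subspace_R vector_space_ps nul_car_R by (simp add: kspace_def)

lemma sg_R: "x \<in> A n \<Longrightarrow> sg n x \<in> car R"
  using subspace_0[OF subspace_A] by (simp add: car_R lookup_sg)

lemma R_sum_closed: "(\<And>i. i \<in> I \<Longrightarrow> f i \<in> car R) \<Longrightarrow> sum f I \<in> car R"
  using module.subspace_sum[OF _ subspace_R] vector_space_ps by (auto simp: module_iff_vector_space)

lemma mult_R: "a \<in> car R \<Longrightarrow> b \<in> car R \<Longrightarrow> a * b \<in> car R"
  unfolding mult_sum_single[of a b]
  by (intro R_sum_closed sg_R A_mult) (auto simp: car_R)

lemma one_R: "1 \<in> car R"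
  using sg_R[OF one_A] by simp

lemma R_commute:
  assumes "central \<or> cocentral" "a \<in> car R" "b \<in> car R"
  shows "a * b - b * a \<in> nul G"
proof -
  have "a * b - b * a = (\<Sum>i\<in>keys a. \<Sum>j\<in>keys b. sg (i + j) (lu a i * lu b j - lu b j * lu a i))"
    unfolding mult_sum_single[of a b] mult_sum_single[of b a] sum.swap[of _ "keys b"]
    by (simp add: sum_subtractf single_diff add.commute)
  also have "\<dots> \<in> nul G"
    using assms A_commute by (intro G_sum_closed) (auto simp: car_R)
  finally show ?thesis .
qed

section \<open>The two hypotheses, and the braiding of the coinvariants\<close>

lemma central_mapD:
  assumes "central_map ((full_space scale)\<lparr>car := K\<rparr>) G gr_incl"
  shows central
  unfolding central_def
proof (intro allI ballI)
  fix n x k assume x: "x \<in> W (Suc n)" and k: "k \<in> K"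
  have "keq G (gr_incl k * sg n x) (sg n x * gr_incl k)"
    using assms x k by (simp add: central_map_def)
  then have "sg n (k * x - x * k) \<in> nul G"
    by (simp add: keq_def gr_incl_def mult_single single_diff)
  then show "k * x - x * k \<in> W n" by simp
qed

lemma cocentral_mapD:
  assumes "cocentral_map G gc gr_proj"
  shows cocentral
  unfolding cocentral_def
proof (intro allI ballI impI)
  fix n x f g assume x: "x \<in> W (Suc n)" and fg: "functional f \<and> functional g \<and> perp (W n) g"
  define f' where "f' = (\<lambda>a. f (lu a 0))"
  define g' where "g' = (\<lambda>a. g (lu a n))"
  have f': "gfun f'" and g': "gfun g'"
    unfolding f'_def g'_def using fg by (auto intro: gfun_lookup simp: perp_def linmap_0)
  have fat: "comp_at f' i = (if i = 0 then f else (\<lambda>x. 0))" and gat: "comp_at g' i = (if i = n then g else (\<lambda>x. 0))" for i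
    using linmap_0[of scale "(*)" f] linmap_0[of scale "(*)" g] fg by (auto simp: f'_def g'_def lookup_sg)
  let ?a = "sg n x"
  have a: "?a \<in> car G" using x by simp
  have "keq (tpow G 2) (tmap2 gr_proj (\<lambda>x. x) (gc ?a)) (tmap2 gr_proj (\<lambda>x. x) (tswap (gc ?a)))"
    using assms a by (simp add: cocentral_map_def)
  then have "evf f' g' (tmap2 gr_proj (\<lambda>x. x) (gc ?a)) = evf f' g' (tmap2 gr_proj (\<lambda>x. x) (tswap (gc ?a)))"
    using f' g' by (intro ev2_keq[OF vector_space_mult bilin_on_functionals]) (auto simp: gfun_def)
  then have "evf f' g' (gc ?a) = evf g' f' (gc ?a)"
    unfolding ev2_tmap2[OF vector_space_mult, of "\<lambda>x y. f' x * g' y"]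
      ev2_tswap[OF vector_space_mult, of "\<lambda>x y. f' (gr_proj x) * g' y"]
    by (simp add: f'_def gr_proj_def mult.commute)
  then have eq: "(\<Sum>m\<in>keys ?a. \<Sum>i\<le>m. conv (comp_at f' i) (comp_at g' (m - i)) (lu ?a m))
      = (\<Sum>m\<in>keys ?a. \<Sum>i\<le>m. conv (comp_at g' i) (comp_at f' (m - i)) (lu ?a m))"
    unfolding gr_comult_test[OF a f' g'] gr_comult_test[OF a g' f'] .
  show "conv f g x = conv g f x"
  proof (cases "x = 0")
    case True
    then show ?thesis using fg by (simp add: linmap_0[OF linmap_conv])
  next
    case False
    have "(\<Sum>i\<le>n. conv (comp_at f' i) (comp_at g' (n - i)) x) = (\<Sum>i\<le>n. if i = 0 then conv f g x else 0)"
      by (intro sum.cong refl) (auto simp: fat gat conv_zero)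
    moreover have "(\<Sum>i\<le>n. conv (comp_at g' i) (comp_at f' (n - i)) x) = (\<Sum>i\<le>n. if i = n then conv g f x else 0)"
      by (intro sum.cong refl) (auto simp: fat gat conv_zero)
    ultimately show ?thesis using eq False by simp
  qed
qed

lemma gr_antipode_sg: "gr_antipode antipode (sg 0 z) = sg 0 (antipode z)"
  using linmap_0[OF linmap_antipode] by (simp add: gr_antipode_def)

lemma gr_ad_car:
  assumes k: "k \<in> K" and b: "b \<in> car G"
  shows "gr_ad scale comult antipode K (sg 0 k) b \<in> car G"
  unfolding gr_ad_def lin_ext_def scl_G
proof (rule G_sum_closed)
  interpret p: vector_space ps by (rule vector_space_ps)
  fix w assume "w \<in> keys (gc (sg 0 k))"
  then obtain y z where w: "w = [sg 0 y, sg 0 z]" "y \<in> K" "z \<in> K" by (rule gr_comult_zero_keys[OF k])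
  have "sg 0 y * b * sg 0 (antipode z) \<in> car G"
    using w antipode_K b by (intro mult_car_G) simp_all
  then show "ps (Poly_Mapping.lookup (gc (sg 0 k)) w) (w ! 0 * b * gr_antipode antipode (w ! 1)) \<in> car G"
    using subspace_G(1) w by (simp add: p.subspace_scale gr_antipode_sg)
qed

text \<open>If K is central, y b S(z) may be rewritten as b y S(z), and the antipode collapses: the
  adjoint action of K is trivial.\<close>

lemma sw_ad_central:
  assumes c: central and f: "gfun f" and b: "b \<in> car G" and k: "k \<in> K"
  shows "sw (*) (\<lambda>y z. f (sg 0 y * b * sg 0 (antipode z))) k = counit k * f b"
proof -
  have fl: "linmap ps (*) f" using f by (simp add: gfun_def)
  note L = bilinI linmap_comp[OF fl] linmap_comp[OF linmap_ps_mult(1)] linmap_comp[OF linmap_ps_mult(2)] linmap_sg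
    linmap_comp[OF linmap_sg] linmap_antipode mult_lin vector_space_mult
  have "sw (*) (\<lambda>y z. f (sg 0 y * b * sg 0 (antipode z))) k = sw (*) (\<lambda>y z. f (b * sg 0 (y * antipode z))) k"
  proof (rule sw_K_cong[OF k])
    show "bilin scale (*) (\<lambda>y z. f (sg 0 y * b * sg 0 (antipode z)))"
      by (intro L)
    show "bilin scale (*) (\<lambda>y z. f (b * sg 0 (y * antipode z)))"
      by (intro L)
    fix y z assume y: "y \<in> K" and z: "z \<in> K"
    have "sg 0 y * b - b * sg 0 y = (\<Sum>n\<in>keys b. sg n (y * lu b n - lu b n * y))"
    proof -
      have "sg 0 y * b - b * sg 0 y = sg 0 y * (\<Sum>n\<in>keys b. sg n (lu b n)) - (\<Sum>n\<in>keys b. sg n (lu b n)) * sg 0 y"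
        using poly_mapping_sum_single[of "keys b" b] by simp
      then show ?thesis
        by (simp add: sum_distrib_left sum_distrib_right mult_single sum_subtractf single_diff)
    qed
    also have "\<dots> \<in> nul G"
      using c y b by (intro G_sum_closed) (auto simp: central_def car_GD)
    finally have "(sg 0 y * b - b * sg 0 y) * sg 0 (antipode z) \<in> nul G"
      using antipode_K[OF z] by (intro mult_nul_G) simp_all
    then have "f ((sg 0 y * b - b * sg 0 y) * sg 0 (antipode z)) = 0" using f by (simp add: gfun_def)
    then show "f (sg 0 y * b * sg 0 (antipode z)) = f (b * sg 0 (y * antipode z))"
      by (simp add: left_diff_distrib linmap_diff[OF fl] mult.assoc mult_single)
  qed (rule vector_space_mult)
  also have "\<dots> = counit k * f (b * sg 0 1)"
    by (rule sw_antipode_collapse(2)) (intro L)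
  finally show ?thesis by simp
qed

text \<open>The braiding is the flip for different reasons in the two cases. In the cocentral case
  the coaction is trivial and the adjoint action only meets 1; in the central case the adjoint
  action is trivial and the coaction is absorbed by the counit.\<close>

lemma ad_coact_test:
  assumes cc: "central \<or> cocentral" and a: "a \<in> car R" and b: "b \<in> car R" and f: "gfun f" and g: "gfun g"
  shows "ev2 (*) (\<lambda>x y. f (gr_ad scale comult antipode K x b) * g y) (gr_coact scale comult K a) = f b * g a"
proof -
  have aG: "a \<in> car G" and bG: "b \<in> car G" using a b car_R_G by auto
  have fl: "linmap ps (*) f" using f by (simp add: gfun_def)
  note L = bilinI linmap_comp[OF fl] linmap_comp[OF linmap_ps_mult(1)] linmap_comp[OF linmap_ps_mult(2)] linmap_sg
    linmap_comp[OF linmap_sg] linmap_antipode mult_lin vector_space_mult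
  \<comment> \<open>The functional sending k to f(ad(k) b), extended to H by its Sweedler
    formula.\<close>
  define h where "h k = sw (*) (\<lambda>y z. f (sg 0 y * b * sg 0 (antipode z))) k" for k
  have bh: "bilin scale (*) (\<lambda>y z. f (sg 0 y * b * sg 0 (antipode z)))" by (intro L)
  have h: "functional h" unfolding h_def by (intro linmap_sw vector_space_mult bh)
  have h': "gfun (\<lambda>x. h (lu x 0))"
    using h by (intro gfun_lookup) (auto simp: perp_def linmap_0)
  have hat: "comp_at (\<lambda>x. h (lu x 0)) i = (if i = 0 then h else (\<lambda>x. 0))" for i
    using linmap_0[OF h] by (auto simp: lookup_sg)
  have ad: "f (gr_ad scale comult antipode K (sg 0 k) b) = h k" if "k \<in> K" for k
  proof -
    have "f (gr_ad scale comult antipode K (sg 0 k) b) = ev2 (*) (\<lambda>x y. f (x * b * gr_antipode antipode y)) (gc (sg 0 k))"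
      unfolding gr_ad_def scl_G by (rule linmap_lin_ext_comp[OF fl])
    also have "\<dots> = h k"
      unfolding h_def using gr_comult_zero_test[OF that vector_space_mult, of "\<lambda>x y. f (x * b * gr_antipode antipode y)"] bh
      by (simp add: gr_antipode_sg)
    finally show ?thesis .
  qed
  have "ev2 (*) (\<lambda>x y. f (gr_ad scale comult antipode K x b) * g y) (gr_coact scale comult K a)
     = ev2 (*) (\<lambda>x y. f (gr_ad scale comult antipode K (gr_proj x) b) * g y) (gc a)"
    unfolding gr_coact_def by (rule ev2_tmap2[OF vector_space_mult])
  also have "\<dots> = ev2 (*) (\<lambda>x y. h (lu x 0) * g y) (gc a)"
    by (rule ev2_cong[OF gr_comult_car[OF aG]]) (use car_GD[of _ 0] in \<open>simp add: gr_proj_def ad\<close>)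
  also have "\<dots> = (\<Sum>n\<in>keys a. \<Sum>i\<le>n. if i = 0 then conv h (comp_at g n) (lu a n) else 0)"
    unfolding gr_comult_test[OF aG h' g]
    by (intro sum.cong refl) (auto simp: hat conv_zero)
  also have "\<dots> = (\<Sum>n\<in>keys a. f b * g (sg n (lu a n)))"
  proof (intro sum.cong refl)
    fix n
    let ?x = "lu a n" and ?g = "comp_at g n"
    have x: "?x \<in> A n" using a by (simp add: car_R)
    note gn = gfun_at[OF g, of n]
    have "conv h ?g ?x = f b * ?g ?x"
      using cc
    proof
      assume cocentral
      then have "?g (hit h ?x - scale (h 1) ?x) = 0" using cocentral_hit[OF _ x h] gn(2) by (simp add: perp_def)
      moreover have "h 1 = f b"
        unfolding h_def sw_one[OF vector_space_mult bh] by (simp add: antipode_one)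
      ultimately show ?thesis by (simp add: linmap_diff[OF gn(1)] linmap_scale[OF gn(1)] functional_hit[OF gn(1)])
    next
      assume c: central
      have "conv h ?g ?x = (\<Sum>c\<in>legs B ?x. h c * ?g (hit (cf c) ?x))"
        unfolding conv_def by (intro sw_expand vector_space_mult bilin_functionals B_basis h gn)
      also have "\<dots> = (\<Sum>c\<in>legs B ?x. f b * (counit c * ?g (hit (cf c) ?x)))"
      proof (intro sum.cong refl)
        fix c'
        show "h c' * ?g (hit (cf c') ?x) = f b * (counit c' * ?g (hit (cf c') ?x))"
        proof (cases "c' \<in> K")
          case True
          then show ?thesis using sw_ad_central[OF c f bG True] by (simp add: h_def)
        next
          case False
          then have "hit (cf c') ?x \<in> W n"
            using hit_W[OF A_W[OF x] lc, of 1] cf_perp_W[of c' 1] by simp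
          then have "?g (hit (cf c') ?x) = 0" by (rule perpD[OF gn(2)])
          then show ?thesis by simp
        qed
      qed
      also have "\<dots> = f b * conv counit ?g ?x"
        unfolding conv_def sum_distrib_left[symmetric]
        by (subst sw_expand[OF vector_space_mult bilin_functionals[OF linmap_counit gn(1)] B_basis]) simp
      finally show ?thesis by (simp add: conv_counit gn)
    qed
    then show "(\<Sum>i\<le>n. if i = 0 then conv h ?g ?x else 0) = f b * g (sg n ?x)" by simp
  qed
  also have "\<dots> = f b * g a" by (simp add: gfun_sum[OF g, of a] sum_distrib_left)
  finally show ?thesis .
qed

text \<open>The choice in \<open>coinv_brd\<close> has a solution because the flip of t is one; any
  other solution has the same pairings, hence equals it in the tensor square of the
  coinvariants.\<close>

lemma coinv_brd_swap:
  assumes cc: "central \<or> cocentral" and t: "t \<in> car (tpow R 2)"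
  shows "coinv_brd scale comult antipode K t \<in> car (tpow R 2)"
    "keq (tpow R 2) (coinv_brd scale comult antipode K t) (tswap t)"
proof -
  let ?e = "lin_ext smul (\<lambda>w. lin_ext smul (\<lambda>v. word [gr_ad scale comult antipode K (v ! 0) (w ! 1), v ! 1])
          (gr_coact scale comult K (w ! 0))) t"
  have RG: "car (tpow R 2) \<subseteq> car (tpow G 2)" using car_R_G by (auto simp: car_tpow)
  have st: "tswap t \<in> car (tpow R 2)" by (rule tswap_car[OF t])
  have e: "keq (tpow G 2) (tswap t) ?e"
  proof (rule tpow2_keqI[OF kspace_G])
    show "tswap t \<in> car (tpow G 2)" using st RG by auto
    show "?e \<in> car (tpow G 2)"
    proof (intro lin_ext_car subspace_car_tpow)
      fix w v assume w: "w \<in> keys t" and v: "v \<in> keys (gr_coact scale comult K (w ! 0))"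
      obtain a b where ab: "w = [a, b]" "a \<in> car G" "b \<in> car G"
        using keys_tpow[OF t w] subsetD[OF car_R_G] by (auto simp: length_2_conv)
      \<comment> \<open>\<open>gr_ad_car\<close> needs a first argument of degree zero in K, so the
        coaction is shown to have such left legs.\<close>
      let ?C = "{s :: (nat \<Rightarrow>\<^sub>0 'h) list \<Rightarrow>\<^sub>0 'k. \<forall>w\<in>keys s. \<exists>k d. w = [sg 0 k, d] \<and> k \<in> K \<and> d \<in> car G}"
      have "gr_coact scale comult K a \<in> ?C"
        unfolding gr_coact_def tmap2_def
      proof (rule lin_ext_car)
        show "free.subspace ?C"
          unfolding free_span_words[symmetric] by simp
        fix u assume "u \<in> keys (gc a)"
        then have "length u = 2" "set u \<subseteq> car G" using keys_tpow[OF gr_comult_car[OF ab(2)]] by auto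
        then obtain c d where cd: "u = [c, d]" "c \<in> car G" "d \<in> car G" by (auto simp: length_2_conv)
        have "lu c 0 \<in> K" using car_GD[OF cd(2), of 0] by simp
        then show "word [gr_proj (u ! 0), u ! 1] \<in> ?C" using cd by (auto simp: gr_proj_def)
      qed
      then obtain k d where "v = [sg 0 k, d]" "k \<in> K" "d \<in> car G" using v ab by auto
      then show "word [gr_ad scale comult antipode K (v ! 0) (w ! 1), v ! 1] \<in> car (tpow G 2)"
        using ab gr_ad_car by simp
    qed
    fix f g assume "linmap (scl G) (*) f" "linmap (scl G) (*) g" "\<And>x. x \<in> nul G \<Longrightarrow> f x = 0" "\<And>x. x \<in> nul G \<Longrightarrow> g x = 0"
    then have f: "gfun f" and g: "gfun g" by (auto simp: gfun_def)
    have "evf f g ?e = lin_ext (*) (\<lambda>w. ev2 (*) (\<lambda>x y. f (gr_ad scale comult antipode K x (w ! 1)) * g y) (gr_coact scale comult K (w ! 0))) t"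
      by (simp add: lin_ext_lin_ext[OF vector_space_mult] lin_ext_word[OF vector_space_mult])
    also have "\<dots> = lin_ext (*) (\<lambda>w. f (w ! 1) * g (w ! 0)) t"
    proof (rule lin_ext_cong)
      fix w assume w: "w \<in> keys t"
      then obtain a b where "w = [a, b]" "a \<in> car R" "b \<in> car R"
        using keys_tpow[OF t w] by (auto simp: length_2_conv)
      then show "ev2 (*) (\<lambda>x y. f (gr_ad scale comult antipode K x (w ! 1)) * g y) (gr_coact scale comult K (w ! 0)) = f (w ! 1) * g (w ! 0)"
        using ad_coact_test[OF cc _ _ f g] by simp
    qed
    also have "\<dots> = evf f g (tswap t)"
      by (rule ev2_tswap[OF vector_space_mult, symmetric])
    finally show "evf f g (tswap t) = evf f g ?e" by simp
  qed
  then have "tswap t \<in> car (tpow R 2) \<and> keq (tpow G 2) (tswap t) ?e" using st by simp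
  then have s: "coinv_brd scale comult antipode K t \<in> car (tpow R 2) \<and> keq (tpow G 2) (coinv_brd scale comult antipode K t) ?e"
    unfolding coinv_brd_def by (rule someI)
  then show "coinv_brd scale comult antipode K t \<in> car (tpow R 2)" by simp
  show "keq (tpow R 2) (coinv_brd scale comult antipode K t) (tswap t)"
  proof (rule tpow2_keqI[OF kspace_R _ st])
    fix f g assume fg: "linmap (scl R) (*) f" "linmap (scl R) (*) g" "\<And>x. x \<in> nul R \<Longrightarrow> f x = 0" "\<And>x. x \<in> nul R \<Longrightarrow> g x = 0"
    then have "bilin_on G (*) (\<lambda>x y. f x * g y)" by (intro bilin_on_functionals) auto
    note k = ev2_keq[OF vector_space_mult this]
    show "evf f g (coinv_brd scale comult antipode K t) = evf f g (tswap t)"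
      using k[OF conjunct2[OF s]] k[OF e] by simp
  qed (use s in simp)
qed

end

section \<open>The PBW basis\<close>

context hopf_pbw
begin

sublocale p: vector_space ps by (rule vector_space_ps)

definition letter :: "nat \<times> 'h \<Rightarrow> nat \<Rightarrow>\<^sub>0 'h" where "letter v = sg (fst v) (snd v)"

definition VB :: "(nat \<Rightarrow>\<^sub>0 'h) set" where "VB = letter ` letters"

text \<open>The null space can be {0}, since by \<open>words_independent\<close> the chosen
  generators are independent even modulo \<open>nul G\<close>.\<close>

definition V :: "('k, nat \<Rightarrow>\<^sub>0 'h) bgspace" where
  "V = \<lparr>scl = ps, car = p.span VB, nul = {0}, brd = tswap, grd = (\<lambda>n. p.span (letter ` {v\<in>letters. fst v = n}))\<rparr>"

lemma V_simps [simp]: "scl V = ps" "car V = p.span VB" "nul V = {0}" "brd V = tswap"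
  "grd V = (\<lambda>n. p.span (letter ` {v\<in>letters. fst v = n}))"
  by (simp_all add: V_def)

lemma kspace_V: "kspace V"
  by (simp add: kspace_def vector_space_ps p.span_zero)

lemma VB_R: "VB \<subseteq> car R"
  by (auto simp: VB_def letter_def intro!: sg_R dest!: lettersD)

lemma car_V_R: "car V \<subseteq> car R"
  using VB_R subspace_R by (simp add: p.span_minimal)

lemma kgrading_V: "kgrading V (grd V)"
  unfolding kgrading_def
proof (intro conjI allI impI ballI)
  show "module.subspace (scl V) (grd V n)" "nul V \<subseteq> grd V n" for n
    by (simp_all add: p.span_zero)
  show "grd V n \<subseteq> car V" for n
    by (simp add: VB_def) (intro p.span_mono, auto)
  show "car V = module.span (scl V) (\<Union>n. grd V n)"
  proof
    have "VB \<subseteq> (\<Union>n. grd V n)" by (auto simp: VB_def intro: p.span_base)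
    then show "car V \<subseteq> module.span (scl V) (\<Union>n. grd V n)" by (simp add: p.span_mono)
    have "grd V n \<subseteq> p.span VB" for n by (simp add: VB_def) (intro p.span_mono, auto)
    then show "module.span (scl V) (\<Union>n. grd V n) \<subseteq> car V" by (simp add: p.span_minimal UN_least)
  qed
  fix F and x :: "nat \<Rightarrow> nat \<Rightarrow>\<^sub>0 'h" and n
  assume x: "finite F \<and> (\<forall>n\<in>F. x n \<in> grd V n) \<and> (\<Sum>n\<in>F. x n) \<in> nul V" and n: "n \<in> F"
  \<comment> \<open>Homogeneous elements of V are concentrated in one degree, so a sum is separated
    by looking up one coefficient.\<close>
  have supp: "lu y m = 0" if "y \<in> grd V k" "m \<noteq> k" for y k m
  proof -
    have "p.subspace {a. \<forall>m. m \<noteq> k \<longrightarrow> lu a m = 0}"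
      by (auto intro!: p.subspaceI simp: lookup_add)
    then have "grd V k \<subseteq> {a. \<forall>m. m \<noteq> k \<longrightarrow> lu a m = 0}"
      unfolding V_simps by (rule p.span_minimal[rotated]) (auto simp: letter_def lookup_sg)
    then show ?thesis using that by auto
  qed
  have "x n = 0"
  proof (rule poly_mapping_eqI)
    fix m
    show "lu (x n) m = lu 0 m"
    proof (cases "m = n")
      case True
      have "lu (\<Sum>n\<in>F. x n) n = (\<Sum>k\<in>F. if k = n then lu (x n) n else 0)"
        unfolding lookup_sum using x supp by (intro sum.cong) auto
      then have "lu (x n) n = 0" using x n by simp
      then show ?thesis using True by simp
    next
      case False
      then show ?thesis using supp[of "x n" n m] x n by simp
    qed
  qed
  then show "x n \<in> nul V" by simp
qed

lemma braided_V: "braided_graded_space V"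
  unfolding braided_graded_space_def
proof (intro conjI ballI allI)
  show "khom (tpow V 2) (tpow V 2) (brd V)"
    using tswap_nul[OF kspace_V]
    by (simp add: khom_def tswap_car linmap_add[OF linmap_tswap] linmap_scale[OF linmap_tswap] keq_refl scl_tpow)
  show "brd V ` tsub V (grd V n) (car V) \<subseteq> tsub V (car V) (grd V n)"
    "brd V ` tsub V (car V) (grd V n) \<subseteq> tsub V (grd V n) (car V)" for n
    using tswap_tsub[OF kspace_V] by simp_all
  fix t assume t: "t \<in> car (tpow V 3)"
  let ?c = "brd_at (brd V)"
  have e: "?c 1 (?c 2 (?c 1 (word w))) = ?c 2 (?c 1 (?c 2 (word w)))" if wt: "w \<in> keys t" for w
  proof -
    obtain a b c where w: "w = [a, b, c]"
      using keys_tpow[OF t wt] by (auto simp: length_Suc_conv numeral_3_eq_3)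
    have 1: "brd_at tswap 1 (word [x, y, z]) = word [y, x, z]" "brd_at tswap 2 (word [x, y, z]) = word [x, z, y]"
      for x y z :: "nat \<Rightarrow>\<^sub>0 'h"
      using brd_at_swap[of "[]" x y "[z]"] brd_at_swap[of "[x]" y z "[]"] by (simp_all add: numeral_2_eq_2)
    show ?thesis by (simp add: w 1 del: One_nat_def)
  qed
  have l: "linmap smul smul (\<lambda>t. ?c i (?c j (?c k t)))" for i j k
    by (intro linmap_comp[OF linmap_brd_at] linmap_brd_at)
  have "?c 1 (?c 2 (?c 1 (lin_ext smul word t))) = ?c 2 (?c 1 (?c 2 (lin_ext smul word t)))"
    unfolding linmap_lin_ext_comp[OF l] by (rule lin_ext_cong) (rule e)
  then show "keq (tpow V 3) (?c 1 (?c 2 (?c 1 t))) (?c 2 (?c 1 (?c 2 t)))"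
    by (simp add: lin_ext_word_id keq_refl)
qed (use kspace_V kgrading_V in auto)

lemma prod_list_letters: "prod_list (map letter w) = sg (wt w) (pr w)"
  by (induction w) (auto simp: letter_def mult_single)

text \<open>The coefficient in one degree n turns a relation in the graded algebra into one between
  monomials of weight n in H, where \<open>pr_independent\<close> applies.\<close>

lemma words_independent:
  assumes F: "finite F" "\<And>w. w \<in> F \<Longrightarrow> set w \<subseteq> VB" "inj_on mset F"
    and rel: "(\<Sum>w\<in>F. ps (c w) (prod_list w)) \<in> nul G" and w: "w \<in> F"
  shows "c w = 0"
proof -
  define \<omega> where "\<omega> w = map (inv_into letters letter) w" for w
  have \<omega>: "map letter (\<omega> w) = w" "set (\<omega> w) \<subseteq> letters" if "w \<in> F" for w
    using F(2)[OF that] inv_into_into[of _ letter letters]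
    by (auto simp: \<omega>_def VB_def f_inv_into_f intro!: map_idI)
  define n where "n = wt (\<omega> w)"
  define I where "I = {v\<in>F. wt (\<omega> v) = n}"
  have "lu (\<Sum>w\<in>F. ps (c w) (prod_list w)) n = (\<Sum>v\<in>F. if wt (\<omega> v) = n then scale (c v) (pr (\<omega> v)) else 0)"
    unfolding lookup_sum
  proof (intro sum.cong refl)
    fix v assume "v \<in> F"
    then have "prod_list v = sg (wt (\<omega> v)) (pr (\<omega> v))" using prod_list_letters[of "\<omega> v"] \<omega> by simp
    then show "lu (ps (c v) (prod_list v)) n = (if wt (\<omega> v) = n then scale (c v) (pr (\<omega> v)) else 0)"
      by (simp add: lookup_sg)
  qed
  also have "\<dots> = (\<Sum>v\<in>I. scale (c v) (pr (\<omega> v)))"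
    using F(1) by (simp add: I_def sum.If_cases Int_def)
  finally have "(\<Sum>v\<in>I. scale (c v) (pr (\<omega> v))) \<in> W n" using nul_GD[OF rel, of n] by simp
  then show ?thesis
  proof (rule pr_independent[rotated 3])
    show "inj_on (\<lambda>v. mset (\<omega> v)) I"
    proof (rule inj_onI)
      fix a b assume ab: "a \<in> I" "b \<in> I" "mset (\<omega> a) = mset (\<omega> b)"
      then have "mset (map letter (\<omega> a)) = mset (map letter (\<omega> b))" by simp
      moreover have "a \<in> F" "b \<in> F" using ab by (auto simp: I_def)
      ultimately show "a = b" using inj_onD[OF F(3), of a b] by (simp only: \<omega>(1))
    qed
  qed (use F w \<omega> in \<open>auto simp: I_def n_def\<close>)
qed

section \<open>Evaluating words in the coinvariants\<close>

definition Ev :: "((nat \<Rightarrow>\<^sub>0 'h) list \<Rightarrow>\<^sub>0 'k) \<Rightarrow> nat \<Rightarrow>\<^sub>0 'h" where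
  "Ev = lin_ext ps prod_list"

lemma linmap_Ev: "linmap smul ps Ev"
  unfolding Ev_def by (rule linmap_lin_ext[OF vector_space_ps])

lemma Ev_word [simp]: "Ev (word w) = prod_list w"
  by (simp add: Ev_def lin_ext_word[OF vector_space_ps])

lemma prod_list_R: "set w \<subseteq> car R \<Longrightarrow> prod_list w \<in> car R"
  by (induction w) (auto intro: mult_R one_R)

lemma Ev_car: "t \<in> car (tens V) \<Longrightarrow> Ev t \<in> car R"
  unfolding Ev_def lin_ext_def
proof (intro R_sum_closed)
  fix w assume "t \<in> car (tens V)" "w \<in> keys t"
  then have "set w \<subseteq> car V" by (simp add: car_tens)
  then have "prod_list w \<in> car R" using car_V_R by (intro prod_list_R) blast
  then show "ps (Poly_Mapping.lookup t w) (prod_list w) \<in> car R" by (rule p.subspace_scale[OF subspace_R])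
qed

lemma Ev_tmul: "Ev (tmul p q) = Ev p * Ev q"
proof -
  have "Ev (tmul p q) = lin_ext ps (\<lambda>u. lin_ext ps (\<lambda>v. prod_list u * prod_list v) q) p"
    by (simp add: Ev_def tmul_def lin_ext_lin_ext[OF vector_space_ps] lin_ext_word[OF vector_space_ps])
  also have "\<dots> = lin_ext ps (\<lambda>u. prod_list u * Ev q) p"
    unfolding Ev_def linmap_lin_ext_comp[OF linmap_ps_mult(2)] ..
  also have "\<dots> = Ev p * Ev q"
    using linmap_lin_ext_comp[OF linmap_ps_mult(1)[of "Ev q"], of prod_list p] by (simp add: Ev_def)
  finally show ?thesis .
qed

text \<open>Evaluation factors through the symmetric algebra because coinvariants commute modulo
  \<open>nul G\<close>.\<close>

lemma Ev_sym_nul: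
  assumes "t \<in> sym_nul V"
  shows "Ev t \<in> nul G"
proof -
  have "free.subspace {t. Ev t \<in> nul G}"
    by (rule free.subspaceI)
      (auto simp: linmap_0[OF linmap_Ev] linmap_add[OF linmap_Ev] linmap_scale[OF linmap_Ev]
        intro: p.subspace_0 p.subspace_add p.subspace_scale subspace_G)
  moreover have "Ev t = 0" if "t \<in> nul (tens V)" for t
    unfolding Ev_def
    by (rule lin_ext_tens_rel[OF vector_space_ps _ _ _ that[unfolded nul_tens]])
      (auto simp: distrib_left distrib_right ps_mult)
  then have "nul (tens V) \<subseteq> {t. Ev t \<in> nul G}" using p.subspace_0[OF subspace_G(2)] by auto
  moreover have "Ev (tmul u (tmul (s - brd V s) v)) \<in> nul G"
    if u: "u \<in> car (tens V)" and s: "s \<in> car (tpow V 2)" and v: "v \<in> car (tens V)" for u s v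
  proof -
    have "Ev s - Ev (tswap s) = lin_ext ps (\<lambda>w. prod_list w - prod_list [w ! 1, w ! 0]) s"
      unfolding Ev_def tswap_def lin_ext_lin_ext[OF vector_space_ps] lin_ext_word[OF vector_space_ps]
        lin_ext_fun_diff[OF vector_space_ps] ..
    also have "\<dots> \<in> nul G"
      unfolding lin_ext_def
    proof (intro G_sum_closed p.subspace_scale[OF subspace_G(2)])
      fix w assume w: "w \<in> keys s"
      obtain a b where "w = [a, b]" "a \<in> car R" "b \<in> car R"
        using keys_tpow[OF s w] subsetD[OF car_V_R] by (auto simp: length_2_conv)
      then show "prod_list w - prod_list [w ! 1, w ! 0] \<in> nul G" using R_commute[OF cc] by simp
    qed
    finally have "Ev (s - brd V s) \<in> nul G" by (simp add: linmap_diff[OF linmap_Ev])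
    then show ?thesis
      unfolding Ev_tmul using Ev_car[OF u] Ev_car[OF v] car_R_G by (intro mult_nul_G) auto
  qed
  ultimately have "sym_nul V \<subseteq> {t. Ev t \<in> nul G}"
    unfolding sym_nul_def by (intro free.span_minimal) auto
  then show ?thesis using assms by auto
qed

text \<open>The preimage is a combination of words of weight n, which is what makes the inverse map
  graded.\<close>

lemma Ev_surj_degree:
  assumes "x \<in> A n"
  shows "\<exists>t\<in>free.span {word (map letter w) | w. set w \<subseteq> letters \<and> wt w = n}. Ev t - sg n x \<in> nul G"
  using pr_generate[OF assms]
proof (induction rule: span_induct_alt)
  case base
  show ?case by (rule bexI[of _ 0]) (use p.subspace_0[OF subspace_G(2)] in \<open>auto simp: linmap_0[OF linmap_Ev] free.span_zero\<close>)
next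
  case (step c b y)
  then obtain t where t: "t \<in> free.span {word (map letter w) | w. set w \<subseteq> letters \<and> wt w = n}" "Ev t - sg n y \<in> nul G"
    by blast
  note sg = linmap_add[OF linmap_sg] linmap_scale[OF linmap_sg]
  show ?case
  proof (cases "b \<in> W n")
    case True
    then have "(Ev t - sg n y) - ps c (sg n b) \<in> nul G"
      by (intro p.subspace_diff[OF subspace_G(2) t(2)] p.subspace_scale[OF subspace_G(2)]) simp
    moreover have "Ev t - sg n (scale c b + y) = (Ev t - sg n y) - ps c (sg n b)"
      unfolding sg by (simp only: diff_diff_eq add.commute)
    ultimately have "Ev t - sg n (scale c b + y) \<in> nul G" by (simp only:)
    then show ?thesis using t(1) by blast
  next
    case False
    then obtain w where w: "b = pr w" "set w \<subseteq> letters" "wt w = n" using step.hyps by auto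
    then have wS: "word (map letter w) \<in> {word (map letter w) | w. set w \<subseteq> letters \<and> wt w = n}" by blast
    let ?t = "smul c (word (map letter w)) + t"
    have "?t \<in> free.span {word (map letter w) | w. set w \<subseteq> letters \<and> wt w = n}"
      by (intro free.span_add[OF free.span_scale[OF free.span_base[OF wS]] t(1)])
    moreover have "Ev ?t - sg n (scale c b + y) = Ev t - sg n y"
      using w by (simp add: linmap_add[OF linmap_Ev] linmap_scale[OF linmap_Ev] sg prod_list_letters del: smul_single map_single)
    ultimately show ?thesis using t(2) by (intro bexI[of _ ?t]) simp_all
  qed
qed

lemma span_letters_car:
  "free.span {word (map letter w) | w. set w \<subseteq> letters \<and> wt w = n} \<subseteq> car (tens V)"
proof (rule free.span_minimal[OF _ subspace_car_tens], rule subsetI)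
  fix x :: "(nat \<Rightarrow>\<^sub>0 'h) list \<Rightarrow>\<^sub>0 'k"
  assume "x \<in> {word (map letter w) | w. set w \<subseteq> letters \<and> wt w = n}"
  then obtain w where w: "x = word (map letter w)" "set w \<subseteq> letters" by blast
  have "letter v \<in> car V" if "v \<in> letters" for v using that by (auto simp: VB_def intro: p.span_base)
  then show "x \<in> car (tens V)" using w by (auto simp: car_tens)
qed

lemma Ev_surj:
  assumes "a \<in> car R"
  shows "\<exists>t\<in>car (tens V). Ev t - a \<in> nul G"
proof -
  have "\<forall>n. \<exists>t. t \<in> car (tens V) \<and> Ev t - sg n (lu a n) \<in> nul G"
    using Ev_surj_degree span_letters_car assms by (meson car_R subsetD)
  then obtain t where t: "\<And>n. t n \<in> car (tens V)" "\<And>n. Ev (t n) - sg n (lu a n) \<in> nul G" by metis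
  let ?t = "\<Sum>n\<in>keys a. t n"
  have "Ev ?t - a = (\<Sum>n\<in>keys a. Ev (t n) - sg n (lu a n))"
    using poly_mapping_sum_single[of "keys a" a] by (simp add: linmap_sum[OF linmap_Ev] sum_subtractf)
  also have "\<dots> \<in> nul G" by (intro G_sum_closed t)
  finally show ?thesis
    by (intro bexI[of _ ?t]) (auto intro: free.subspace_sum[OF subspace_car_tens] t)
qed

definition sorted_words :: "((nat \<Rightarrow>\<^sub>0 'h) \<times> (nat \<Rightarrow>\<^sub>0 'h)) set \<Rightarrow> (nat \<Rightarrow>\<^sub>0 'h) list set" where
  "sorted_words r = {w. set w \<subseteq> VB \<and> sorted_wrt (\<lambda>x y. (x, y) \<in> r) w}"

lemma inj_on_mset_sorted:
  assumes "well_order_on VB r" "F \<subseteq> sorted_words r"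
  shows "inj_on mset F"
proof (rule inj_onI)
  fix a b assume "a \<in> F" "b \<in> F" "mset a = mset b"
  moreover have "antisym r" using assms(1) by (simp add: well_order_on_def linear_order_on_def partial_order_on_def)
  ultimately show "a = b" using sorted_unique[of r a b] assms(2) by (auto simp: sorted_words_def)
qed

lemma sorted_words_independent:
  assumes "well_order_on VB r" "finite F" "F \<subseteq> sorted_words r" "(\<Sum>w\<in>F. ps (c w) (prod_list w)) \<in> nul G" "w \<in> F"
  shows "c w = 0"
  by (rule words_independent[OF assms(2) _ inj_on_mset_sorted[OF assms(1,3)] assms(4,5)])
    (use assms(3) in \<open>auto simp: sorted_words_def\<close>)

lemma VB_car: "VB \<subseteq> car V" "car V \<subseteq> module.span (scl V) VB"
  by (simp_all add: p.span_superset)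

text \<open>Sorted words span the symmetric algebra and have independent values. The well-order is
  an auxiliary choice here.\<close>

lemma Ev_inj:
  assumes t: "t \<in> car (tens V)" and 0: "Ev t \<in> nul G"
  shows "t \<in> sym_nul V"
proof -
  obtain r where r: "well_order_on VB r" using well_order_on by blast
  obtain s where s: "s \<in> free.span {word w | w. set w \<subseteq> VB \<and> sorted_wrt (\<lambda>x y. (x, y) \<in> r) w}" "t - s \<in> sym_nul V"
    using sym_generated[OF kspace_V _ VB_car r t] by auto
  have keys: "keys s \<subseteq> sorted_words r"
    using s(1) unfolding free_span_words by (auto simp: sorted_words_def)
  have "Ev t - Ev (t - s) \<in> nul G"
    by (rule p.subspace_diff[OF subspace_G(2) 0 Ev_sym_nul[OF s(2)]])
  then have "Ev s \<in> nul G" by (simp add: linmap_diff[OF linmap_Ev])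
  then have "(\<Sum>w\<in>keys s. ps (Poly_Mapping.lookup s w) (prod_list w)) \<in> nul G"
    by (simp add: Ev_def lin_ext_def)
  then have "Poly_Mapping.lookup s w = 0" if "w \<in> keys s" for w
    using sorted_words_independent[OF r _ keys] that by simp
  then have "s = 0" by (intro poly_mapping_eqI) (auto simp: in_keys_iff)
  then show ?thesis using s by simp
qed

lemma Ev_eqD:
  assumes "t \<in> car (tens V)" "t' \<in> car (tens V)" "Ev t - Ev t' \<in> nul G"
  shows "t - t' \<in> sym_nul V"
  by (rule Ev_inj[OF free.subspace_diff[OF subspace_car_tens assms(1,2)]])
    (use assms(3) in \<open>simp add: linmap_diff[OF linmap_Ev]\<close>)

text \<open>The required isomorphism goes from the coinvariants to the symmetric algebra, against
  \<open>Ev\<close>, so a preimage is chosen for each coinvariant. It is linear and multiplicative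
  only up to \<open>sym_nul V\<close>, which is all that a map between quotients requires.\<close>

definition lft :: "(nat \<Rightarrow>\<^sub>0 'h) \<Rightarrow> ((nat \<Rightarrow>\<^sub>0 'h) list \<Rightarrow>\<^sub>0 'k)" where
  "lft a = (SOME t. t \<in> car (tens V) \<and> Ev t - a \<in> nul G)"

lemma lft: "a \<in> car R \<Longrightarrow> lft a \<in> car (tens V)" "a \<in> car R \<Longrightarrow> Ev (lft a) - a \<in> nul G"
  using someI_ex[of "\<lambda>t. t \<in> car (tens V) \<and> Ev t - a \<in> nul G"] Ev_surj[of a] unfolding lft_def by blast+

lemma lft_eq:
  assumes "a \<in> car R" "t \<in> car (tens V)" "Ev t - a \<in> nul G"
  shows "lft a - t \<in> sym_nul V"
proof (rule Ev_eqD[OF lft(1)[OF assms(1)] assms(2)])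
  have "(Ev (lft a) - a) - (Ev t - a) \<in> nul G"
    by (rule p.subspace_diff[OF subspace_G(2) lft(2)[OF assms(1)] assms(3)])
  then show "Ev (lft a) - Ev t \<in> nul G" by simp
qed

abbreviation C where "C \<equiv> coinv_alg scale comult antipode K"

lemma C_simps [simp]: "scl C = ps" "car C = car R" "nul C = nul G" "brd C = coinv_brd scale comult antipode K"
  "mlt C = (*)" "unt C = 1"
  by (simp_all add: coinv_alg_def)

lemma SA_simps [simp]: "scl (sym_alg V) = smul" "car (sym_alg V) = car (tens V)" "nul (sym_alg V) = sym_nul V"
  "brd (sym_alg V) = tens_brd tswap" "mlt (sym_alg V) = tmul" "unt (sym_alg V) = word []"
  by (simp_all add: sym_alg_def)

lemma khom_lft: "khom C (sym_alg V) lft"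
  unfolding khom_def
proof (intro conjI ballI allI)
  show "lft x \<in> car (sym_alg V)" if "x \<in> car C" for x using that lft by simp
  show "keq (sym_alg V) (lft (x + y)) (lft x + lft y)" if "x \<in> car C" "y \<in> car C" for x y
  proof -
    have xy: "x \<in> car R" "y \<in> car R" using that by simp_all
    have "(Ev (lft x) - x) + (Ev (lft y) - y) \<in> nul G"
      by (intro p.subspace_add[OF subspace_G(2)] lft xy)
    then show ?thesis unfolding keq_def SA_simps
      using xy by (intro lft_eq p.subspace_add[OF subspace_R] free.subspace_add[OF subspace_car_tens] lft)
        (simp_all add: linmap_add[OF linmap_Ev] algebra_simps)
  qed
  show "keq (sym_alg V) (lft (scl C c x)) (scl (sym_alg V) c (lft x))" if "x \<in> car C" for c x
  proof -
    have x: "x \<in> car R" using that by simp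
    have "ps c (Ev (lft x) - x) \<in> nul G"
      by (intro p.subspace_scale[OF subspace_G(2)] lft x)
    then show ?thesis unfolding keq_def SA_simps C_simps
      using x by (intro lft_eq p.subspace_scale[OF subspace_R] free.subspace_scale[OF subspace_car_tens] lft)
        (simp_all add: linmap_scale[OF linmap_Ev] p.scale_right_diff_distrib)
  qed
  show "lft x \<in> nul (sym_alg V)" if "x \<in> nul C" for x
  proof -
    have x: "x \<in> nul G" "x \<in> car R" using that nul_car_R by auto
    have "Ev 0 - x \<in> nul G" using p.subspace_neg[OF subspace_G(2) x(1)] by (simp add: linmap_0[OF linmap_Ev])
    then show ?thesis using lft_eq[OF x(2) free.subspace_0[OF subspace_car_tens]] by simp
  qed
qed

text \<open>Both braidings are flips up to null tensors, so comparing pairings suffices. A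
  functional vanishing on \<open>sym_nul V\<close>, composed with \<open>lft\<close>, is additive on
  the coinvariants, which is what \<open>bilin_on\<close> asks.\<close>

lemma lft_braid:
  assumes t: "t \<in> car (tpow C 2)"
  shows "keq (tpow (sym_alg V) 2) (tmap2 lft lft (brd C t)) (brd (sym_alg V) (tmap2 lft lft t))"
proof -
  have tR: "t \<in> car (tpow R 2)" using t by (simp add: car_tpow)
  note cb = coinv_brd_swap[OF cc tR]
  have lftc: "lft x \<in> car (sym_alg V)" if "x \<in> car R" for x using that lft by simp
  show ?thesis
  proof (rule tpow2_keqI)
    show "kspace (sym_alg V)" by (rule kspace_sym_alg[OF kspace_V]) simp
    show "tmap2 lft lft (brd C t) \<in> car (tpow (sym_alg V) 2)"
      using tmap2_car[OF cb(1) lftc lftc] by simp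
    have "tmap2 lft lft t \<in> car (tpow (sym_alg V) 2)"
      by (rule tmap2_car[OF tR lftc lftc])
    then show "brd (sym_alg V) (tmap2 lft lft t) \<in> car (tpow (sym_alg V) 2)"
      unfolding SA_simps by (rule tens_brd_swap_car)
    fix f g assume fg: "linmap (scl (sym_alg V)) (*) f" "linmap (scl (sym_alg V)) (*) g"
      "\<And>x. x \<in> nul (sym_alg V) \<Longrightarrow> f x = 0" "\<And>x. x \<in> nul (sym_alg V) \<Longrightarrow> g x = 0"
    have lin: "h (lft (x + y)) = h (lft x) + h (lft y)" "h (lft (ps c x)) = c * h (lft x)" "z \<in> nul G \<Longrightarrow> h (lft z) = 0"
      if h: "linmap smul (*) h" "\<And>x. x \<in> sym_nul V \<Longrightarrow> h x = 0" and xy: "x \<in> car R" "y \<in> car R" for h x y c z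
    proof -
      have "h (lft (x + y) - (lft x + lft y)) = 0" "h (lft (ps c x) - smul c (lft x)) = 0"
        using khom_lft xy unfolding khom_def keq_def by (auto intro!: h(2))
      then show "h (lft (x + y)) = h (lft x) + h (lft y)" "h (lft (ps c x)) = c * h (lft x)"
        by (simp_all add: linmap_diff[OF h(1)] linmap_add[OF h(1)] linmap_scale[OF h(1)])
      show "h (lft z) = 0" if "z \<in> nul G"
        using khom_lft that unfolding khom_def by (auto intro!: h(2))
    qed
    have bl: "bilin_on R (*) (\<lambda>x y. f (lft x) * g (lft y))"
      unfolding bilin_on_def using lin[of f] lin[of g] fg by (simp add: algebra_simps)
    have "evf f g (tmap2 lft lft (brd C t)) = ev2 (*) (\<lambda>x y. f (lft x) * g (lft y)) (tswap t)"
      unfolding ev2_tmap2[OF vector_space_mult, of "\<lambda>x y. f x * g y"] C_simps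
      by (rule ev2_keq[OF vector_space_mult bl cb(2)])
    also have "\<dots> = ev2 (*) (\<lambda>x y. f y * g x) (tmap2 lft lft t)"
      unfolding ev2_tmap2[OF vector_space_mult, of "\<lambda>x y. f y * g x"]
        ev2_tswap[OF vector_space_mult, of "\<lambda>x y. f (lft x) * g (lft y)"] ..
    also have "\<dots> = evf f g (brd (sym_alg V) (tmap2 lft lft t))"
      unfolding SA_simps by (rule ev2_tens_brd_swap[symmetric]) (use fg in simp_all)
    finally show "evf f g (tmap2 lft lft (brd C t)) =
      evf f g (brd (sym_alg V) (tmap2 lft lft t))" .
  qed
qed

text \<open>The chosen lift need not be homogeneous itself, but it differs by an element of
  \<open>sym_nul V\<close> from a preimage of weight n, and the graded pieces contain
  \<open>sym_nul V\<close>.\<close>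

lemma lft_grd: "lft ` grd C n \<subseteq> grd (sym_alg V) n"
proof
  fix s assume "s \<in> lft ` grd C n"
  then obtain a where a: "s = lft a" "a \<in> car R" "\<And>m. m \<noteq> n \<Longrightarrow> lu a m \<in> W m"
    by (auto simp: coinv_alg_def)
  have "lu a n \<in> A n" using a(2) by (simp add: car_R)
  then obtain t where t: "t \<in> free.span {word (map letter w) | w. set w \<subseteq> letters \<and> wt w = n}" "Ev t - sg n (lu a n) \<in> nul G"
    using Ev_surj_degree by blast
  have "sg n (lu a n) - a \<in> nul G"
    using a(3) subspace_neg[OF subspace_W] subspace_0[OF subspace_W] by (auto simp: nul_G lookup_minus lookup_sg)
  then have "(Ev t - sg n (lu a n)) + (sg n (lu a n) - a) \<in> nul G"
    by (rule p.subspace_add[OF subspace_G(2) t(2)])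
  then have "lft a - t \<in> sym_nul V" using t(1) span_letters_car by (intro lft_eq a) auto
  let ?L = "{word w | w d. list_all2 (\<lambda>x i. x \<in> grd V i) w d \<and> sum_list d = n} :: ((nat \<Rightarrow>\<^sub>0 'h) list \<Rightarrow>\<^sub>0 'k) set"
  have "{word (map letter w) | w. set w \<subseteq> letters \<and> wt w = n} \<subseteq> ?L"
  proof
    fix x :: "(nat \<Rightarrow>\<^sub>0 'h) list \<Rightarrow>\<^sub>0 'k"
    assume "x \<in> {word (map letter w) | w. set w \<subseteq> letters \<and> wt w = n}"
    then obtain w where w: "x = word (map letter w)" "set w \<subseteq> letters" "wt w = n" by blast
    have "list_all2 (\<lambda>x i. x \<in> grd V i) (map letter w) (map fst w)"
      using w(2) by (induction w) (auto intro: p.span_base)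
    moreover have "sum_list (map fst w) = n" using w(3) by (simp add: wt_def)
    ultimately show "x \<in> ?L" using w(1) by blast
  qed
  then have "t \<in> free.span (sym_nul V \<union> ?L)"
    using t(1) free.span_mono[of _ "sym_nul V \<union> ?L"] by blast
  moreover have "lft a - t \<in> free.span (sym_nul V \<union> ?L)"
    using \<open>lft a - t \<in> sym_nul V\<close> by (intro free.span_base) simp
  ultimately have "t + (lft a - t) \<in> free.span (sym_nul V \<union> ?L)" by (rule free.span_add)
  then show "s \<in> grd (sym_alg V) n" by (simp add: a(1) sym_alg_def)
qed

lemma iso_lft: "bgalg_iso C (sym_alg V) lft"
  unfolding bgalg_iso_def
proof (intro conjI ballI allI impI)
  show "khom C (sym_alg V) lft" by (rule khom_lft)
  show "x \<in> nul C" if "x \<in> car C" "lft x \<in> nul (sym_alg V)" for x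
  proof -
    have "Ev (lft x) - (Ev (lft x) - x) \<in> nul G"
      using that by (intro p.subspace_diff[OF subspace_G(2)] Ev_sym_nul lft) simp_all
    then show ?thesis by simp
  qed
  show "\<exists>x\<in>car C. keq (sym_alg V) (lft x) y" if "y \<in> car (sym_alg V)" for y
    using that Ev_car lft_eq[of "Ev y" y] p.subspace_0[OF subspace_G(2)]
    by (intro bexI[of _ "Ev y"]) (simp_all add: keq_def)
  show "keq (sym_alg V) (lft (unt C)) (unt (sym_alg V))"
    using lft_eq[OF one_R, of "word []"] p.subspace_0[OF subspace_G(2)] by (simp add: keq_def car_tens)
  show "keq (sym_alg V) (lft (mlt C x y)) (mlt (sym_alg V) (lft x) (lft y))" if "x \<in> car C" "y \<in> car C" for x y
  proof -
    have xy: "x \<in> car R" "y \<in> car R" using that by simp_all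
    have "(Ev (lft x) - x) * Ev (lft y) + x * (Ev (lft y) - y) \<in> nul G"
      using xy subsetD[OF car_R_G] by (intro p.subspace_add[OF subspace_G(2)] mult_nul_G lft) (auto intro: Ev_car lft)
    then show ?thesis unfolding keq_def SA_simps C_simps
      using xy by (intro lft_eq mult_R tmul_car lft) (simp_all add: Ev_tmul algebra_simps)
  qed
  show "lft ` grd C n \<subseteq> grd (sym_alg V) n" for n by (rule lft_grd)
  show "keq (tpow (sym_alg V) 2) (tmap2 lft lft (brd C t)) (brd (sym_alg V) (tmap2 lft lft t))"
    if "t \<in> car (tpow C 2)" for t using that by (rule lft_braid)
qed

section \<open>The bases of V and of its symmetric algebra\<close>

lemma kbasis_V: "kbasis V VB"
  unfolding kbasis_def
proof (intro conjI allI impI ballI)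
  show "VB \<subseteq> car V" by (rule VB_car)
  show "\<exists>y\<in>module.span (scl V) VB. keq V x y" if "x \<in> car V" for x
    using that by (intro bexI[of _ x]) (simp_all add: keq_def)
  fix F c b assume F: "finite F \<and> F \<subseteq> VB \<and> (\<Sum>b\<in>F. scl V (c b) b) \<in> nul V" and b: "b \<in> F"
  have inj: "inj_on (\<lambda>b. [b]) F" by (auto simp: inj_on_def)
  have "(\<lambda>w. c (hd w)) [b] = 0"
  \<comment> \<open>Elements of \<open>VB\<close> are seen as words of one letter.\<close>
  proof (rule words_independent[where F = "(\<lambda>b. [b]) ` F"])
    show "(\<Sum>w\<in>(\<lambda>b. [b]) ` F. ps (c (hd w)) (prod_list w)) \<in> nul G"
      using F p.subspace_0[OF subspace_G(2)] by (simp add: sum.reindex[OF inj])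
    show "inj_on mset ((\<lambda>b. [b]) ` F)" by (auto simp: inj_on_def)
  qed (use F b in auto)
  then show "c b = 0" by simp
qed

lemma kbasis_sym:
  assumes r: "well_order_on VB r"
  shows "kbasis (sym_alg V) {word w | w. set w \<subseteq> VB \<and> sorted_wrt (\<lambda>x y. (x, y) \<in> r) w}"
  unfolding kbasis_def
proof (intro conjI allI impI ballI)
  let ?S = "{word w | w. set w \<subseteq> VB \<and> sorted_wrt (\<lambda>x y. (x, y) \<in> r) w} :: ((nat \<Rightarrow>\<^sub>0 'h) list \<Rightarrow>\<^sub>0 'k) set"
  show "?S \<subseteq> car (sym_alg V)" using p.span_superset[of VB] by (auto simp: car_tens)
  show "\<exists>y\<in>module.span (scl (sym_alg V)) ?S. keq (sym_alg V) x y" if "x \<in> car (sym_alg V)" for x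
    using sym_generated[OF kspace_V _ VB_car r, of x] that by (simp add: keq_def)
  fix F c b assume F: "finite F \<and> F \<subseteq> ?S \<and> (\<Sum>b\<in>F. scl (sym_alg V) (c b) b) \<in> nul (sym_alg V)" and b: "b \<in> F"
  \<comment> \<open>The relation between vectors \<open>word w\<close> is carried over to the words
    themselves.\<close>
  define F' where "F' = {w. word w \<in> F}"
  have inj: "inj_on word F'" for F' :: "(nat \<Rightarrow>\<^sub>0 'h) list set"
    by (rule inj_onI) (metis keys_single singleton_inject zero_neq_one)
  have FF': "F = word ` F'" using F by (auto simp: F'_def)
  have "F' \<subseteq> sorted_words r"
  proof
    fix w assume "w \<in> F'"
    then have "word w \<in> ?S" using F FF' by blast
    then obtain w' where w': "word w = (word w' :: (nat \<Rightarrow>\<^sub>0 'h) list \<Rightarrow>\<^sub>0 'k)" "w' \<in> sorted_words r"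
      by (auto simp: sorted_words_def)
    then show "w \<in> sorted_words r" using inj_onD[OF inj[of UNIV] w'(1)] by simp
  qed
  moreover have "finite F'" using F inj[of F'] unfolding FF' by (blast dest: finite_imageD)
  moreover have "Ev (\<Sum>b\<in>F. smul (c b) b) \<in> nul G" using F by (intro Ev_sym_nul) simp
  then have "(\<Sum>w\<in>F'. ps (c (word w)) (prod_list w)) \<in> nul G"
    unfolding linmap_sum[OF linmap_Ev] linmap_scale[OF linmap_Ev] FF' sum.reindex[OF inj] o_def Ev_word .
  moreover obtain w where "w \<in> F'" "b = word w" using b FF' by blast
  ultimately show "c b = 0"
    using sorted_words_independent[OF r, of F' "\<lambda>w. c (word w)" w] by simp
qed

lemma PBW: "has_PBW_basis scale comult antipode K"
proof -
  obtain r where r: "well_order_on VB r" using well_order_on by blast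
  show ?thesis
    unfolding has_PBW_basis_def
    using braided_V iso_lft kbasis_V kbasis_sym[OF r] r by blast
qed

end

theorem corollary2p4:
  fixes scale :: "'k::field_char_0 \<Rightarrow> 'h::ring_1 \<Rightarrow> 'h"
    and \<Delta> :: "'h \<Rightarrow> ('h list \<Rightarrow>\<^sub>0 'k)"
    and \<epsilon> :: "'h \<Rightarrow> 'k"
    and S :: "'h \<Rightarrow> 'h"
    and K :: "'h set"
  assumes "hopf_algebra scale \<Delta> \<epsilon> S"
    and "hopf_subalgebra scale \<Delta> S K"
    and "coradical scale \<Delta> \<subseteq> K"
    and "central_map ((full_space scale)\<lparr>car := K\<rparr>) (gr scale \<Delta> K) gr_incl
       \<or> cocentral_map (gr scale \<Delta> K) (gr_comult scale \<Delta> K) gr_proj"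
  shows "has_PBW_basis scale \<Delta> S K"
proof -
  interpret hopf_pair scale \<Delta> \<epsilon> S K
    using assms(1,2) by (simp add: hopf_pair_def hopf_pair_axioms_def)
  obtain B where "adapted B" using ex_adapted by blast
  then interpret hopf_pair_basis scale \<Delta> \<epsilon> S K B by unfold_locales
  have "central \<or> cocentral" using assms(4) central_mapD cocentral_mapD by blast
  then interpret hopf_pbw scale \<Delta> \<epsilon> S K B by unfold_locales
  show ?thesis by (rule PBW)
qed

end
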